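(* Let $\Gamma$ be a compact quantum graph with a distinguished vertex $v$ at which the $\delta$-type vertex condition with parameter $\alpha\ne\infty$ (i.e. $\alpha\in\mathbb{R}$) is imposed, the conditions at all other vertices being fixed. Let $\lambda=\lambda(\alpha)$ be a simple eigenvalue of $\Gamma$ and $f$ the corresponding $L_2$-normalized eigenfunction. Then $$\frac{d\lambda}{d\alpha}=|f(v)|^2.$$ If the conditions at $v$ are re-parameterized as: $f$ is continuous at $v$ and $$\zeta\sum_{e\in\mathcal{E}_v}\frac{df}{dx_e}(v)=-f(v),$$ with $\zeta\in\mathbb{R}$, now allowing the Dirichlet condition ($\zeta=0$) and excluding the Neumann condition ($\zeta=\infty$), then for a simple eigenvalue $\lambda=\lambda(\zeta)$ with normalized eigenfunction $f$ the derivative is $$\frac{d\lambda}{d\zeta}=\left|\sum_{e\in\mathcal{E}_v}\frac{df}{dx_e}(v)\right|^2.$$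
   Context: A compact quantum graph is a metric graph with finitely many vertices and edges, each edge $e$ being a segment of finite positive length, equipped with the operator $\mathcal{H}$ acting as $-d^2/dx^2+V(x)$ on each edge, where $V\in L_2(\Gamma)$ is real-valued, on functions that belong to $H^2(e)$ on each edge $e$ and satisfy local self-adjoint vertex conditions. Self-adjoint conditions at a vertex $w$ of degree $d_w$ are conditions $A_wF(w)+B_wF'(w)=0$, where $F(w)$ and $F'(w)$ are the column vectors of values and of derivatives of $f$ at $w$ along the incident edges, $A_w,B_w$ are $d_w\times d_w$ complex matrices, $(A_w\ B_w)$ has rank $d_w$ and $A_wB_w^*$ is self-adjoint. Eigenvalues of $\Gamma$ are eigenvalues of $\mathcal{H}$. $\mathcal{E}_v$ is the set of edges incident to $v$; derivatives $\frac{df}{dx_e}(v)$ at a vertex are taken away from the vertex and into the edge. The $\delta$-type condition at $v$ with parameter $\alpha\in\mathbb{R}$ is: $f$ is continuous at $v$ (all values of $f$ at $v$ along incident edges agree) and $\sum_{e\in\mathcal{E}_v}\frac{df}{dx_e}(v)=\alpha f(v)$. The Dirichlet condition is $f(v)=0$ along all incident edges (formally $\alpha=\infty$); the Neumann condition is $\alpha=0$. *)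

theory Defs
  imports
    "HOL-Analysis.Analysis"
    "Jordan_Normal_Form.DL_Rank"
    "Jordan_Normal_Form.Schur_Decomposition"
begin

section \<open>Compact quantum graphs\<close>

text \<open>
  Edge \<open>e\<close> is the segment \<open>[0, len \<Gamma> e]\<close> with \<open>0\<close> glued to \<open>source \<Gamma> e\<close> and \<open>len \<Gamma> e\<close> glued to
  \<open>target \<Gamma> e\<close>. Loops and multiple edges are allowed. Incidences at a vertex are edge ends, so that a
  loop is incident to its vertex twice and the degree counts it twice.

  A vertex condition is a relation between the values \<open>F\<close> and the derivatives \<open>F'\<close> along the
  incident ends; only the entries at these ends matter.
\<close>

datatype side = Source | Target

type_synonym 'e vertex_condition =
  "('e \<times> side \<Rightarrow> complex) \<Rightarrow> ('e \<times> side \<Rightarrow> complex) \<Rightarrow> bool"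

record ('v, 'e) quantum_graph =
  verts :: "'v set"
  edges :: "'e set"
  source :: "'e \<Rightarrow> 'v"
  target :: "'e \<Rightarrow> 'v"
  len :: "'e \<Rightarrow> real"
  potential :: "'e \<Rightarrow> real \<Rightarrow> real"
  vertex_cond :: "'v \<Rightarrow> 'e vertex_condition"

definition incident_ends :: "('v, 'e) quantum_graph \<Rightarrow> 'v \<Rightarrow> ('e \<times> side) set" where
  "incident_ends \<Gamma> w =
     {(e, Source) | e. e \<in> edges \<Gamma> \<and> source \<Gamma> e = w} \<union>
     {(e, Target) | e. e \<in> edges \<Gamma> \<and> target \<Gamma> e = w}"

text \<open>
  The enumeration \<open>ps\<close> of the incident ends fixes the order of the entries of the column vectors
  \<open>F(w)\<close>, \<open>F'(w)\<close>. The condition is \<open>A F + B F' = 0\<close>, and the matrix \<open>(A B)\<close> is obtained by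
  juxtaposing the columns of \<open>A\<close> and \<open>B\<close>.
\<close>

definition self_adjoint_condition :: "('e \<times> side) set \<Rightarrow> 'e vertex_condition \<Rightarrow> bool" where
  "self_adjoint_condition P C \<longleftrightarrow>
     (\<exists>ps d A B.
        distinct ps \<and> set ps = P \<and> d = length ps \<and>
        A \<in> carrier_mat d d \<and> B \<in> carrier_mat d d \<and>
        vec_space.rank d (mat_of_cols d (cols A @ cols B)) = d \<and>
        mat_adjoint (A * mat_adjoint B) = A * mat_adjoint B \<and>
        (\<forall>F F'. C F F' \<longleftrightarrow>
           A *\<^sub>v vec_of_list (map F ps) + B *\<^sub>v vec_of_list (map F' ps) = 0\<^sub>v d))"

definition square_integrable :: "real \<Rightarrow> (real \<Rightarrow> 'a::{banach, second_countable_topology}) \<Rightarrow> bool" where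
  "square_integrable L h \<longleftrightarrow>
     set_borel_measurable lebesgue {0..L} h \<and>
     set_integrable lebesgue {0..L} (\<lambda>x. (norm (h x))\<^sup>2)"

definition compact_quantum_graph :: "('v, 'e) quantum_graph \<Rightarrow> bool" where
  "compact_quantum_graph \<Gamma> \<longleftrightarrow>
     finite (verts \<Gamma>) \<and> finite (edges \<Gamma>) \<and>
     (\<forall>e\<in>edges \<Gamma>. source \<Gamma> e \<in> verts \<Gamma> \<and> target \<Gamma> e \<in> verts \<Gamma> \<and> 0 < len \<Gamma> e \<and>
        square_integrable (len \<Gamma> e) (potential \<Gamma> e)) \<and>
     (\<forall>w\<in>verts \<Gamma>. self_adjoint_condition (incident_ends \<Gamma> w) (vertex_cond \<Gamma> w))"

section \<open>The operator and its eigenvalues\<close>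

text \<open>
  \<open>second_weak_derivative L f h\<close> says that \<open>f\<close> is (the continuously differentiable representative of)
  an element of \<open>H\<^sup>2(0, L)\<close> and \<open>h\<close> is its second weak derivative: \<open>f'\<close> exists on \<open>[0, L]\<close> (one-sided at
  the endpoints) and is the indefinite integral of \<open>h\<close>, which is in \<open>L\<^sub>2\<close>. Values of \<open>f\<close> outside
  \<open>[0, L]\<close> are irrelevant.
\<close>

definition second_weak_derivative :: "real \<Rightarrow> (real \<Rightarrow> complex) \<Rightarrow> (real \<Rightarrow> complex) \<Rightarrow> bool" where
  "second_weak_derivative L f h \<longleftrightarrow>
     square_integrable L h \<and>
     (\<exists>g. (\<forall>x\<in>{0..L}. (f has_vector_derivative g x) (at x within {0..L})) \<and>
          (\<forall>x\<in>{0..L}. g x = g 0 + (LINT t:{0..x}|lebesgue. h t)))"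

definition sobolev_H2 :: "real \<Rightarrow> (real \<Rightarrow> complex) set" where
  "sobolev_H2 L = {f. \<exists>h. second_weak_derivative L f h}"

text \<open>Determined only up to a null set.\<close>

definition second_deriv :: "real \<Rightarrow> (real \<Rightarrow> complex) \<Rightarrow> real \<Rightarrow> complex" where
  "second_deriv L f = (SOME h. second_weak_derivative L f h)"

fun end_value :: "('v, 'e) quantum_graph \<Rightarrow> ('e \<Rightarrow> real \<Rightarrow> complex) \<Rightarrow> 'e \<times> side \<Rightarrow> complex" where
  "end_value \<Gamma> f (e, Source) = f e 0"
| "end_value \<Gamma> f (e, Target) = f e (len \<Gamma> e)"

text \<open>The derivative at an edge end is taken away from the vertex and into the edge.\<close>

fun end_deriv :: "('v, 'e) quantum_graph \<Rightarrow> ('e \<Rightarrow> real \<Rightarrow> complex) \<Rightarrow> 'e \<times> side \<Rightarrow> complex" where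
  "end_deriv \<Gamma> f (e, Source) = vector_derivative (f e) (at 0 within {0..len \<Gamma> e})"
| "end_deriv \<Gamma> f (e, Target) = - vector_derivative (f e) (at (len \<Gamma> e) within {0..len \<Gamma> e})"

definition hamiltonian_domain :: "('v, 'e) quantum_graph \<Rightarrow> ('e \<Rightarrow> real \<Rightarrow> complex) set" where
  "hamiltonian_domain \<Gamma> =
     {f. (\<forall>e\<in>edges \<Gamma>. f e \<in> sobolev_H2 (len \<Gamma> e)) \<and>
         (\<forall>w\<in>verts \<Gamma>. vertex_cond \<Gamma> w (end_value \<Gamma> f) (end_deriv \<Gamma> f))}"

definition hamiltonian :: "('v, 'e) quantum_graph \<Rightarrow> ('e \<Rightarrow> real \<Rightarrow> complex) \<Rightarrow> 'e \<Rightarrow> real \<Rightarrow> complex" where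
  "hamiltonian \<Gamma> f e x =
     - second_deriv (len \<Gamma> e) (f e) x + complex_of_real (potential \<Gamma> e x) * f e x"

definition eigenfunction ::
  "('v, 'e) quantum_graph \<Rightarrow> complex \<Rightarrow> ('e \<Rightarrow> real \<Rightarrow> complex) \<Rightarrow> bool" where
  "eigenfunction \<Gamma> z f \<longleftrightarrow>
     f \<in> hamiltonian_domain \<Gamma> \<and>
     (\<exists>e\<in>edges \<Gamma>. \<exists>x\<in>{0..len \<Gamma> e}. f e x \<noteq> 0) \<and>
     (\<forall>e\<in>edges \<Gamma>. AE x in lebesgue. x \<in> {0..len \<Gamma> e} \<longrightarrow> hamiltonian \<Gamma> f e x = z * f e x)"

text \<open>
  One-dimensional eigenspace. Functions are compared on the edges only, since their values elsewhere
  carry no meaning.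
\<close>

definition simple_eigenvalue :: "('v, 'e) quantum_graph \<Rightarrow> complex \<Rightarrow> bool" where
  "simple_eigenvalue \<Gamma> z \<longleftrightarrow>
     (\<exists>f. eigenfunction \<Gamma> z f \<and>
        (\<forall>g. eigenfunction \<Gamma> z g \<longrightarrow>
           (\<exists>c. \<forall>e\<in>edges \<Gamma>. \<forall>x\<in>{0..len \<Gamma> e}. g e x = c * f e x)))"

definition normalized_eigenfunction ::
  "('v, 'e) quantum_graph \<Rightarrow> complex \<Rightarrow> ('e \<Rightarrow> real \<Rightarrow> complex) \<Rightarrow> bool" where
  "normalized_eigenfunction \<Gamma> z f \<longleftrightarrow>
     eigenfunction \<Gamma> z f \<and>
     (\<Sum>e\<in>edges \<Gamma>. LINT x:{0..len \<Gamma> e}|lebesgue. (cmod (f e x))\<^sup>2) = 1"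

section \<open>Conditions of \<open>\<delta>\<close>-type\<close>

definition delta_condition :: "('e \<times> side) set \<Rightarrow> real \<Rightarrow> 'e vertex_condition" where
  "delta_condition P \<alpha> F F' \<longleftrightarrow>
     (\<forall>p\<in>P. \<forall>q\<in>P. F p = F q) \<and>
     (\<forall>p\<in>P. (\<Sum>q\<in>P. F' q) = complex_of_real \<alpha> * F p)"

definition inverse_delta_condition :: "('e \<times> side) set \<Rightarrow> real \<Rightarrow> 'e vertex_condition" where
  "inverse_delta_condition P \<zeta> F F' \<longleftrightarrow>
     (\<forall>p\<in>P. \<forall>q\<in>P. F p = F q) \<and>
     (\<forall>p\<in>P. complex_of_real \<zeta> * (\<Sum>q\<in>P. F' q) = - F p)"

text \<open>The condition at \<open>v\<close> is replaced, everything else is kept.\<close>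

definition with_delta :: "('v, 'e) quantum_graph \<Rightarrow> 'v \<Rightarrow> real \<Rightarrow> ('v, 'e) quantum_graph" where
  "with_delta \<Gamma> v \<alpha> =
     \<Gamma>\<lparr>vertex_cond := (vertex_cond \<Gamma>)(v := delta_condition (incident_ends \<Gamma> v) \<alpha>)\<rparr>"

definition with_inverse_delta :: "('v, 'e) quantum_graph \<Rightarrow> 'v \<Rightarrow> real \<Rightarrow> ('v, 'e) quantum_graph" where
  "with_inverse_delta \<Gamma> v \<zeta> =
     \<Gamma>\<lparr>vertex_cond := (vertex_cond \<Gamma>)(v := inverse_delta_condition (incident_ends \<Gamma> v) \<zeta>)\<rparr>"

text \<open>The common value of \<open>f\<close> at the ends incident to \<open>v\<close>, for \<open>f\<close> continuous at \<open>v\<close>.\<close>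

definition vertex_value :: "('v, 'e) quantum_graph \<Rightarrow> ('e \<Rightarrow> real \<Rightarrow> complex) \<Rightarrow> 'v \<Rightarrow> complex" where
  "vertex_value \<Gamma> f v = (THE c. \<forall>p\<in>incident_ends \<Gamma> v. end_value \<Gamma> f p = c)"

definition vertex_deriv_sum :: "('v, 'e) quantum_graph \<Rightarrow> ('e \<Rightarrow> real \<Rightarrow> complex) \<Rightarrow> 'v \<Rightarrow> complex" where
  "vertex_deriv_sum \<Gamma> f v = (\<Sum>p\<in>incident_ends \<Gamma> v. end_deriv \<Gamma> f p)"

text \<open>
  \<open>lam\<close> is, near \<open>t\<^sub>0\<close>, a function selecting continuously a simple eigenvalue of the family \<open>G\<close>, with
  \<open>lam t\<^sub>0 = \<mu>\<close>. Continuity only prevents jumps between different eigenvalues of the same graph;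
  differentiability is not presupposed.
\<close>

definition simple_eigenvalue_branch ::
  "(real \<Rightarrow> ('v, 'e) quantum_graph) \<Rightarrow> real \<Rightarrow> real \<Rightarrow> (real \<Rightarrow> real) \<Rightarrow> bool" where
  "simple_eigenvalue_branch G t\<^sub>0 \<mu> lam \<longleftrightarrow>
     lam t\<^sub>0 = \<mu> \<and>
     (\<exists>\<delta>>0. continuous_on {t\<^sub>0 - \<delta><..<t\<^sub>0 + \<delta>} lam \<and>
        (\<forall>t\<in>{t\<^sub>0 - \<delta><..<t\<^sub>0 + \<delta>}. simple_eigenvalue (G t) (complex_of_real (lam t))))"

end

theory Submission
  imports Defs
begin

text \<open>
  Let \<open>S \<lambda>\<close> be the space of solutions of \<open>- f'' + V f = \<lambda> f\<close> that satisfy the conditions at all vertices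
  other than \<open>v\<close> and are continuous at \<open>v\<close>, and write \<open>c f\<close> for the value and \<open>N f\<close> for the sum of the
  derivatives at \<open>v\<close>. Green's identity reads
  \<open>(\<lambda> - \<mu>) \<langle>f, g\<rangle> = N f * cnj (c g) - c f * cnj (N g)\<close> for \<open>f \<in> S \<lambda>\<close> and \<open>g \<in> S \<mu>\<close>. Both families of
  conditions have the form \<open>b f = t * a f\<close>, with \<open>(a, b) = (c, N)\<close> or \<open>(a, b) = (N, - c)\<close>, so for
  eigenfunctions \<open>f\<close> at parameter \<open>t\<close> and \<open>g\<close> at \<open>t\<^sub>0\<close> the right-hand side is
  \<open>(t - t\<^sub>0) * a f * cnj (a g)\<close>. As \<open>t\<close> tends to \<open>t\<^sub>0\<close>, compactness of the Cauchy data and simplicity make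
  suitable multiples of \<open>f\<close> converge to \<open>g\<close>, which gives the derivative \<open>\<bar>a g\<bar>\<^sup>2\<close>.

  For the existence of a branch, a dimension count shows that \<open>S \<lambda>\<close> is never trivial. If \<open>a g = 0\<close>, the
  constant branch works. Otherwise \<open>S \<lambda>\<close> is a line on which \<open>a\<close> does not vanish for \<open>\<lambda>\<close> near \<open>\<mu>\<close>, the
  ratio \<open>b / a\<close> is real with positive derivative in \<open>\<lambda>\<close>, and its inverse is the branch.
\<close>

section \<open>Pencils of boundary conditions\<close>

text \<open>The potential is only square integrable and \<open>lam\<close> is only continuous, so no
  differentiable family of eigenfunctions is at hand; of the dependence of solutions on the energy
  only a Lipschitz bound is proved. Green's identity gets by with this because it evaluates the
  difference quotient exactly: for an eigenfunction f at parameter t with eigenvalue \<nu>, and g at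
  \<open>t\<^sub>0\<close> with \<mu>, the quotient of \<nu> - \<mu> by \<open>t - t\<^sub>0\<close>
  is a f * cnj (a g) / <f, g>. This is homogeneous of degree 0 in f. Hence f needs neither unit norm
  nor a consistent phase: multiples with a nonzero limit suffice, and Bolzano-Weierstrass provides
  them because the Cauchy data are finitely many.

  The dimension count: E edges carry 2 E Cauchy data, a vertex of degree d imposes d equations, and
  the degrees add up to 2 E. Without the equation that carries the parameter, v imposes only its d -
  1 continuity equations, so there is one equation fewer than unknowns.\<close>

lemma finite_coordinates_convergent_subseq:
  fixes X :: "nat \<Rightarrow> 'i \<Rightarrow> complex"
  assumes "finite I" and "\<And>n i. i \<in> I \<Longrightarrow> norm (X n i) \<le> B"
  obtains l r where "strict_mono (r :: nat \<Rightarrow> nat)" "\<And>i. i \<in> I \<Longrightarrow> (\<lambda>n. X (r n) i) \<longlonglongrightarrow> l i"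
proof -
  have "\<forall>d\<subseteq>I. \<exists>l::'i \<Rightarrow> complex. \<exists>r::nat\<Rightarrow>nat. strict_mono r \<and>
      (\<forall>e>0. eventually (\<lambda>n. \<forall>i\<in>d. dist (X (r n) i) (l i) < e) sequentially)"
    using assms by (intro compact_lemma_general[where unproj = "\<lambda>f. f"]) (auto simp: bounded_iff)
  then obtain l and r :: "nat \<Rightarrow> nat" where r: "strict_mono r"
    and l: "\<forall>e>0. eventually (\<lambda>n. \<forall>i\<in>I. dist (X (r n) i) (l i) < e) sequentially"
    by blast
  have "(\<lambda>n. X (r n) i) \<longlonglongrightarrow> l i" if "i \<in> I" for i
    unfolding tendsto_iff
  proof (intro allI impI)
    fix e :: real assume "e > 0"
    then have "eventually (\<lambda>n. \<forall>i\<in>I. dist (X (r n) i) (l i) < e) sequentially" using l by blast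
    then show "eventually (\<lambda>n. dist (X (r n) i) (l i) < e) sequentially"
      by eventually_elim (use that in blast)
  qed
  with r that show ?thesis by blast
qed

text \<open>If the limit failed, some sequence would keep a fixed distance from \<open>l\<close>,
  and no subsequence of it could converge to \<open>l\<close>. So one good subsequence of every
  sequence is enough, which is all that compactness delivers.\<close>

lemma tendsto_at_by_subseq:
  fixes q :: "real \<Rightarrow> real"
  assumes "\<And>T. T \<longlonglongrightarrow> t\<^sub>0 \<Longrightarrow> (\<And>n. T n \<noteq> t\<^sub>0) \<Longrightarrow> (\<And>n. \<bar>T n - t\<^sub>0\<bar> < d) \<Longrightarrow>
      \<exists>r::nat\<Rightarrow>nat. strict_mono r \<and> (\<lambda>n. q (T (r n))) \<longlonglongrightarrow> l" and "d > 0"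
  shows "(q \<longlongrightarrow> l) (at t\<^sub>0)"
proof (rule ccontr)
  assume "\<not> (q \<longlongrightarrow> l) (at t\<^sub>0)"
  then obtain e where e: "e > 0" "\<And>s. s > 0 \<Longrightarrow> \<exists>t. t \<noteq> t\<^sub>0 \<and> norm (t - t\<^sub>0) < s \<and> \<not> norm (q t - l) < e"
    unfolding LIM_eq by blast
  \<comment> \<open>Radii \<open>d / Suc n\<close> make the sequence converge while keeping all of
    it, the first term included, inside the radius \<open>d\<close>.\<close>
  have "\<forall>n. \<exists>t. t \<noteq> t\<^sub>0 \<and> norm (t - t\<^sub>0) < d / real (Suc n) \<and> \<not> norm (q t - l) < e"
    using e(2) \<open>d > 0\<close> by simp
  then obtain T where T: "\<And>n. T n \<noteq> t\<^sub>0" "\<And>n. norm (T n - t\<^sub>0) < d / real (Suc n)"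
      "\<And>n. \<not> norm (q (T n) - l) < e" by metis
  have "(\<lambda>n. d / real (Suc n)) \<longlonglongrightarrow> 0"
    using tendsto_mult[OF tendsto_const[of d] LIMSEQ_inverse_real_of_nat] by (simp add: field_simps)
  then have "(\<lambda>n. T n - t\<^sub>0) \<longlonglongrightarrow> 0"
    by (rule Lim_null_comparison[rotated]) (intro always_eventually allI less_imp_le T(2))
  then have "T \<longlonglongrightarrow> t\<^sub>0" by (simp add: LIM_zero_iff)
  moreover have "\<bar>T n - t\<^sub>0\<bar> < d" for n
  proof -
    have "d / real (Suc n) \<le> d" using \<open>d > 0\<close> by (simp add: field_simps)
    then show ?thesis using T(2)[of n] by simp
  qed
  ultimately obtain r :: "nat \<Rightarrow> nat" where "(\<lambda>n. q (T (r n))) \<longlonglongrightarrow> l" using assms(1) T(1) by blast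
  then have "\<forall>\<^sub>F n in sequentially. dist (q (T (r n))) l < e" using e(1) tendstoD by blast
  then show False using T(3) by (auto simp: eventually_sequentially dist_norm)
qed

text \<open>
  \<open>S \<nu>\<close> stands for the solutions of the eigenvalue equation that satisfy every condition except the
  one carrying the parameter, which reads \<open>b \<nu> x = t * a \<nu> x\<close>; solutions are represented by
  finitely many coordinates. The form \<open>G \<nu> \<mu>\<close> is the inner product of the solutions, and
  \<open>green\<close> is Green's identity.
\<close>

locale boundary_pencil =
  fixes I :: "'i set"
    and S :: "real \<Rightarrow> ('i \<Rightarrow> complex) set"
    and a b :: "real \<Rightarrow> ('i \<Rightarrow> complex) \<Rightarrow> complex"
    and G :: "real \<Rightarrow> real \<Rightarrow> ('i \<Rightarrow> complex) \<Rightarrow> ('i \<Rightarrow> complex) \<Rightarrow> complex"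
  assumes finite_I: "finite I"
    and S_supp: "x \<in> S \<nu> \<Longrightarrow> i \<notin> I \<Longrightarrow> x i = 0"
    and S_lin: "x \<in> S \<nu> \<Longrightarrow> y \<in> S \<nu> \<Longrightarrow> (\<lambda>i. x i + c * y i) \<in> S \<nu>"
    and S_nontrivial: "\<exists>x\<in>S \<nu>. x \<noteq> (\<lambda>i. 0)"
    and S_closed: "Z \<longlonglongrightarrow> \<nu> \<Longrightarrow> (\<And>n. X n \<in> S (Z n)) \<Longrightarrow> (\<And>i. (\<lambda>n. X n i) \<longlonglongrightarrow> x i) \<Longrightarrow> x \<in> S \<nu>"
    and a_lin: "a \<nu> (\<lambda>i. x i + c * y i) = a \<nu> x + c * a \<nu> y"
    and b_lin: "b \<nu> (\<lambda>i. x i + c * y i) = b \<nu> x + c * b \<nu> y"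
    and a_lim: "Z \<longlonglongrightarrow> \<nu> \<Longrightarrow> (\<And>i. (\<lambda>n. X n i) \<longlonglongrightarrow> x i) \<Longrightarrow> (\<lambda>n. a (Z n) (X n)) \<longlonglongrightarrow> a \<nu> x"
    and b_lim: "Z \<longlonglongrightarrow> \<nu> \<Longrightarrow> (\<And>i. (\<lambda>n. X n i) \<longlonglongrightarrow> x i) \<Longrightarrow> (\<lambda>n. b (Z n) (X n)) \<longlonglongrightarrow> b \<nu> x"
    and G_lim: "Z \<longlonglongrightarrow> \<nu> \<Longrightarrow> (\<And>i. (\<lambda>n. X n i) \<longlonglongrightarrow> x i) \<Longrightarrow> (\<lambda>n. G (Z n) \<nu> (X n) y) \<longlonglongrightarrow> G \<nu> \<nu> x y"
    and G_scale: "G \<nu> \<mu> (\<lambda>i. c * x i) y = c * G \<nu> \<mu> x y"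
    and G_pos: "x \<in> S \<nu> \<Longrightarrow> x \<noteq> (\<lambda>i. 0) \<Longrightarrow> \<exists>r>0. G \<nu> \<nu> x x = complex_of_real r"
    and green: "x \<in> S \<nu> \<Longrightarrow> y \<in> S \<mu> \<Longrightarrow>
      complex_of_real (\<nu> - \<mu>) * G \<nu> \<mu> x y = b \<nu> x * cnj (a \<mu> y) - a \<nu> x * cnj (b \<mu> y)"
begin

definition eigenspace :: "real \<Rightarrow> real \<Rightarrow> ('i \<Rightarrow> complex) set" where
  "eigenspace t \<nu> = {x \<in> S \<nu>. b \<nu> x = complex_of_real t * a \<nu> x}"

definition simple :: "real \<Rightarrow> real \<Rightarrow> bool" where
  "simple t \<nu> \<longleftrightarrow> (\<exists>x\<in>eigenspace t \<nu>. x \<noteq> (\<lambda>i. 0) \<and> (\<forall>y\<in>eigenspace t \<nu>. \<exists>c. y = (\<lambda>i. c * x i)))"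

definition branch :: "real \<Rightarrow> real \<Rightarrow> (real \<Rightarrow> real) \<Rightarrow> bool" where
  "branch t\<^sub>0 \<mu> lam \<longleftrightarrow> lam t\<^sub>0 = \<mu> \<and>
     (\<exists>\<delta>>0. continuous_on {t\<^sub>0 - \<delta><..<t\<^sub>0 + \<delta>} lam \<and> (\<forall>t\<in>{t\<^sub>0 - \<delta><..<t\<^sub>0 + \<delta>}. simple t (lam t)))"

lemma S_zero: "(\<lambda>i. 0) \<in> S \<nu>"
proof -
  obtain x where "x \<in> S \<nu>" using S_nontrivial by blast
  from S_lin[OF this this, of "-1"] show ?thesis by simp
qed

lemma S_scale: "x \<in> S \<nu> \<Longrightarrow> (\<lambda>i. c * x i) \<in> S \<nu>"
  using S_lin[OF S_zero, of x \<nu> c] by simp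

lemma a_zero: "a \<nu> (\<lambda>i. 0) = 0"
  using a_lin[of \<nu> "\<lambda>i. 0" "-1" "\<lambda>i. 0"] by simp

lemma b_zero: "b \<nu> (\<lambda>i. 0) = 0"
  using b_lin[of \<nu> "\<lambda>i. 0" "-1" "\<lambda>i. 0"] by simp

lemma a_scale: "a \<nu> (\<lambda>i. c * x i) = c * a \<nu> x"
  using a_lin[of \<nu> "\<lambda>i. 0" c x] by (simp add: a_zero)

lemma b_scale: "b \<nu> (\<lambda>i. c * x i) = c * b \<nu> x"
  using b_lin[of \<nu> "\<lambda>i. 0" c x] by (simp add: b_zero)

text \<open>\<open>simple\<close> provides one unspecified generator of the eigenspace; this lets
  any nonzero eigenvector take its place.\<close>

lemma simple_unique:
  assumes "simple t \<nu>" "x \<in> eigenspace t \<nu>" "x \<noteq> (\<lambda>i. 0)" "y \<in> eigenspace t \<nu>"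
  obtains c where "y = (\<lambda>i. c * x i)"
proof -
  from assms(1) obtain z where z: "\<And>y. y \<in> eigenspace t \<nu> \<Longrightarrow> \<exists>c. y = (\<lambda>i. c * z i)"
    by (auto simp: simple_def)
  from z[OF assms(2)] obtain c where c: "x = (\<lambda>i. c * z i)" by blast
  from z[OF assms(4)] obtain d where d: "y = (\<lambda>i. d * z i)" by blast
  have "c \<noteq> 0" using assms(3) c by auto
  then have "y = (\<lambda>i. (d / c) * x i)" using c d by auto
  then show ?thesis by (rule that)
qed

text \<open>Normalizing the coordinates rather than the \<open>G\<close>-norm makes the sequence compact at once.\<close>

lemma subseq_limit:
  assumes "Z \<longlonglongrightarrow> \<nu>" and X: "\<And>n. X n \<in> S (Z n)" and nz: "\<And>n. X n \<noteq> (\<lambda>i. 0)"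
  obtains r x k where "strict_mono (r :: nat \<Rightarrow> nat)" "x \<in> S \<nu>" "x \<noteq> (\<lambda>i. 0)"
    "\<And>n. k n \<noteq> (0::complex)" "\<And>i. (\<lambda>n. k n * X (r n) i) \<longlonglongrightarrow> x i" "(\<lambda>n. Z (r n)) \<longlonglongrightarrow> \<nu>"
    "\<And>n. (\<lambda>i. k n * X (r n) i) \<in> S (Z (r n))"
proof -
  define N where "N n = (\<Sum>i\<in>I. norm (X n i))" for n
  have N: "N n > 0" for n
  proof -
    from nz[of n] obtain i where i: "X n i \<noteq> 0" by auto
    then have "i \<in> I" using S_supp[OF X] by blast
    then have "norm (X n i) \<le> N n" unfolding N_def by (intro member_le_sum finite_I) auto
    then show ?thesis using i by (smt (verit) zero_less_norm_iff)
  qed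
  define Y where "Y n i = complex_of_real (1 / N n) * X n i" for n i
  have sumY: "(\<Sum>i\<in>I. norm (Y n i)) = 1" for n
    using N[of n] by (simp add: Y_def norm_mult norm_divide sum_divide_distrib[symmetric] N_def[symmetric])
  have "norm (Y n i) \<le> 1" if "i \<in> I" for n i
    using member_le_sum[OF that, of "\<lambda>i. norm (Y n i)"] sumY[of n] finite_I by simp
  then obtain l and r :: "nat \<Rightarrow> nat" where r: "strict_mono r" and l: "\<And>i. i \<in> I \<Longrightarrow> (\<lambda>n. Y (r n) i) \<longlonglongrightarrow> l i"
    using finite_coordinates_convergent_subseq[OF finite_I, of Y 1] by metis
  define x where "x i = (if i \<in> I then l i else 0)" for i
  have lim: "(\<lambda>n. Y (r n) i) \<longlonglongrightarrow> x i" for i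
  proof (cases "i \<in> I")
    case False
    then have "Y (r n) i = 0" for n using S_supp[OF X] by (simp add: Y_def)
    then show ?thesis using False by (simp add: x_def)
  qed (simp add: l x_def)
  have Zr: "(\<lambda>n. Z (r n)) \<longlonglongrightarrow> \<nu>"
    using LIMSEQ_subseq_LIMSEQ[OF assms(1) r] by (simp add: o_def)
  have YS: "Y n \<in> S (Z n)" for n
    using S_scale[OF X, of "complex_of_real (1 / N n)" n] by (simp add: Y_def[abs_def])
  \<comment> \<open>The normalization survives the limit, so the limit is not the zero
    vector.\<close>
  have "(\<lambda>n. \<Sum>i\<in>I. norm (Y (r n) i)) \<longlonglongrightarrow> (\<Sum>i\<in>I. norm (x i))"
    by (intro tendsto_intros lim)
  then have "(\<Sum>i\<in>I. norm (x i)) = 1" using sumY LIMSEQ_unique by (auto simp: LIMSEQ_const_iff)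
  then have "x \<noteq> (\<lambda>i. 0)" by auto
  moreover have "x \<in> S \<nu>" by (rule S_closed[OF Zr, of "\<lambda>n. Y (r n)"]) (use YS lim in auto)
  ultimately show ?thesis
    using that[of r x "\<lambda>n. complex_of_real (1 / N (r n))"] r lim Zr N YS
    by (simp add: Y_def[abs_def] less_imp_neq[THEN not_sym])
qed

text \<open>By \<open>green\<close> the quotient is \<open>a\<close> of the rescaled eigenvector
  times \<open>cnj (a \<mu> x\<^sub>0)\<close>, divided by the product of that eigenvector with
  \<open>x\<^sub>0\<close>. The rescaled vectors converge to \<open>c * x\<^sub>0\<close> with an
  unknown \<open>c \<noteq> 0\<close>, which cancels.\<close>

lemma branch_deriv_seq:
  assumes simple: "simple t\<^sub>0 \<mu>" and x0: "x\<^sub>0 \<in> eigenspace t\<^sub>0 \<mu>" and norm: "G \<mu> \<mu> x\<^sub>0 x\<^sub>0 = 1"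
    and T: "T \<longlonglongrightarrow> t\<^sub>0" "\<And>n. T n \<noteq> t\<^sub>0"
    and Z: "Z \<longlonglongrightarrow> \<mu>"
    and X: "\<And>n. X n \<in> eigenspace (T n) (Z n)" "\<And>n. X n \<noteq> (\<lambda>i. 0)"
  obtains r where "strict_mono (r :: nat \<Rightarrow> nat)"
    "(\<lambda>n. (Z (r n) - \<mu>) / (T (r n) - t\<^sub>0)) \<longlonglongrightarrow> (cmod (a \<mu> x\<^sub>0))\<^sup>2"
proof -
  have x0S: "x\<^sub>0 \<in> S \<mu>" and bx0: "b \<mu> x\<^sub>0 = complex_of_real t\<^sub>0 * a \<mu> x\<^sub>0"
    using x0 by (auto simp: eigenspace_def)
  \<comment> \<open>\<open>G_scale\<close> with factor 0 would give the zero vector norm 0 instead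
    of 1.\<close>
  have x0nz: "x\<^sub>0 \<noteq> (\<lambda>i. 0)"
    using G_scale[of \<mu> \<mu> 0 x\<^sub>0 x\<^sub>0] norm by auto
  have XS: "X n \<in> S (Z n)" and Xb: "b (Z n) (X n) = complex_of_real (T n) * a (Z n) (X n)" for n
    using X by (auto simp: eigenspace_def)
  obtain r x k where r: "strict_mono (r :: nat \<Rightarrow> nat)" and x: "x \<in> S \<mu>" "x \<noteq> (\<lambda>i. 0)"
    and k: "\<And>n. k n \<noteq> (0::complex)" and lim: "\<And>i. (\<lambda>n. k n * X (r n) i) \<longlonglongrightarrow> x i"
    and Zr: "(\<lambda>n. Z (r n)) \<longlonglongrightarrow> \<mu>" and YS: "\<And>n. (\<lambda>i. k n * X (r n) i) \<in> S (Z (r n))"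
    by (rule subseq_limit[OF Z XS X(2)]) (rule that)
  define Y where "Y n i = k n * X (r n) i" for n i
  have limY: "(\<lambda>n. Y n i) \<longlonglongrightarrow> x i" for i using lim by (simp add: Y_def)
  have YS': "Y n \<in> S (Z (r n))" for n using YS by (simp add: Y_def[abs_def])
  have Yb: "b (Z (r n)) (Y n) = complex_of_real (T (r n)) * a (Z (r n)) (Y n)" for n
    by (simp add: Y_def[abs_def] a_scale b_scale Xb)
  have Tr: "(\<lambda>n. T (r n)) \<longlonglongrightarrow> t\<^sub>0" using LIMSEQ_subseq_LIMSEQ[OF T(1) r] by (simp add: o_def)
  have la: "(\<lambda>n. a (Z (r n)) (Y n)) \<longlonglongrightarrow> a \<mu> x" by (rule a_lim[OF Zr limY])
  \<comment> \<open>The condition at parameter \<open>T (r n)\<close> passes to the limit, which is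
    therefore an eigenvector at \<open>t\<^sub>0\<close>; simplicity then fixes its
    direction.\<close>
  have "b \<mu> x = complex_of_real t\<^sub>0 * a \<mu> x"
  proof (rule LIMSEQ_unique)
    show "(\<lambda>n. b (Z (r n)) (Y n)) \<longlonglongrightarrow> b \<mu> x" by (rule b_lim[OF Zr limY])
    show "(\<lambda>n. b (Z (r n)) (Y n)) \<longlonglongrightarrow> complex_of_real t\<^sub>0 * a \<mu> x"
      unfolding Yb by (intro tendsto_intros Tr la)
  qed
  then have "x \<in> eigenspace t\<^sub>0 \<mu>" using x by (simp add: eigenspace_def)
  then obtain c where c: "x = (\<lambda>i. c * x\<^sub>0 i)" using simple_unique[OF simple x0 x0nz] by metis
  have cnz: "c \<noteq> 0" using x(2) c by auto
  define g where "g n = G (Z (r n)) \<mu> (Y n) x\<^sub>0" for n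
  have "g \<longlonglongrightarrow> G \<mu> \<mu> x x\<^sub>0" unfolding g_def by (rule G_lim[OF Zr limY])
  then have lg: "g \<longlonglongrightarrow> c" by (simp add: c G_scale norm)
  have "(\<lambda>n. a (Z (r n)) (Y n) * cnj (a \<mu> x\<^sub>0) / g n) \<longlonglongrightarrow> a \<mu> x * cnj (a \<mu> x\<^sub>0) / c"
    by (intro tendsto_intros la lg cnz)
  moreover have "a \<mu> x * cnj (a \<mu> x\<^sub>0) / c = complex_of_real ((cmod (a \<mu> x\<^sub>0))\<^sup>2)"
    using cnz by (simp add: c a_scale flip: complex_norm_square)
  moreover have "\<forall>\<^sub>F n in sequentially. a (Z (r n)) (Y n) * cnj (a \<mu> x\<^sub>0) / g n =
      complex_of_real ((Z (r n) - \<mu>) / (T (r n) - t\<^sub>0))"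
  proof -
    \<comment> \<open>Single terms \<open>g n\<close> may vanish; the nonzero limit excludes this
      for large \<open>n\<close>, which is enough for a limit.\<close>
    have "\<forall>\<^sub>F n in sequentially. g n \<noteq> 0" using lg cnz by (rule tendsto_imp_eventually_ne)
    then show ?thesis
    proof eventually_elim
      case (elim n)
      have "complex_of_real (Z (r n) - \<mu>) * g n =
          complex_of_real (T (r n) - t\<^sub>0) * (a (Z (r n)) (Y n) * cnj (a \<mu> x\<^sub>0))"
        unfolding g_def using green[OF YS' x0S] by (simp add: Yb bx0 algebra_simps)
      moreover have "complex_of_real (T (r n) - t\<^sub>0) \<noteq> 0" using T(2)[of "r n"]
        by (metis eq_iff_diff_eq_0 of_real_eq_0_iff)
      ultimately show ?case using elim by (simp add: field_simps)
    qed
  qed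
  ultimately have "(\<lambda>n. complex_of_real ((Z (r n) - \<mu>) / (T (r n) - t\<^sub>0))) \<longlonglongrightarrow>
      complex_of_real ((cmod (a \<mu> x\<^sub>0))\<^sup>2)"
    using Lim_transform_eventually by force
  then show ?thesis using that[OF r] tendsto_of_real_iff by blast
qed

theorem branch_has_derivative:
  assumes br: "branch t\<^sub>0 \<mu> lam" and x0: "x\<^sub>0 \<in> eigenspace t\<^sub>0 \<mu>" and norm: "G \<mu> \<mu> x\<^sub>0 x\<^sub>0 = 1"
  shows "(lam has_real_derivative (cmod (a \<mu> x\<^sub>0))\<^sup>2) (at t\<^sub>0)"
proof -
  from br obtain d where d: "d > 0" "continuous_on {t\<^sub>0 - d<..<t\<^sub>0 + d} lam"
      "\<And>t. t \<in> {t\<^sub>0 - d<..<t\<^sub>0 + d} \<Longrightarrow> simple t (lam t)" and lam0: "lam t\<^sub>0 = \<mu>"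
    by (auto simp: branch_def)
  have s0: "simple t\<^sub>0 \<mu>" using d(3)[of t\<^sub>0] d(1) lam0 by simp
  \<comment> \<open>Continuity of the branch enters only through this, to make the eigenvalues
    converge along the sequence.\<close>
  have ic: "isCont lam t\<^sub>0" using continuous_on_eq_continuous_at[of "{t\<^sub>0 - d<..<t\<^sub>0 + d}" lam] d by auto
  have "((\<lambda>t. (lam t - lam t\<^sub>0) / (t - t\<^sub>0)) \<longlongrightarrow> (cmod (a \<mu> x\<^sub>0))\<^sup>2) (at t\<^sub>0)"
  proof (rule tendsto_at_by_subseq[OF _ d(1)])
    fix T assume T: "T \<longlonglongrightarrow> t\<^sub>0" "\<And>n. T n \<noteq> t\<^sub>0" "\<And>n. \<bar>T n - t\<^sub>0\<bar> < d"
    have "\<forall>n. \<exists>x. x \<in> eigenspace (T n) (lam (T n)) \<and> x \<noteq> (\<lambda>i. 0)"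
    proof
      fix n
      have "T n \<in> {t\<^sub>0 - d<..<t\<^sub>0 + d}" using T(3)[of n] by auto
      from d(3)[OF this] show "\<exists>x. x \<in> eigenspace (T n) (lam (T n)) \<and> x \<noteq> (\<lambda>i. 0)"
        by (auto simp: simple_def)
    qed
    then obtain X where X: "\<And>n. X n \<in> eigenspace (T n) (lam (T n))" "\<And>n. X n \<noteq> (\<lambda>i. 0)" by metis
    have "(\<lambda>n. lam (T n)) \<longlonglongrightarrow> \<mu>" using isCont_tendsto_compose[OF ic T(1)] lam0 by simp
    from branch_deriv_seq[OF s0 x0 norm T(1,2) this X] lam0
    show "\<exists>r::nat\<Rightarrow>nat. strict_mono r \<and>
        (\<lambda>n. (lam (T (r n)) - lam t\<^sub>0) / (T (r n) - t\<^sub>0)) \<longlonglongrightarrow> (cmod (a \<mu> x\<^sub>0))\<^sup>2"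
      by metis
  qed
  then show ?thesis by (simp add: has_field_derivative_iff)
qed

text \<open>\<open>b\<close> vanishes at \<open>x\<^sub>0\<close> as well, so
  \<open>x\<^sub>0\<close> is an eigenvector at every parameter. The multiplicity can rise only at a
  parameter with a further eigenvector on which \<open>a\<close> does not vanish, and Green's
  identity at equal energies allows at most one such parameter.\<close>

lemma branch_exists_degenerate:
  assumes s: "simple t\<^sub>0 \<mu>" and x0: "x\<^sub>0 \<in> eigenspace t\<^sub>0 \<mu>" "x\<^sub>0 \<noteq> (\<lambda>i. 0)" and a0: "a \<mu> x\<^sub>0 = 0"
  shows "\<exists>lam. branch t\<^sub>0 \<mu> lam"
proof -
  have x0S: "x\<^sub>0 \<in> S \<mu>" and bx0: "b \<mu> x\<^sub>0 = 0" using x0 a0 by (auto simp: eigenspace_def)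
  define P where "P t \<longleftrightarrow> (\<exists>y\<in>S \<mu>. b \<mu> y = complex_of_real t * a \<mu> y \<and> a \<mu> y \<noteq> 0)" for t
  have bad: "P t" if "\<not> simple t \<mu>" for t
  proof -
    have "x\<^sub>0 \<in> eigenspace t \<mu>" using x0S bx0 a0 by (simp add: eigenspace_def)
    then obtain y where y: "y \<in> eigenspace t \<mu>" "\<nexists>c. y = (\<lambda>i. c * x\<^sub>0 i)"
      using \<open>\<not> simple t \<mu>\<close> x0(2) unfolding simple_def by blast
    have "a \<mu> y \<noteq> 0"
    proof
      assume "a \<mu> y = 0"
      then have "y \<in> eigenspace t\<^sub>0 \<mu>" using y(1) by (simp add: eigenspace_def)
      then show False using y(2) simple_unique[OF s x0] by metis
    qed
    then show "P t" using y(1) by (auto simp: P_def eigenspace_def)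
  qed
  have unique: "t = t'" if Pt: "P t" "P t'" for t t'
  proof -
    from Pt obtain y y' where y: "y \<in> S \<mu>" "b \<mu> y = complex_of_real t * a \<mu> y" "a \<mu> y \<noteq> 0"
      and y': "y' \<in> S \<mu>" "b \<mu> y' = complex_of_real t' * a \<mu> y'" "a \<mu> y' \<noteq> 0"
      unfolding P_def by blast
    have "complex_of_real (t - t') * (a \<mu> y * cnj (a \<mu> y')) = b \<mu> y * cnj (a \<mu> y') - a \<mu> y * cnj (b \<mu> y')"
      unfolding y(2) y'(2) by (simp add: algebra_simps)
    also have "\<dots> = 0" using green[OF y(1) y'(1)] by simp
    finally have "complex_of_real (t - t') * (a \<mu> y * cnj (a \<mu> y')) = 0" .
    then show ?thesis using y(3) y'(3) by (metis eq_iff_diff_eq_0 mult_eq_0_iff of_real_eq_0_iff complex_cnj_zero_iff)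
  qed
  have "\<exists>\<delta>>0. \<forall>t\<in>{t\<^sub>0 - \<delta><..<t\<^sub>0 + \<delta>}. simple t \<mu>"
  \<comment> \<open>The exceptional parameter, if any, differs from \<open>t\<^sub>0\<close>, where
    simplicity is assumed; its distance is the radius.\<close>
  proof (cases "\<exists>s. \<not> simple s \<mu>")
    case True
    then obtain s' where s': "\<not> simple s' \<mu>" by blast
    then have "s' \<noteq> t\<^sub>0" using s by auto
    moreover have "simple t \<mu>" if "t \<in> {t\<^sub>0 - \<bar>s' - t\<^sub>0\<bar><..<t\<^sub>0 + \<bar>s' - t\<^sub>0\<bar>}" for t
    proof (rule ccontr)
      assume "\<not> simple t \<mu>"
      then have "t = s'" using unique bad s' by blast
      then show False using that by (auto simp: abs_if split: if_splits)
    qed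
    ultimately show ?thesis by (intro exI[of _ "\<bar>s' - t\<^sub>0\<bar>"]) auto
  qed (auto intro: exI[of _ 1])
  then have "branch t\<^sub>0 \<mu> (\<lambda>_. \<mu>)" by (auto simp: branch_def)
  then show ?thesis by blast
qed

text \<open>Finding an eigenvalue for a given parameter would be an existence problem of its own.
  Finding the parameter for a given energy needs only a nonzero element of \<open>S\<close>, so the
  dependence is established in that direction and then inverted.\<close>

lemma branch_exists_nondegenerate:
  assumes s: "simple t\<^sub>0 \<mu>" and x0: "x\<^sub>0 \<in> eigenspace t\<^sub>0 \<mu>" "x\<^sub>0 \<noteq> (\<lambda>i. 0)" and a0: "a \<mu> x\<^sub>0 \<noteq> 0"
  shows "\<exists>lam. branch t\<^sub>0 \<mu> lam"
proof -
  have x0S: "x\<^sub>0 \<in> S \<mu>" and bx0: "b \<mu> x\<^sub>0 = complex_of_real t\<^sub>0 * a \<mu> x\<^sub>0" using x0 by (auto simp: eigenspace_def)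
  \<comment> \<open>Nonzero elements of \<open>S\<close> with \<open>a = 0\<close> at energies
    tending to \<open>\<mu>\<close> would leave such an element at \<open>\<mu>\<close>
    itself.\<close>
  have "\<exists>\<delta>>0. \<forall>\<nu>. \<bar>\<nu> - \<mu>\<bar> < \<delta> \<longrightarrow> (\<forall>x\<in>S \<nu>. x \<noteq> (\<lambda>i. 0) \<longrightarrow> a \<nu> x \<noteq> 0)"
  proof (rule ccontr)
    assume "\<not> ?thesis"
    then have "\<forall>n::nat. \<exists>\<nu> x. \<bar>\<nu> - \<mu>\<bar> < inverse (real (Suc n)) \<and> x \<in> S \<nu> \<and> x \<noteq> (\<lambda>i. 0) \<and> a \<nu> x = 0"
      by (metis inverse_positive_iff_positive of_nat_0_less_iff zero_less_Suc)
    then obtain Z X where Z: "\<And>n::nat. \<bar>Z n - \<mu>\<bar> < inverse (real (Suc n))"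
      and X: "\<And>n. X n \<in> S (Z n)" "\<And>n. X n \<noteq> (\<lambda>i. 0)" "\<And>n. a (Z n) (X n) = 0" by metis
    have "(\<lambda>n. Z n - \<mu>) \<longlonglongrightarrow> 0"
      by (rule Lim_null_comparison[OF _ LIMSEQ_inverse_real_of_nat], intro always_eventually allI less_imp_le)
        (simp add: Z del: of_nat_Suc)
    then have "Z \<longlonglongrightarrow> \<mu>" by (simp add: LIM_zero_iff)
    then obtain r x k where "strict_mono (r :: nat \<Rightarrow> nat)" and x: "x \<in> S \<mu>" "x \<noteq> (\<lambda>i. 0)"
      and "\<And>n. k n \<noteq> (0::complex)" and lim: "\<And>i. (\<lambda>n. k n * X (r n) i) \<longlonglongrightarrow> x i"
      and Zr: "(\<lambda>n. Z (r n)) \<longlonglongrightarrow> \<mu>" and "\<And>n. (\<lambda>i. k n * X (r n) i) \<in> S (Z (r n))"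
      by (rule subseq_limit[OF _ X(1,2)]) (rule that)
    have "(\<lambda>n. a (Z (r n)) (\<lambda>i. k n * X (r n) i)) \<longlonglongrightarrow> a \<mu> x" by (rule a_lim[OF Zr lim])
    then have ax: "a \<mu> x = 0" by (simp add: a_scale X(3) LIMSEQ_const_iff)
    \<comment> \<open>Equal energies make the left side of \<open>green\<close> zero, and with
      \<open>a \<mu> x = 0\<close> what remains is
      \<open>b \<mu> x * cnj (a \<mu> x\<^sub>0)\<close>.\<close>
    then have "b \<mu> x = 0" using green[OF x(1) x0S] a0 by simp
    then have "x \<in> eigenspace t\<^sub>0 \<mu>" using x ax by (simp add: eigenspace_def)
    then obtain c where "x = (\<lambda>i. c * x\<^sub>0 i)" using simple_unique[OF s x0] by metis
    then show False using ax x(2) a0 by (auto simp: a_scale)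
  qed
  then obtain \<delta> where \<delta>: "\<delta> > 0" and anz: "\<And>\<nu> x. \<bar>\<nu> - \<mu>\<bar> < \<delta> \<Longrightarrow> x \<in> S \<nu> \<Longrightarrow> x \<noteq> (\<lambda>i. 0) \<Longrightarrow> a \<nu> x \<noteq> 0"
    by blast
  have "\<forall>\<nu>. \<exists>x. \<bar>\<nu> - \<mu>\<bar> < \<delta> \<longrightarrow> x \<in> S \<nu> \<and> a \<nu> x = 1"
  proof
    fix \<nu>
    obtain x where x: "x \<in> S \<nu>" "x \<noteq> (\<lambda>i. 0)" using S_nontrivial by blast
    show "\<exists>x. \<bar>\<nu> - \<mu>\<bar> < \<delta> \<longrightarrow> x \<in> S \<nu> \<and> a \<nu> x = 1"
      using S_scale[OF x(1), of "1 / a \<nu> x"] anz[OF _ x] a_scale[of \<nu> "1 / a \<nu> x" x]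
      by (intro exI[of _ "\<lambda>i. 1 / a \<nu> x * x i"]) simp
  qed
  then obtain \<phi> where \<phi>: "\<And>\<nu>. \<bar>\<nu> - \<mu>\<bar> < \<delta> \<Longrightarrow> \<phi> \<nu> \<in> S \<nu>" "\<And>\<nu>. \<bar>\<nu> - \<mu>\<bar> < \<delta> \<Longrightarrow> a \<nu> (\<phi> \<nu>) = 1" by metis
  \<comment> \<open>Otherwise the difference would be a nonzero element of \<open>S \<nu>\<close> on
    which \<open>a\<close> vanishes.\<close>
  have span: "x = (\<lambda>i. a \<nu> x * \<phi> \<nu> i)" if "\<bar>\<nu> - \<mu>\<bar> < \<delta>" "x \<in> S \<nu>" for \<nu> x
  proof (rule ccontr)
    assume ne: "x \<noteq> (\<lambda>i. a \<nu> x * \<phi> \<nu> i)"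
    define y where "y i = x i + (- a \<nu> x) * \<phi> \<nu> i" for i
    have "y \<in> S \<nu>" unfolding y_def[abs_def] by (rule S_lin) (use that \<phi> in auto)
    moreover have "a \<nu> y = 0" unfolding y_def[abs_def] a_lin using \<phi>(2)[OF that(1)] by simp
    moreover have "y \<noteq> (\<lambda>i. 0)" using ne by (auto simp: y_def fun_eq_iff)
    ultimately show False using anz[OF that(1)] by blast
  qed
  define m where "m \<nu> = Re (b \<nu> (\<phi> \<nu>))" for \<nu>
  \<comment> \<open>\<open>green\<close> for \<open>\<phi> \<nu>\<close> against itself equates
    \<open>b\<close> with its conjugate, since \<open>a\<close> is 1 there.\<close>
  have m: "b \<nu> (\<phi> \<nu>) = complex_of_real (m \<nu>)" if "\<bar>\<nu> - \<mu>\<bar> < \<delta>" for \<nu>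
    using green[OF \<phi>(1)[OF that] \<phi>(1)[OF that]] \<phi>(2)[OF that]
    by (simp add: m_def complex_eq_iff)
  have \<phi>nz: "\<phi> \<nu> \<noteq> (\<lambda>i. 0)" if "\<bar>\<nu> - \<mu>\<bar> < \<delta>" for \<nu>
    using \<phi>(2)[OF that] a_zero by auto
  have m0: "m \<mu> = t\<^sub>0"
  proof -
    have \<mu>: "\<bar>\<mu> - \<mu>\<bar> < \<delta>" using \<delta> by simp
    have "b \<mu> x\<^sub>0 = a \<mu> x\<^sub>0 * b \<mu> (\<phi> \<mu>)" using span[OF \<mu> x0S] b_scale[of \<mu> "a \<mu> x\<^sub>0" "\<phi> \<mu>"] by simp
    then show ?thesis using bx0 a0 m[OF \<mu>] by simp
  qed
  \<comment> \<open>With \<open>a\<close> normalized to 1, \<open>green\<close> for two energies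
    says that the difference quotient of \<open>m\<close> is the product of the two normalized
    vectors, whose limit is a positive squared norm.\<close>
  have deriv: "\<exists>g>0. (m has_real_derivative g) (at \<nu>)" if \<nu>: "\<bar>\<nu> - \<mu>\<bar> < \<delta>" for \<nu>
  proof -
    obtain g where g: "g > 0" "G \<nu> \<nu> (\<phi> \<nu>) (\<phi> \<nu>) = complex_of_real g"
      using G_pos[OF \<phi>(1)[OF \<nu>] \<phi>nz[OF \<nu>]] by blast
    have "((\<lambda>s. (m s - m \<nu>) / (s - \<nu>)) \<longlongrightarrow> g) (at \<nu>)"
    proof (rule tendsto_at_by_subseq)
      show "\<delta> - \<bar>\<nu> - \<mu>\<bar> > 0" using \<nu> by simp
      fix Z assume Z: "Z \<longlonglongrightarrow> \<nu>" "\<And>n. Z n \<noteq> \<nu>" "\<And>n. \<bar>Z n - \<nu>\<bar> < \<delta> - \<bar>\<nu> - \<mu>\<bar>"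
      have in\<delta>: "\<bar>Z n - \<mu>\<bar> < \<delta>" for n using Z(3)[of n] by linarith
      obtain r x k where r: "strict_mono (r :: nat \<Rightarrow> nat)" and x: "x \<in> S \<nu>" "x \<noteq> (\<lambda>i. 0)"
        and k: "\<And>n. k n \<noteq> (0::complex)" and lim: "\<And>i. (\<lambda>n. k n * \<phi> (Z (r n)) i) \<longlonglongrightarrow> x i"
        and Zr: "(\<lambda>n. Z (r n)) \<longlonglongrightarrow> \<nu>"
        and "\<And>n. (\<lambda>i. k n * \<phi> (Z (r n)) i) \<in> S (Z (r n))"
        by (rule subseq_limit[OF Z(1) \<phi>(1)[OF in\<delta>] \<phi>nz[OF in\<delta>]]) (rule that)
      have ax: "a \<nu> x \<noteq> 0" using anz[OF \<nu> x] .
      \<comment> \<open>\<open>\<phi>\<close> was chosen separately at every energy, so its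
        continuity is not known beforehand; applying \<open>a\<close> controls the scaling factors
        \<open>k\<close>.\<close>
      have lk: "k \<longlonglongrightarrow> a \<nu> x"
      proof -
        have "(\<lambda>n. a (Z (r n)) (\<lambda>i. k n * \<phi> (Z (r n)) i)) \<longlonglongrightarrow> a \<nu> x" by (rule a_lim[OF Zr lim])
        then show ?thesis by (simp add: a_scale \<phi>(2)[OF in\<delta>])
      qed
      have "(\<lambda>n. G (Z (r n)) \<nu> (\<lambda>i. k n * \<phi> (Z (r n)) i) (\<phi> \<nu>)) \<longlonglongrightarrow> G \<nu> \<nu> x (\<phi> \<nu>)"
        by (rule G_lim[OF Zr lim])
      then have "(\<lambda>n. k n * G (Z (r n)) \<nu> (\<phi> (Z (r n))) (\<phi> \<nu>)) \<longlonglongrightarrow> a \<nu> x * complex_of_real g"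
        using span[OF \<nu> x(1)] G_scale[of \<nu> \<nu> "a \<nu> x" "\<phi> \<nu>" "\<phi> \<nu>"] g(2) by (simp add: G_scale)
      from tendsto_divide[OF this lk ax]
      have "(\<lambda>n. G (Z (r n)) \<nu> (\<phi> (Z (r n))) (\<phi> \<nu>)) \<longlonglongrightarrow> complex_of_real g"
        using ax k by simp
      moreover have "G (Z n) \<nu> (\<phi> (Z n)) (\<phi> \<nu>) = complex_of_real ((m (Z n) - m \<nu>) / (Z n - \<nu>))" for n
      proof -
        have "complex_of_real (Z n - \<nu>) \<noteq> 0" using Z(2)[of n]
          by (metis eq_iff_diff_eq_0 of_real_eq_0_iff)
        then show ?thesis
          using green[OF \<phi>(1)[OF in\<delta>, of n] \<phi>(1)[OF \<nu>]]
          by (simp add: m[OF \<nu>] m[OF in\<delta>] \<phi>(2)[OF \<nu>] \<phi>(2)[OF in\<delta>] field_simps)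
      qed
      ultimately have "(\<lambda>n. (m (Z (r n)) - m \<nu>) / (Z (r n) - \<nu>)) \<longlonglongrightarrow> g"
        using tendsto_of_real_iff[of "\<lambda>n. (m (Z (r n)) - m \<nu>) / (Z (r n) - \<nu>)" g sequentially, where ?'a = complex]
        by simp
      then show "\<exists>r::nat\<Rightarrow>nat. strict_mono r \<and> (\<lambda>n. (m (Z (r n)) - m \<nu>) / (Z (r n) - \<nu>)) \<longlonglongrightarrow> g"
        using r by blast
    qed
    then show ?thesis using g(1) by (auto simp: has_field_derivative_iff)
  qed
  \<comment> \<open>Compact and inside the domain: the inverse of a continuous injection is
    continuous on the image of a compact set.\<close>
  define K where "K = {\<mu> - \<delta>/2..\<mu> + \<delta>/2}"
  have K: "\<bar>\<nu> - \<mu>\<bar> < \<delta>" if "\<nu> \<in> K" for \<nu> using that \<delta> unfolding K_def by (auto simp: abs_if field_simps)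
  have inc: "m s < m s'" if "s \<in> K" "s' \<in> K" "s < s'" for s s'
  proof (rule DERIV_pos_imp_increasing[OF that(3)])
    fix y assume "s \<le> y" "y \<le> s'"
    then have "y \<in> K" using that by (auto simp: K_def)
    then show "\<exists>g. DERIV m y :> g \<and> g > 0" using deriv[OF K] by blast
  qed
  have inj: "inj_on m K" by (rule linorder_inj_onI') (use inc in force)
  have contm: "continuous_on K m"
    using deriv[OF K] by (meson DERIV_isCont continuous_at_imp_continuous_on)
  define lam where "lam = inv_into K m"
  have lam: "lam (m s) = s" if "s \<in> K" for s using inv_into_f_f[OF inj that] by (simp add: lam_def)
  have contl: "continuous_on (m ` K) lam"
    by (rule continuous_on_inv[OF contm]) (use lam in \<open>auto simp: K_def\<close>)
  \<comment> \<open>\<open>m\<close> is increasing on \<open>K\<close> with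
    \<open>m \<mu> = t\<^sub>0\<close>, so this is the smaller distance from
    \<open>t\<^sub>0\<close> to an end of the image of \<open>K\<close>.\<close>
  define \<epsilon> where "\<epsilon> = min (t\<^sub>0 - m (\<mu> - \<delta>/2)) (m (\<mu> + \<delta>/2) - t\<^sub>0)"
  have \<epsilon>: "\<epsilon> > 0" using inc[of "\<mu> - \<delta>/2" \<mu>] inc[of \<mu> "\<mu> + \<delta>/2"] \<delta> by (simp add: \<epsilon>_def K_def m0)
  have sub: "{t\<^sub>0 - \<epsilon><..<t\<^sub>0 + \<epsilon>} \<subseteq> m ` K"
  proof
    fix t assume "t \<in> {t\<^sub>0 - \<epsilon><..<t\<^sub>0 + \<epsilon>}"
    then have "m (\<mu> - \<delta>/2) \<le> t" "t \<le> m (\<mu> + \<delta>/2)" by (auto simp: \<epsilon>_def)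
    then have "\<exists>s\<ge>\<mu> - \<delta>/2. s \<le> \<mu> + \<delta>/2 \<and> m s = t"
      using contm \<delta> by (intro IVT') (auto simp: K_def)
    then show "t \<in> m ` K" by (auto simp: K_def)
  qed
  have "simple t (lam t)" if "t \<in> {t\<^sub>0 - \<epsilon><..<t\<^sub>0 + \<epsilon>}" for t
  proof -
    from sub that obtain s where s: "s \<in> K" "t = m s" by blast
    have l: "lam t = s" using lam s by simp
    note \<nu> = K[OF s(1)]
    have "\<phi> s \<in> eigenspace t s" using \<phi>[OF \<nu>] m[OF \<nu>] s by (simp add: eigenspace_def)
    moreover have "\<exists>c. y = (\<lambda>i. c * \<phi> s i)" if "y \<in> eigenspace t s" for y
      using span[OF \<nu>] that unfolding eigenspace_def by blast
    ultimately show ?thesis unfolding simple_def l using \<phi>nz[OF \<nu>] by blast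
  qed
  moreover have "lam t\<^sub>0 = \<mu>" using lam[of \<mu>] \<delta> by (simp add: K_def m0)
  ultimately have "branch t\<^sub>0 \<mu> lam"
    unfolding branch_def using \<epsilon> continuous_on_subset[OF contl sub] by blast
  then show ?thesis by blast
qed

theorem branch_exists:
  assumes "simple t\<^sub>0 \<mu>"
  shows "\<exists>lam. branch t\<^sub>0 \<mu> lam"
proof -
  obtain x where "x \<in> eigenspace t\<^sub>0 \<mu>" "x \<noteq> (\<lambda>i. 0)" using assms by (auto simp: simple_def)
  then show ?thesis
    using branch_exists_degenerate[OF assms] branch_exists_nondegenerate[OF assms] by blast
qed

end

section \<open>Integration by parts\<close>

lemma absolutely_integrable_mult_continuous:
  fixes h u :: "real \<Rightarrow> complex"
  assumes "h absolutely_integrable_on {a..b}" "continuous_on {a..b} u"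
  shows "(\<lambda>t. h t * u t) absolutely_integrable_on {a..b}"
proof -
  have "(\<lambda>t. u t * h t) absolutely_integrable_on {a..b}"
  proof (rule absolutely_integrable_bounded_measurable_product[where h = "(*)"])
    show "bilinear ((*) :: complex \<Rightarrow> complex \<Rightarrow> complex)"
      by (simp add: bilinear_times)
    show "u \<in> borel_measurable (lebesgue_on {a..b})"
      by (rule continuous_imp_measurable_on_sets_lebesgue) (use assms in auto)
    show "bounded (u ` {a..b})"
      using compact_continuous_image[OF assms(2)] compact_imp_bounded by blast
  qed (use assms in auto)
  then show ?thesis by (simp add: mult.commute)
qed

lemma absolutely_integrable_on_Icc_subset:
  fixes h :: "real \<Rightarrow> complex"
  assumes "h absolutely_integrable_on {0..L}" "0 \<le> a" "b \<le> L"
  shows "h absolutely_integrable_on {a..b}"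
  by (rule set_integrable_subset[OF assms(1)]) (use assms in auto)

text \<open>
  The first factor is only absolutely continuous. The difference of the two sides is constant because
  its increments are bounded by the step length times the integral of \<open>norm h\<close> over the step.
\<close>

lemma integration_by_parts_absolutely_continuous:
  fixes H G h G' :: "real \<Rightarrow> complex"
  assumes h: "h absolutely_integrable_on {0..L}"
    and H: "\<And>x. x \<in> {0..L} \<Longrightarrow> H x = H 0 + integral {0..x} h"
    and G: "\<And>x. x \<in> {0..L} \<Longrightarrow> (G has_vector_derivative G' x) (at x within {0..L})"
    and G': "continuous_on {0..L} G'"
    and x: "x \<in> {0..L}"
  shows "H x * G x - H 0 * G 0 = integral {0..x} (\<lambda>t. h t * G t + H t * G' t)"
proof -
  have hi: "h integrable_on {0..L}" using h set_lebesgue_integral_eq_integral(1) by blast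
  have nh: "(\<lambda>t. norm (h t)) integrable_on {0..L}"
    using h by (simp add: absolutely_integrable_on_def)
  have contG: "continuous_on {0..L} G"
    using G by (rule continuous_on_vector_derivative)
  have "continuous_on {0..L} (\<lambda>x. H 0 + integral {0..x} h)"
    by (intro continuous_intros indefinite_integral_continuous_1 hi)
  then have contH: "continuous_on {0..L} H"
    by (rule continuous_on_eq) (rule H[symmetric])
  obtain B where B: "B > 0" "\<And>t. t \<in> {0..L} \<Longrightarrow> norm (G' t) \<le> B"
    using compact_imp_bounded[OF compact_continuous_image[OF G' compact_Icc]]
    unfolding bounded_pos by auto
  have hG: "(\<lambda>t. h t * G t) absolutely_integrable_on {0..L}"
    by (rule absolutely_integrable_mult_continuous[OF h contG])
  have HG': "(\<lambda>t. H t * G' t) integrable_on {0..L}"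
    by (intro integrable_continuous_real continuous_intros contH G')
  have tot: "(\<lambda>t. h t * G t + H t * G' t) integrable_on {0..L}"
    using hG HG' set_lebesgue_integral_eq_integral(1) by (intro integrable_add) blast+
  \<comment> \<open>The variation function of \<open>H\<close>: it bounds the increments of
    \<open>H\<close> and is continuous even where \<open>H\<close> has no derivative.\<close>
  define Q where "Q x = integral {0..x} (\<lambda>t. norm (h t))" for x
  have contQ: "continuous_on {0..L} Q"
    unfolding Q_def by (rule indefinite_integral_continuous_1[OF nh])
  define \<phi> where "\<phi> x = H x * G x - integral {0..x} (\<lambda>t. h t * G t + H t * G' t)" for x
  have sub: "f integrable_on {y..z}" if "f integrable_on {0..L}" "0 \<le> y" "z \<le> L" for f :: "real \<Rightarrow> complex" and y z
    using that by (auto intro: integrable_on_subinterval)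
  have subr: "f integrable_on {y..z}" if "f integrable_on {0..L}" "0 \<le> y" "z \<le> L" for f :: "real \<Rightarrow> real" and y z
    using that by (auto intro: integrable_on_subinterval)
  have step: "norm (\<phi> z - \<phi> y) \<le> 2 * B * (z - y) * (Q z - Q y)" if yz: "0 \<le> y" "y \<le> z" "z \<le> L" for y z
  proof -
    have Gd: "norm (G t - G s) \<le> B * (t - s)" if "0 \<le> s" "s \<le> t" "t \<le> L" for s t
    proof -
      have "(G' has_integral (G t - G s)) {s..t}"
        by (rule fundamental_theorem_of_calculus)
          (use that in \<open>auto intro: has_vector_derivative_within_subset[OF G]\<close>)
      then have "norm (G t - G s) \<le> B * measure lborel {s..t}"
        by (rule has_integral_bound_real[rotated 2, where S="{}"]) (use B that in auto)
      then show ?thesis using that by simp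
    qed
    have int: "integral {0..z} f - integral {0..y} f = integral {y..z} f"
      if "f integrable_on {0..L}" for f :: "real \<Rightarrow> complex"
      using Henstock_Kurzweil_Integration.integral_combine[OF yz(1,2) sub[OF that _ yz(3)]] by (simp add: algebra_simps)
    have intr: "Q z - Q y = integral {y..z} (\<lambda>t. norm (h t))"
      using Henstock_Kurzweil_Integration.integral_combine[OF yz(1,2) subr[OF nh _ yz(3)]] by (simp add: Q_def algebra_simps)
    have Hd: "H t - H y = integral {y..t} h" and Hn: "norm (H t - H y) \<le> Q z - Q y" if t: "y \<le> t" "t \<le> z" for t
    proof -
      have "integral {0..y} h + integral {y..t} h = integral {0..t} h"
        by (rule Henstock_Kurzweil_Integration.integral_combine) (use yz t sub[OF hi] in auto)
      then show 1: "H t - H y = integral {y..t} h"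
        using H[of t] H[of y] yz t by (simp add: algebra_simps)
      have "norm (integral {y..t} h) \<le> integral {y..t} (\<lambda>t. norm (h t))"
        by (rule integral_norm_bound_integral) (use yz t sub[OF hi] subr[OF nh] in auto)
      also have "\<dots> \<le> integral {y..z} (\<lambda>t. norm (h t))"
        by (rule integral_subset_le) (use yz t subr[OF nh] in auto)
      finally show "norm (H t - H y) \<le> Q z - Q y" using 1 intr by simp
    qed
    have Gint: "integral {y..z} G' = G z - G y"
      by (rule integral_unique, rule fundamental_theorem_of_calculus)
        (use yz in \<open>auto intro: has_vector_derivative_within_subset[OF G]\<close>)
    have i1: "(\<lambda>t. h t * G t) integrable_on {y..z}"
      using hG set_lebesgue_integral_eq_integral(1) yz sub by blast
    have i2: "(\<lambda>t. H t * G' t) integrable_on {y..z}" using HG' yz sub by blast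
    have i3: "h integrable_on {y..z}" using hi yz sub by blast
    have i4: "G' integrable_on {y..z}"
      using integrable_continuous_real[OF G'] yz sub by blast
    have i5: "(\<lambda>t. norm (h t)) integrable_on {y..z}" using nh yz subr by blast
    have "\<phi> z - \<phi> y = (H z - H y) * G z + H y * (G z - G y)
        - (integral {0..z} (\<lambda>t. h t * G t + H t * G' t) - integral {0..y} (\<lambda>t. h t * G t + H t * G' t))"
      by (simp add: \<phi>_def algebra_simps)
    also have "\<dots> = integral {y..z} h * G z + H y * integral {y..z} G'
        - (integral {y..z} (\<lambda>t. h t * G t) + integral {y..z} (\<lambda>t. H t * G' t))"
      unfolding int[OF tot] using Hd[of z] yz Gint i1 i2
      by (simp add: Henstock_Kurzweil_Integration.integral_add)
    \<comment> \<open>Comparison with the constants \<open>G z\<close> and \<open>H y\<close> leaves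
      integrands that contain an increment of \<open>G\<close> or of \<open>H\<close>; each of the
      two integrals is at most \<open>B * (z - y) * (Q z - Q y)\<close>.\<close>
    also have "\<dots> = integral {y..z} (\<lambda>t. h t * (G z - G t)) - integral {y..z} (\<lambda>t. (H t - H y) * G' t)"
    proof -
      have "integral {y..z} (\<lambda>t. h t * (G z - G t)) = integral {y..z} h * G z - integral {y..z} (\<lambda>t. h t * G t)"
        using i1 i3 by (simp add: right_diff_distrib Henstock_Kurzweil_Integration.integral_diff integrable_on_mult_left)
      moreover have "integral {y..z} (\<lambda>t. (H t - H y) * G' t) = integral {y..z} (\<lambda>t. H t * G' t) - H y * integral {y..z} G'"
        using i2 i4 by (simp add: left_diff_distrib Henstock_Kurzweil_Integration.integral_diff integrable_on_mult_right)
      ultimately show ?thesis by (simp add: algebra_simps)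
    qed
    finally have eq: "\<phi> z - \<phi> y = integral {y..z} (\<lambda>t. h t * (G z - G t)) - integral {y..z} (\<lambda>t. (H t - H y) * G' t)" .
    have "norm (integral {y..z} (\<lambda>t. h t * (G z - G t))) \<le> integral {y..z} (\<lambda>t. norm (h t) * (B * (z - y)))"
    proof (rule integral_norm_bound_integral)
      show "(\<lambda>t. h t * (G z - G t)) integrable_on {y..z}"
        using i1 i3 by (simp add: right_diff_distrib integrable_diff integrable_on_mult_left)
      show "(\<lambda>t. norm (h t) * (B * (z - y))) integrable_on {y..z}" using i5 by (rule integrable_on_mult_left)
      show "norm (h t * (G z - G t)) \<le> norm (h t) * (B * (z - y))" if "t \<in> {y..z}" for t
      proof -
        have "norm (G z - G t) \<le> B * (z - t)" using Gd[of t z] that yz by auto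
        also have "\<dots> \<le> B * (z - y)" using that B by (intro mult_left_mono) auto
        finally show ?thesis by (simp add: norm_mult mult_left_mono)
      qed
    qed
    also have "\<dots> = B * (z - y) * (Q z - Q y)" by (simp add: intr)
    finally have n1: "norm (integral {y..z} (\<lambda>t. h t * (G z - G t))) \<le> B * (z - y) * (Q z - Q y)" .
    have Q0: "Q z - Q y \<ge> 0" using Hn[of y] yz by simp
    have "norm (integral {y..z} (\<lambda>t. (H t - H y) * G' t)) \<le> integral {y..z} (\<lambda>t. (Q z - Q y) * B)"
    proof (rule integral_norm_bound_integral)
      show "(\<lambda>t. (H t - H y) * G' t) integrable_on {y..z}"
        using i2 i4 by (simp add: left_diff_distrib integrable_diff integrable_on_mult_right)
      show "norm ((H t - H y) * G' t) \<le> (Q z - Q y) * B" if "t \<in> {y..z}" for t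
        unfolding norm_mult by (rule mult_mono) (use Hn B Q0 that yz in auto)
    qed auto
    also have "\<dots> = B * (z - y) * (Q z - Q y)" using yz by simp
    finally have n2: "norm (integral {y..z} (\<lambda>t. (H t - H y) * G' t)) \<le> B * (z - y) * (Q z - Q y)" .
    have "norm (\<phi> z - \<phi> y) \<le> B * (z - y) * (Q z - Q y) + B * (z - y) * (Q z - Q y)"
      unfolding eq by (rule order_trans[OF norm_triangle_ineq4 add_mono[OF n1 n2]])
    then show ?thesis by simp
  qed
  \<comment> \<open>Divided by the step, the bound is \<open>2 * B * \<bar>Q z - Q y\<bar>\<close>,
    which tends to 0 by continuity of \<open>Q\<close>. So the derivative is 0 at every point and
    not just almost everywhere, as constancy requires.\<close>
  have "(\<phi> has_vector_derivative 0) (at y within {0..L})" if y: "y \<in> {0..L}" for y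
  proof -
    have "((\<lambda>z. 2 * B * \<bar>Q z - Q y\<bar>) \<longlongrightarrow> 2 * B * \<bar>Q y - Q y\<bar>) (at y within {0..L})"
      by (intro tendsto_intros) (use contQ y in \<open>simp add: continuous_on_def\<close>)
    then have lim: "((\<lambda>z. 2 * B * \<bar>Q z - Q y\<bar>) \<longlongrightarrow> 0) (at y within {0..L})" by simp
    have bnd: "norm (\<phi> z - \<phi> y) \<le> (2 * B * \<bar>Q z - Q y\<bar>) * norm (z - y)" if z: "z \<in> {0..L}" for z
    proof (cases "y \<le> z")
      case True
      have "norm (\<phi> z - \<phi> y) \<le> (2 * B * (z - y)) * (Q z - Q y)" using step[of y z] y z True by simp
      also have "\<dots> \<le> (2 * B * (z - y)) * \<bar>Q z - Q y\<bar>"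
        using True B by (intro mult_left_mono) auto
      also have "\<dots> = (2 * B * \<bar>Q z - Q y\<bar>) * norm (z - y)" using True by (simp add: algebra_simps)
      finally show ?thesis .
    next
      case False
      have "norm (\<phi> z - \<phi> y) \<le> (2 * B * (y - z)) * (Q y - Q z)" using step[of z y] y z False by (simp add: norm_minus_commute)
      also have "\<dots> \<le> (2 * B * (y - z)) * \<bar>Q z - Q y\<bar>"
        using False B by (intro mult_left_mono) auto
      also have "\<dots> = (2 * B * \<bar>Q z - Q y\<bar>) * norm (z - y)" using False by (simp add: algebra_simps)
      finally show ?thesis .
    qed
    have "((\<lambda>z. (\<phi> z - \<phi> y) /\<^sub>R norm (z - y)) \<longlongrightarrow> 0) (at y within {0..L})"
    proof (rule Lim_null_comparison[OF _ lim])
      show "\<forall>\<^sub>F z in at y within {0..L}. norm ((\<phi> z - \<phi> y) /\<^sub>R norm (z - y)) \<le> 2 * B * \<bar>Q z - Q y\<bar>"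
        unfolding eventually_at_filter
      proof (intro always_eventually allI impI)
        fix z assume "z \<noteq> y" "z \<in> {0..L}"
        then have "norm (\<phi> z - \<phi> y) / norm (z - y) \<le> 2 * B * \<bar>Q z - Q y\<bar>"
          using bnd[of z] by (subst pos_divide_le_eq) auto
        then show "norm ((\<phi> z - \<phi> y) /\<^sub>R norm (z - y)) \<le> 2 * B * \<bar>Q z - Q y\<bar>"
          by (simp add: divide_inverse mult.commute)
      qed
    qed
    then show ?thesis
      by (simp add: has_vector_derivative_def has_derivative_within divide_inverse)
  qed
  then have "\<phi> x = \<phi> 0"
    by (intro has_derivative_zero_unique[where s = "{0..L}"]) (use x in \<open>auto simp: has_vector_derivative_def\<close>)
  then show ?thesis by (simp add: \<phi>_def algebra_simps)
qed

section \<open>The initial value problem on a segment\<close>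

lemma integral_exp:
  assumes "K > (0::real)" "0 \<le> x"
  shows "((\<lambda>t. exp (K * t)) has_integral (exp (K * x) - 1) / K) {0..x}"
proof -
  have "((\<lambda>t. exp (K * t)) has_integral exp (K * x) / K - exp (K * 0) / K) {0..x}"
    using assms
    by (intro fundamental_theorem_of_calculus)
      (auto intro!: derivative_eq_intros simp flip: has_real_derivative_iff_has_vector_derivative)
  then show ?thesis by (simp add: diff_divide_distrib)
qed

locale schroedinger_segment =
  fixes L :: real and V :: "real \<Rightarrow> real"
  assumes L_pos: "0 < L"
    and V_int: "V absolutely_integrable_on {0..L}"
    and V_sq_int: "(\<lambda>t. (V t)\<^sup>2) absolutely_integrable_on {0..L}"
begin

text \<open>The two operators integrate \<open>(V - \<nu>) u\<close> once and twice from 0. In this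
  form the equation \<open>f'' = (V - \<nu>) f\<close> involves neither a second derivative nor an
  exceptional null set.\<close>

definition volterra1 :: "real \<Rightarrow> (real \<Rightarrow> complex) \<Rightarrow> real \<Rightarrow> complex" where
  "volterra1 \<nu> u x = integral {0..x} (\<lambda>t. complex_of_real (V t - \<nu>) * u t)"

definition volterra2 :: "real \<Rightarrow> (real \<Rightarrow> complex) \<Rightarrow> real \<Rightarrow> complex" where
  "volterra2 \<nu> u x = integral {0..x} (volterra1 \<nu> u)"

text \<open>Carrying the derivative \<open>g\<close> as a separate function keeps the Cauchy data
  \<open>f 0\<close> and \<open>g 0\<close> explicit.\<close>

definition solves :: "real \<Rightarrow> (real \<Rightarrow> complex) \<Rightarrow> (real \<Rightarrow> complex) \<Rightarrow> bool" where
  "solves \<nu> f g \<longleftrightarrow>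
     (\<forall>x\<in>{0..L}. (f has_vector_derivative g x) (at x within {0..L})) \<and>
     (\<forall>x\<in>{0..L}. g x = g 0 + volterra1 \<nu> f x)"

lemma shifted_potential_integrable: "(\<lambda>t. complex_of_real (V t - \<nu>)) absolutely_integrable_on {0..L}"
proof -
  have "(\<lambda>t. V t - \<nu>) absolutely_integrable_on {0..L}"
    by (rule set_integral_diff(1)[OF V_int absolutely_integrable_on_const]) simp
  then have "(complex_of_real \<circ> (\<lambda>t. V t - \<nu>)) absolutely_integrable_on {0..L}"
    by (rule absolutely_integrable_linear) (rule bounded_linear_of_real)
  then show ?thesis by (simp add: o_def)
qed

lemma potential_mult_integrable:
  assumes "continuous_on {0..L} u"
  shows "(\<lambda>t. complex_of_real (V t - \<nu>) * u t) absolutely_integrable_on {0..L}"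
  by (rule absolutely_integrable_mult_continuous[OF shifted_potential_integrable assms])

lemma potential_mult_integrable_on:
  assumes "continuous_on {0..L} u" "x \<le> L"
  shows "(\<lambda>t. complex_of_real (V t - \<nu>) * u t) integrable_on {0..x}"
  using integrable_on_subinterval[OF set_lebesgue_integral_eq_integral(1)[OF potential_mult_integrable[OF assms(1)]]] assms(2)
  by auto

lemma volterra1_continuous:
  assumes "continuous_on {0..L} u"
  shows "continuous_on {0..L} (volterra1 \<nu> u)"
  unfolding volterra1_def
  by (rule indefinite_integral_continuous_1[OF potential_mult_integrable_on[OF assms order_refl]])

lemma volterra1_integrable_on:
  assumes "continuous_on {0..L} u" "x \<le> L"
  shows "volterra1 \<nu> u integrable_on {0..x}"
  by (rule integrable_continuous_real, rule continuous_on_subset[OF volterra1_continuous[OF assms(1)]]) (use assms(2) in auto)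

lemma volterra2_continuous:
  assumes "continuous_on {0..L} u"
  shows "continuous_on {0..L} (volterra2 \<nu> u)"
  unfolding volterra2_def
  by (rule indefinite_integral_continuous_1[OF volterra1_integrable_on[OF assms order_refl]])

lemma volterra1_lin:
  assumes "continuous_on {0..L} u" "continuous_on {0..L} w" "x \<le> L"
  shows "volterra1 \<nu> (\<lambda>t. u t + c * w t) x = volterra1 \<nu> u x + c * volterra1 \<nu> w x"
proof -
  have "volterra1 \<nu> (\<lambda>t. u t + c * w t) x =
      integral {0..x} (\<lambda>t. complex_of_real (V t - \<nu>) * u t + c * (complex_of_real (V t - \<nu>) * w t))"
    unfolding volterra1_def by (simp add: algebra_simps)
  also have "\<dots> = volterra1 \<nu> u x + c * volterra1 \<nu> w x"
    unfolding volterra1_def using potential_mult_integrable_on assms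
    by (subst Henstock_Kurzweil_Integration.integral_add) (auto intro: integrable_on_mult_right)
  finally show ?thesis .
qed

lemma volterra2_lin:
  assumes "continuous_on {0..L} u" "continuous_on {0..L} w" "x \<le> L"
  shows "volterra2 \<nu> (\<lambda>t. u t + c * w t) x = volterra2 \<nu> u x + c * volterra2 \<nu> w x"
proof -
  have "volterra2 \<nu> (\<lambda>t. u t + c * w t) x = integral {0..x} (\<lambda>t. volterra1 \<nu> u t + c * volterra1 \<nu> w t)"
    unfolding volterra2_def by (rule integral_cong) (use volterra1_lin assms in auto)
  also have "\<dots> = volterra2 \<nu> u x + c * volterra2 \<nu> w x"
    unfolding volterra2_def using volterra1_integrable_on assms
    by (subst Henstock_Kurzweil_Integration.integral_add) (auto intro: integrable_on_mult_right)
  finally show ?thesis .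
qed

text \<open>Isolates the energy as an explicit factor, the source of the Lipschitz dependence of
  solutions on it.\<close>

lemma volterra1_change_parameter:
  assumes "continuous_on {0..L} u" "x \<le> L"
  shows "volterra1 \<nu> u x = volterra1 \<mu> u x + complex_of_real (\<mu> - \<nu>) * integral {0..x} u"
proof -
  have ui: "u integrable_on {0..x}"
    by (rule integrable_continuous_real, rule continuous_on_subset[OF assms(1)]) (use assms(2) in auto)
  have "volterra1 \<nu> u x = integral {0..x} (\<lambda>t. complex_of_real (V t - \<mu>) * u t + complex_of_real (\<mu> - \<nu>) * u t)"
    unfolding volterra1_def by (simp add: algebra_simps)
  also have "\<dots> = volterra1 \<mu> u x + complex_of_real (\<mu> - \<nu>) * integral {0..x} u"
    unfolding volterra1_def using potential_mult_integrable_on[OF assms] ui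
    by (subst Henstock_Kurzweil_Integration.integral_add) (auto intro: integrable_on_mult_right)
  finally show ?thesis .
qed

text \<open>
  The weight \<open>exp (K * s)\<close> makes both Volterra operators contractions. Since the potential is square
  integrable, \<open>2 \<bar>V - \<nu>\<bar> exp (K t) \<le> \<epsilon> (V - \<nu>)\<^sup>2 exp (K s) + exp (2 K t - K s) / \<epsilon>\<close> suffices.
\<close>

lemma volterra_contraction:
  obtains K where "K \<ge> 1"
    "\<And>\<nu> u m s. \<bar>\<nu>\<bar> \<le> R \<Longrightarrow> continuous_on {0..L} u \<Longrightarrow> (\<And>t. t \<in> {0..L} \<Longrightarrow> norm (u t) \<le> m * exp (K * t)) \<Longrightarrow>
       s \<in> {0..L} \<Longrightarrow> norm (volterra1 \<nu> u s) \<le> m / 2 * exp (K * s) \<and> norm (volterra2 \<nu> u s) \<le> m / 2 * exp (K * s)"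
proof -
  have Vi: "(\<lambda>t. (V t)\<^sup>2) integrable_on {0..L}" using V_sq_int set_lebesgue_integral_eq_integral(1) by blast
  define A where "A = integral {0..L} (\<lambda>t. (V t)\<^sup>2) + R\<^sup>2 * L"
  have A0: "A \<ge> 0" unfolding A_def using L_pos Vi
    by (intro add_nonneg_nonneg integral_nonneg) auto
  \<comment> \<open>\<open>\<epsilon> * A \<le> 1/4\<close> bounds the first half of the estimate by
    a quarter and \<open>K * \<epsilon> \<ge> 1\<close> the second; together they give the factor
    \<open>1/2\<close>. \<open>K \<ge> 1\<close> ensures that the second integration does not spoil
    it.\<close>
  define \<epsilon> where "\<epsilon> = 1 / (4 * (A + 1))"
  have \<epsilon>: "\<epsilon> > 0" "\<epsilon> * A \<le> 1/4" using A0 by (auto simp: \<epsilon>_def field_simps)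
  define K where "K = max 1 (1 / \<epsilon>)"
  have K: "K \<ge> 1" "K * \<epsilon> \<ge> 1" using \<epsilon> by (auto simp: K_def max_def field_simps)
  have m_nonneg: "m \<ge> 0" if "\<And>t. t \<in> {0..L} \<Longrightarrow> norm (u t) \<le> m * exp (K * t)" for u :: "real \<Rightarrow> complex" and m
    using order_trans[OF norm_ge_zero that[of 0]] L_pos by simp
  have v1: "norm (volterra1 \<nu> u s) \<le> m / 2 * exp (K * s)"
    if \<nu>: "\<bar>\<nu>\<bar> \<le> R" and u: "continuous_on {0..L} u" and bnd: "\<And>t. t \<in> {0..L} \<Longrightarrow> norm (u t) \<le> m * exp (K * t)"
      and s: "s \<in> {0..L}" for \<nu> u m s
  proof -
    have m0: "m \<ge> 0" by (rule m_nonneg[OF bnd])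
    \<comment> \<open>A majorant of the integrand in which \<open>(V t - \<nu>)\<^sup>2\<close> is
      replaced by its bound \<open>2 * ((V t)\<^sup>2 + R\<^sup>2)\<close>, so that it serves all
      \<open>\<nu>\<close> in the range at once.\<close>
    define p where "p t = m * (\<epsilon> * ((V t)\<^sup>2 + R\<^sup>2) * exp (K * s) + exp ((2 * K) * t) * (exp (- K * s) / (2 * \<epsilon>)))" for t
    have Vs: "(\<lambda>t. (V t)\<^sup>2) integrable_on {0..s}" using Vi by (rule integrable_on_subinterval) (use s in auto)
    have VR: "((\<lambda>t. (V t)\<^sup>2 + R\<^sup>2) has_integral (integral {0..s} (\<lambda>t. (V t)\<^sup>2) + R\<^sup>2 * s)) {0..s}"
      using has_integral_add[OF integrable_integral[OF Vs] has_integral_const_real[of "R\<^sup>2" 0 s]] s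
      by (simp add: mult.commute)
    have p: "(p has_integral m * (\<epsilon> * (integral {0..s} (\<lambda>t. (V t)\<^sup>2) + R\<^sup>2 * s) * exp (K * s) +
        (exp ((2 * K) * s) - 1) / (2 * K) * (exp (- K * s) / (2 * \<epsilon>)))) {0..s}"
      unfolding p_def[abs_def]
      by (rule has_integral_mult_right[OF has_integral_add[OF has_integral_mult_left[OF has_integral_mult_right[OF VR]]
            has_integral_mult_left[OF integral_exp]]]) (use K s in auto)
    have "norm (volterra1 \<nu> u s) \<le> integral {0..s} p"
      unfolding volterra1_def
    proof (rule integral_norm_bound_integral)
      show "p integrable_on {0..s}" using p by blast
      show "(\<lambda>t. complex_of_real (V t - \<nu>) * u t) integrable_on {0..s}"
        using potential_mult_integrable_on[OF u] s by auto
      fix t assume t: "t \<in> {0..s}"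
      define X where "X = \<bar>V t - \<nu>\<bar>"
      define Y where "Y = exp (K * t)"
      define Z where "Z = exp (K * s)"
      have Z: "Z > 0" by (simp add: Z_def)
      have X2: "X\<^sup>2 \<le> 2 * ((V t)\<^sup>2 + R\<^sup>2)"
      proof -
        have "\<nu>\<^sup>2 \<le> R\<^sup>2" using \<nu> by (metis abs_le_square_iff abs_ge_self order_trans)
        moreover have "0 \<le> (V t + \<nu>)\<^sup>2" by simp
        ultimately show ?thesis by (simp add: X_def power2_eq_square algebra_simps)
      qed
      \<comment> \<open>Young's inequality with a weight: it separates the rough factor
        \<open>X\<close> from the exponential \<open>Y\<close>, so that only
        \<open>X\<^sup>2\<close> has to be integrated.\<close>
      have "0 \<le> (\<epsilon> * X * Z - Y)\<^sup>2" by simp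
      then have "2 * \<epsilon> * Z * (X * Y) \<le> \<epsilon>\<^sup>2 * X\<^sup>2 * Z\<^sup>2 + Y\<^sup>2" by (simp add: power2_eq_square algebra_simps)
      also have "\<dots> \<le> \<epsilon>\<^sup>2 * (2 * ((V t)\<^sup>2 + R\<^sup>2)) * Z\<^sup>2 + Y\<^sup>2"
        by (intro add_right_mono mult_right_mono mult_left_mono X2) auto
      finally have "X * Y \<le> (\<epsilon>\<^sup>2 * (2 * ((V t)\<^sup>2 + R\<^sup>2)) * Z\<^sup>2 + Y\<^sup>2) / (2 * \<epsilon> * Z)"
        using \<epsilon> Z by (simp add: field_simps)
      also have "\<dots> = \<epsilon> * ((V t)\<^sup>2 + R\<^sup>2) * Z + Y\<^sup>2 * (1 / Z / (2 * \<epsilon>))"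
        using \<epsilon> Z by (simp add: field_simps power2_eq_square)
      also have "Y\<^sup>2 = exp ((2 * K) * t)" by (simp add: Y_def power2_eq_square flip: exp_add)
      also have "1 / Z = exp (- K * s)" by (simp add: Z_def exp_minus field_simps)
      finally have XY: "X * Y \<le> p t / m" if "m \<noteq> 0" using that by (simp add: p_def Z_def)
      have "norm (complex_of_real (V t - \<nu>) * u t) = X * norm (u t)"
        unfolding norm_mult norm_of_real X_def ..
      also have "\<dots> \<le> X * (m * Y)" unfolding Y_def by (intro mult_left_mono bnd) (use t s in \<open>auto simp: X_def\<close>)
      also have "\<dots> \<le> p t"
      proof (cases "m = 0")
        case False
        then show ?thesis using XY m0 by (simp add: field_simps)
      qed (simp add: p_def)
      finally show "norm (complex_of_real (V t - \<nu>) * u t) \<le> p t" .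
    qed
    also have "\<dots> = m * (\<epsilon> * (integral {0..s} (\<lambda>t. (V t)\<^sup>2) + R\<^sup>2 * s) * exp (K * s) +
        (exp ((2 * K) * s) - 1) / (2 * K) * (exp (- K * s) / (2 * \<epsilon>)))"
      using p by (rule integral_unique)
    also have "\<dots> \<le> m * (1/4 * exp (K * s) + 1/4 * exp (K * s))"
    proof (intro mult_left_mono add_mono m0)
      have "integral {0..s} (\<lambda>t. (V t)\<^sup>2) + R\<^sup>2 * s \<le> A"
        unfolding A_def using s Vs Vi by (intro add_mono integral_subset_le mult_left_mono) auto
      then have "\<epsilon> * (integral {0..s} (\<lambda>t. (V t)\<^sup>2) + R\<^sup>2 * s) \<le> \<epsilon> * A"
        using \<epsilon> by (intro mult_left_mono) auto
      from order_trans[OF this \<epsilon>(2)]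
      show "\<epsilon> * (integral {0..s} (\<lambda>t. (V t)\<^sup>2) + R\<^sup>2 * s) * exp (K * s) \<le> 1/4 * exp (K * s)"
        by (rule mult_right_mono) simp
      have "(exp ((2 * K) * s) - 1) / (2 * K) * (exp (- K * s) / (2 * \<epsilon>))
          \<le> exp ((2 * K) * s) / (2 * K) * (exp (- K * s) / (2 * \<epsilon>))"
        using K \<epsilon> by (intro mult_right_mono divide_right_mono) auto
      also have "\<dots> = exp (K * s) / (4 * (K * \<epsilon>))"
      proof -
        have "exp ((2 * K) * s) * exp (- K * s) = exp (K * s)" by (simp flip: exp_add)
        then show ?thesis by (simp add: mult.commute mult.left_commute)
      qed
      also have "\<dots> \<le> exp (K * s) / 4" using K(2) by (intro divide_left_mono) auto
      finally show "(exp ((2 * K) * s) - 1) / (2 * K) * (exp (- K * s) / (2 * \<epsilon>)) \<le> 1/4 * exp (K * s)" by simp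
    qed
    finally show ?thesis by simp
  qed
  have v2: "norm (volterra2 \<nu> u s) \<le> m / 2 * exp (K * s)"
    if \<nu>: "\<bar>\<nu>\<bar> \<le> R" and u: "continuous_on {0..L} u" and bnd: "\<And>t. t \<in> {0..L} \<Longrightarrow> norm (u t) \<le> m * exp (K * t)"
      and s: "s \<in> {0..L}" for \<nu> u m s
  proof -
    have m0: "m \<ge> 0" by (rule m_nonneg[OF bnd])
    have e: "((\<lambda>t. m / 2 * exp (K * t)) has_integral m / 2 * ((exp (K * s) - 1) / K)) {0..s}"
      by (intro has_integral_mult_right integral_exp) (use K s in auto)
    have "norm (volterra2 \<nu> u s) \<le> integral {0..s} (\<lambda>t. m / 2 * exp (K * t))"
      unfolding volterra2_def
      by (rule integral_norm_bound_integral) (use volterra1_integrable_on[OF u] e v1[OF \<nu> u bnd] s in auto)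
    also have "\<dots> = m / 2 * ((exp (K * s) - 1) / K)" using e by (rule integral_unique)
    also have "\<dots> \<le> m / 2 * exp (K * s)"
    proof (rule mult_left_mono)
      have "exp (K * s) \<le> exp (K * s) * K" using K by simp
      then have "exp (K * s) - 1 \<le> exp (K * s) * K" by linarith
      then show "(exp (K * s) - 1) / K \<le> exp (K * s)" using K by (simp add: field_simps)
    qed (use m0 in auto)
    finally show ?thesis .
  qed
  show ?thesis by (rule that[OF K(1)]) (use v1 v2 in blast)
qed

text \<open>At a point where \<open>norm (f x) * exp (- K * x)\<close> attains its maximum
  \<open>M\<close>, the equation gives \<open>M \<le> m + M / 2\<close>.\<close>

lemma volterra_a_priori:
  assumes con: "\<And>u m s. continuous_on {0..L} u \<Longrightarrow> (\<And>t. t \<in> {0..L} \<Longrightarrow> norm (u t) \<le> m * exp (K * t)) \<Longrightarrow>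
       s \<in> {0..L} \<Longrightarrow> norm (volterra2 \<nu> u s) \<le> m / 2 * exp (K * s)"
    and f: "continuous_on {0..L} f" and eq: "\<And>x. x \<in> {0..L} \<Longrightarrow> f x = \<phi> x + volterra2 \<nu> f x"
    and \<phi>: "\<And>x. x \<in> {0..L} \<Longrightarrow> norm (\<phi> x) \<le> m * exp (K * x)"
    and x: "x \<in> {0..L}"
  shows "norm (f x) \<le> 2 * m * exp (K * x)"
proof -
  have cont: "continuous_on {0..L} (\<lambda>t. norm (f t) * exp (- K * t))" by (intro continuous_intros f)
  have ne: "{0..L} \<noteq> {}" using L_pos by auto
  obtain s where s: "s \<in> {0..L}" "\<And>t. t \<in> {0..L} \<Longrightarrow> norm (f t) * exp (- K * t) \<le> norm (f s) * exp (- K * s)"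
    using continuous_attains_sup[OF compact_Icc ne cont] by blast
  define M where "M = norm (f s) * exp (- K * s)"
  have fs: "norm (f s) = M * exp (K * s)" by (simp add: M_def mult.assoc flip: exp_add)
  have M: "norm (f t) \<le> M * exp (K * t)" if "t \<in> {0..L}" for t
  proof -
    have "norm (f t) * exp (- K * t) * exp (K * t) \<le> M * exp (K * t)"
      using s(2)[OF that] by (intro mult_right_mono) (auto simp: M_def)
    then show ?thesis by (simp add: mult.assoc flip: exp_add)
  qed
  have "M * exp (K * s) \<le> norm (\<phi> s) + norm (volterra2 \<nu> f s)"
    using eq[OF s(1)] norm_triangle_ineq[of "\<phi> s" "volterra2 \<nu> f s"] fs by simp
  also have "\<dots> \<le> m * exp (K * s) + M / 2 * exp (K * s)"
    by (intro add_mono \<phi> con f M s(1))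
  finally have "M * exp (K * s) \<le> (m + M / 2) * exp (K * s)" by (simp add: algebra_simps)
  then have "M \<le> 2 * m" by simp
  then show ?thesis using M[OF x] by (smt (verit) exp_ge_zero mult_right_mono)
qed

text \<open>The solution is the Neumann series of the iterates of \<open>volterra2\<close> on
  \<open>\<phi>\<close>; the weighted bound halves at every step, so the series converges
  uniformly.\<close>

lemma volterra_fixed_point:
  assumes \<phi>: "continuous_on {0..L} \<phi>"
  obtains f where "continuous_on {0..L} f" "\<And>x. x \<in> {0..L} \<Longrightarrow> f x = \<phi> x + volterra2 \<nu> f x"
proof -
  obtain K where K: "K \<ge> 1" and con: "\<And>u m s. continuous_on {0..L} u \<Longrightarrow>
      (\<And>t. t \<in> {0..L} \<Longrightarrow> norm (u t) \<le> m * exp (K * t)) \<Longrightarrow> s \<in> {0..L} \<Longrightarrow> norm (volterra2 \<nu> u s) \<le> m / 2 * exp (K * s)"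
    using volterra_contraction[of "\<bar>\<nu>\<bar>"] by (metis order_refl)
  define u where "u n = (volterra2 \<nu> ^^ n) \<phi>" for n
  have u0: "u 0 = \<phi>" and uS: "u (Suc n) = volterra2 \<nu> (u n)" for n by (auto simp: u_def)
  have cu: "continuous_on {0..L} (u n)" for n
    by (induction n) (simp_all add: u0 uS \<phi> volterra2_continuous)
  obtain m where m: "m > 0" "\<And>x. x \<in> {0..L} \<Longrightarrow> norm (\<phi> x) \<le> m"
    using compact_imp_bounded[OF compact_continuous_image[OF \<phi> compact_Icc]] unfolding bounded_pos by auto
  have bu: "norm (u n x) \<le> m / 2 ^ n * exp (K * x)" if "x \<in> {0..L}" for n x
    using that
  proof (induction n arbitrary: x)
    case 0
    have "m * 1 \<le> m * exp (K * x)" using m 0 K by (intro mult_left_mono) auto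
    then show ?case using m(2)[OF 0] by (simp add: u0)
  next
    case (Suc n)
    show ?case using con[OF cu[of n] Suc.IH Suc.prems] by (simp add: uS field_simps)
  qed
  have bu': "norm (u n x) \<le> m * exp (K * L) * (1 / 2) ^ n" if "x \<in> {0..L}" for n x
  proof -
    have "norm (u n x) \<le> m / 2 ^ n * exp (K * x)" by (rule bu[OF that])
    also have "\<dots> \<le> m / 2 ^ n * exp (K * L)" using that m K by (intro mult_left_mono) auto
    finally show ?thesis by (simp add: power_divide field_simps)
  qed
  define F where "F n x = (\<Sum>k<n. u k x)" for n x
  have "uniformly_convergent_on {0..L} (\<lambda>n x. \<Sum>k<n. u k x)"
    by (rule Weierstrass_m_test'[OF bu']) (auto intro: summable_mult summable_geometric)
  then obtain f where f: "uniform_limit {0..L} F f sequentially"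
    unfolding uniformly_convergent_on_def F_def[abs_def] by blast
  have cF: "continuous_on {0..L} (F n)" for n unfolding F_def[abs_def] by (intro continuous_intros cu)
  have cf: "continuous_on {0..L} f"
    by (rule uniform_limit_theorem[OF _ f]) (use cF in auto)
  \<comment> \<open>A partial sum inserted in the right-hand side gives the next partial sum, so the
    limit is a fixed point once \<open>volterra2\<close> is seen to be continuous along the
    sequence.\<close>
  have TF: "\<phi> x + volterra2 \<nu> (F n) x = F (Suc n) x" if "x \<in> {0..L}" for n x
  proof (induction n)
    case 0
    then show ?case by (simp add: F_def[abs_def] u0 volterra2_def volterra1_def[abs_def])
  next
    case (Suc n)
    have "volterra2 \<nu> (F (Suc n)) x = volterra2 \<nu> (\<lambda>t. F n t + 1 * u n t) x"
      by (simp add: F_def[abs_def])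
    also have "\<dots> = volterra2 \<nu> (F n) x + u (Suc n) x"
      using volterra2_lin[OF cF[of n] cu[of n], of x \<nu> 1] that by (simp add: uS)
    finally have "\<phi> x + volterra2 \<nu> (F (Suc n)) x = F (Suc n) x + u (Suc n) x" using Suc by simp
    also have "\<dots> = F (Suc (Suc n)) x" by (simp add: F_def)
    finally show ?case .
  qed
  have "f x = \<phi> x + volterra2 \<nu> f x" if x: "x \<in> {0..L}" for x
  proof (rule LIMSEQ_unique)
    have "(\<lambda>n. F n x) \<longlonglongrightarrow> f x" using tendsto_uniform_limitI[OF f x] .
    then show "(\<lambda>n. F (Suc n) x) \<longlonglongrightarrow> f x" by (rule LIMSEQ_Suc)
    have "(\<lambda>n. volterra2 \<nu> (F n) x) \<longlonglongrightarrow> volterra2 \<nu> f x"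
    proof (rule tendstoI)
      fix e :: real assume e: "e > 0"
      \<comment> \<open>Compensates for the weight, which is at most \<open>exp (K * L)\<close> on
        the segment.\<close>
      define e' where "e' = e * exp (- K * L)"
      have e': "e' > 0" using e by (simp add: e'_def)
      show "\<forall>\<^sub>F n in sequentially. dist (volterra2 \<nu> (F n) x) (volterra2 \<nu> f x) < e"
        using uniform_limitD[OF f e']
      proof eventually_elim
        case (elim n)
        have "norm (volterra2 \<nu> (\<lambda>t. F n t + (-1) * f t) x) \<le> e' / 2 * exp (K * x)"
        proof (rule con[OF _ _ x])
          show "continuous_on {0..L} (\<lambda>t. F n t + (-1) * f t)" by (intro continuous_intros cF cf)
          show "norm (F n t + (-1) * f t) \<le> e' * exp (K * t)" if "t \<in> {0..L}" for t
          proof -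
            have "norm (F n t + (-1) * f t) \<le> e' * 1" using elim that by (auto simp: dist_norm less_imp_le)
            also have "\<dots> \<le> e' * exp (K * t)" using e' K that by (intro mult_left_mono) auto
            finally show ?thesis .
          qed
        qed
        also have "\<dots> \<le> e' / 2 * exp (K * L)" using e' K x by (intro mult_left_mono) auto
        also have "\<dots> = e / 2" by (simp add: e'_def mult.assoc flip: exp_add)
        finally show ?case using volterra2_lin[OF cF[of n] cf, of x \<nu> "-1"] x e by (simp add: dist_norm)
      qed
    qed
    then have "(\<lambda>n. \<phi> x + volterra2 \<nu> (F n) x) \<longlonglongrightarrow> \<phi> x + volterra2 \<nu> f x" by (intro tendsto_intros)
    then show "(\<lambda>n. F (Suc n) x) \<longlonglongrightarrow> \<phi> x + volterra2 \<nu> f x" using TF[OF x] by simp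
  qed
  then show ?thesis using that cf by blast
qed

lemma solves_continuous:
  assumes "solves \<nu> f g"
  shows "continuous_on {0..L} f" "continuous_on {0..L} g"
proof -
  show f: "continuous_on {0..L} f"
    using assms unfolding solves_def by (blast intro: continuous_on_vector_derivative)
  show "continuous_on {0..L} g"
  proof (rule continuous_on_eq)
    show "continuous_on {0..L} (\<lambda>x. g 0 + volterra1 \<nu> f x)"
      by (intro continuous_intros volterra1_continuous f)
    show "g 0 + volterra1 \<nu> f x = g x" if "x \<in> {0..L}" for x
      using assms that unfolding solves_def by metis
  qed
qed

lemma solves_imp_volterra:
  assumes "solves \<nu> f g" "x \<in> {0..L}"
  shows "f x = f 0 + g 0 * complex_of_real x + volterra2 \<nu> f x"
proof -
  note c = solves_continuous[OF assms(1)]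
  have df: "(f has_vector_derivative g t) (at t within {0..L})" if "t \<in> {0..L}" for t
    using assms(1) that unfolding solves_def by blast
  have "(g has_integral (f x - f 0)) {0..x}"
    by (rule fundamental_theorem_of_calculus)
      (use assms(2) in \<open>auto intro: has_vector_derivative_within_subset[OF df]\<close>)
  moreover have "((\<lambda>t. g 0 + volterra1 \<nu> f t) has_integral (complex_of_real x * g 0 + volterra2 \<nu> f x)) {0..x}"
    using has_integral_add[OF has_integral_const_real[of "g 0" 0 x] integrable_integral[OF volterra1_integrable_on[OF c(1)]]] assms(2)
    by (simp add: volterra2_def scaleR_conv_of_real)
  then have "(g has_integral (complex_of_real x * g 0 + volterra2 \<nu> f x)) {0..x}"
  proof (rule has_integral_eq[rotated])
    fix t assume "t \<in> {0..x}"
    then have "t \<in> {0..L}" using assms(2) by auto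
    then show "g 0 + volterra1 \<nu> f t = g t" using assms(1) unfolding solves_def by metis
  qed
  ultimately have "f x - f 0 = complex_of_real x * g 0 + volterra2 \<nu> f x" by (rule has_integral_unique)
  then show ?thesis by (simp add: algebra_simps)
qed

lemma solves_exists:
  obtains f g where "solves \<nu> f g" "f 0 = c" "g 0 = d"
proof -
  have "continuous_on {0..L} (\<lambda>x. c + d * complex_of_real x)" by (intro continuous_intros)
  then obtain f where f: "continuous_on {0..L} f"
    and eq: "\<And>x. x \<in> {0..L} \<Longrightarrow> f x = (c + d * complex_of_real x) + volterra2 \<nu> f x"
    using volterra_fixed_point[of "\<lambda>x. c + d * complex_of_real x" \<nu>] by blast
  define g where "g x = d + volterra1 \<nu> f x" for x
  have g0: "g 0 = d" by (simp add: g_def volterra1_def)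
  have "(f has_vector_derivative g x) (at x within {0..L})" if x: "x \<in> {0..L}" for x
  proof -
    have "(volterra2 \<nu> f has_vector_derivative volterra1 \<nu> f x) (at x within {0..L})"
      unfolding volterra2_def[abs_def] by (rule integral_has_vector_derivative[OF volterra1_continuous[OF f] x])
    moreover have "((\<lambda>x. c + d * complex_of_real x) has_vector_derivative d) (at x within {0..L})"
      by (auto intro!: derivative_eq_intros simp: scaleR_conv_of_real)
    ultimately have "((\<lambda>x. (c + d * complex_of_real x) + volterra2 \<nu> f x) has_vector_derivative d + volterra1 \<nu> f x) (at x within {0..L})"
      by (intro has_vector_derivative_add)
    then show ?thesis unfolding g_def
      by (rule has_vector_derivative_transform[OF x, rotated]) (use eq in auto)
  qed
  then have "solves \<nu> f g" unfolding solves_def using g0 by (simp add: g_def)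
  moreover have "f 0 = c" using eq[of 0] L_pos by (simp add: volterra2_def)
  ultimately show ?thesis using that g0 by blast
qed

lemma solves_lin:
  assumes "solves \<nu> f g" "solves \<nu> p q"
  shows "solves \<nu> (\<lambda>x. f x + c * p x) (\<lambda>x. g x + c * q x)"
  unfolding solves_def
proof (intro conjI ballI)
  fix x assume x: "x \<in> {0..L}"
  show "((\<lambda>x. f x + c * p x) has_vector_derivative g x + c * q x) (at x within {0..L})"
  proof (intro has_vector_derivative_add has_vector_derivative_mult_right)
    show "(f has_vector_derivative g x) (at x within {0..L})" "(p has_vector_derivative q x) (at x within {0..L})"
      using assms x unfolding solves_def by blast+
  qed
  have e: "g x = g 0 + volterra1 \<nu> f x" "q x = q 0 + volterra1 \<nu> p x"
    using assms x unfolding solves_def by blast+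
  have "g x + c * q x = g 0 + c * q 0 + (volterra1 \<nu> f x + c * volterra1 \<nu> p x)"
    by (subst e(1), subst e(2)) (simp add: algebra_simps)
  also have "volterra1 \<nu> f x + c * volterra1 \<nu> p x = volterra1 \<nu> (\<lambda>x. f x + c * p x) x"
    using volterra1_lin[OF solves_continuous(1)[OF assms(1)] solves_continuous(1)[OF assms(2)], of x \<nu> c] x by simp
  finally show "g x + c * q x = g 0 + c * q 0 + volterra1 \<nu> (\<lambda>x. f x + c * p x) x" .
qed

text \<open>With equal parameters the estimate also gives uniqueness for the initial value problem.\<close>

lemma solves_lipschitz:
  assumes s0: "solves \<mu> f\<^sub>0 g\<^sub>0"
  obtains B where "\<And>\<nu> f g x. \<bar>\<nu> - \<mu>\<bar> \<le> 1 \<Longrightarrow> solves \<nu> f g \<Longrightarrow> f 0 = f\<^sub>0 0 \<Longrightarrow> g 0 = g\<^sub>0 0 \<Longrightarrow> x \<in> {0..L} \<Longrightarrow>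
      norm (f x - f\<^sub>0 x) \<le> B * \<bar>\<nu> - \<mu>\<bar> \<and> norm (g x - g\<^sub>0 x) \<le> B * \<bar>\<nu> - \<mu>\<bar>"
proof -
  note c0 = solves_continuous[OF s0]
  \<comment> \<open>The radius \<open>\<bar>\<mu>\<bar> + 1\<close> gives one weight
    \<open>K\<close> for all energies within distance 1 of \<open>\<mu>\<close>, hence one Lipschitz
    constant.\<close>
  obtain K where K: "K \<ge> 1" and con:
    "\<And>\<nu> u m s. \<bar>\<nu>\<bar> \<le> \<bar>\<mu>\<bar> + 1 \<Longrightarrow> continuous_on {0..L} u \<Longrightarrow> (\<And>t. t \<in> {0..L} \<Longrightarrow> norm (u t) \<le> m * exp (K * t)) \<Longrightarrow>
       s \<in> {0..L} \<Longrightarrow> norm (volterra1 \<nu> u s) \<le> m / 2 * exp (K * s) \<and> norm (volterra2 \<nu> u s) \<le> m / 2 * exp (K * s)"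
    using volterra_contraction[of "\<bar>\<mu>\<bar> + 1"] by metis
  \<comment> \<open>\<open>J1\<close> and \<open>J2\<close> are the coefficients of
    \<open>\<mu> - \<nu>\<close> when the energy in the two Volterra terms of
    \<open>f\<^sub>0\<close> is changed.\<close>
  define J1 where "J1 x = integral {0..x} f\<^sub>0" for x
  define J2 where "J2 x = integral {0..x} J1" for x
  have f0i: "f\<^sub>0 integrable_on {0..x}" if "x \<le> L" for x
    by (rule integrable_continuous_real, rule continuous_on_subset[OF c0(1)]) (use that in auto)
  have cJ1: "continuous_on {0..L} J1" unfolding J1_def by (rule indefinite_integral_continuous_1[OF f0i[OF order_refl]])
  have J1i: "J1 integrable_on {0..x}" if "x \<le> L" for x
    by (rule integrable_continuous_real, rule continuous_on_subset[OF cJ1]) (use that in auto)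
  have cJ2: "continuous_on {0..L} J2" unfolding J2_def by (rule indefinite_integral_continuous_1[OF J1i[OF order_refl]])
  obtain C1 where C1: "C1 > 0" "\<And>x. x \<in> {0..L} \<Longrightarrow> norm (J1 x) \<le> C1"
    using compact_imp_bounded[OF compact_continuous_image[OF cJ1 compact_Icc]] unfolding bounded_pos by auto
  obtain C2 where C2: "C2 > 0" "\<And>x. x \<in> {0..L} \<Longrightarrow> norm (J2 x) \<le> C2"
    using compact_imp_bounded[OF compact_continuous_image[OF cJ2 compact_Icc]] unfolding bounded_pos by auto
  show ?thesis
  \<comment> \<open>The first term comes from the a priori bound on \<open>f - f\<^sub>0\<close>,
    the second from changing the energy in the formula for \<open>g\<close>.\<close>
  proof (rule that[of "2 * C2 * exp (K * L) + C1"])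
    fix \<nu> f g x
    assume \<nu>: "\<bar>\<nu> - \<mu>\<bar> \<le> 1" and s: "solves \<nu> f g" and ic: "f 0 = f\<^sub>0 0" "g 0 = g\<^sub>0 0" and x: "x \<in> {0..L}"
    note c = solves_continuous[OF s]
    \<comment> \<open>The difference solves a Volterra equation at energy \<open>\<nu>\<close> whose
      inhomogeneity is \<open>\<mu> - \<nu>\<close> times a fixed function.\<close>
    define d where "d t = f t + (-1) * f\<^sub>0 t" for t
    have cd: "continuous_on {0..L} d" unfolding d_def by (intro continuous_intros c c0)
    have \<nu>R: "\<bar>\<nu>\<bar> \<le> \<bar>\<mu>\<bar> + 1" using \<nu> by linarith
    have change2: "volterra2 \<nu> f\<^sub>0 t = volterra2 \<mu> f\<^sub>0 t + complex_of_real (\<mu> - \<nu>) * J2 t" if "t \<in> {0..L}" for t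
    proof -
      have "volterra2 \<nu> f\<^sub>0 t = integral {0..t} (\<lambda>s. volterra1 \<mu> f\<^sub>0 s + complex_of_real (\<mu> - \<nu>) * J1 s)"
        unfolding volterra2_def J1_def
        by (rule integral_cong) (use volterra1_change_parameter[OF c0(1)] that in auto)
      also have "\<dots> = volterra2 \<mu> f\<^sub>0 t + complex_of_real (\<mu> - \<nu>) * J2 t"
        unfolding volterra2_def J2_def using volterra1_integrable_on[OF c0(1)] J1i that
        by (subst Henstock_Kurzweil_Integration.integral_add) (auto intro: integrable_on_mult_right)
      finally show ?thesis .
    qed
    have deq: "d t = complex_of_real (\<mu> - \<nu>) * J2 t + volterra2 \<nu> d t" if "t \<in> {0..L}" for t
    proof -
      have "volterra2 \<nu> d t = volterra2 \<nu> f t - volterra2 \<nu> f\<^sub>0 t"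
        unfolding d_def using volterra2_lin[OF c(1) c0(1), of t \<nu> "-1"] that by simp
      then show ?thesis
        using solves_imp_volterra[OF s that] solves_imp_volterra[OF s0 that] change2[OF that] ic
        by (simp add: d_def)
    qed
    define m where "m = \<bar>\<nu> - \<mu>\<bar> * C2"
    have m0: "m \<ge> 0" using C2 by (simp add: m_def)
    have \<phi>: "norm (complex_of_real (\<mu> - \<nu>) * J2 t) \<le> m * exp (K * t)" if "t \<in> {0..L}" for t
    proof -
      have "norm (complex_of_real (\<mu> - \<nu>) * J2 t) = \<bar>\<nu> - \<mu>\<bar> * norm (J2 t)"
        unfolding norm_mult norm_of_real by (simp add: abs_minus_commute)
      also have "\<dots> \<le> m * 1" unfolding m_def using C2(2)[OF that] by (simp add: mult_left_mono)
      also have "\<dots> \<le> m * exp (K * t)" using m0 K that by (intro mult_left_mono) auto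
      finally show ?thesis .
    qed
    have dbound: "norm (d t) \<le> 2 * m * exp (K * t)" if "t \<in> {0..L}" for t
    proof (rule volterra_a_priori[of K \<nu> d "\<lambda>t. complex_of_real (\<mu> - \<nu>) * J2 t", OF _ cd deq \<phi> that])
      fix u :: "real \<Rightarrow> complex" and n s
      assume "continuous_on {0..L} u" "\<And>t. t \<in> {0..L} \<Longrightarrow> norm (u t) \<le> n * exp (K * t)" "s \<in> {0..L}"
      then show "norm (volterra2 \<nu> u s) \<le> n / 2 * exp (K * s)" using con[OF \<nu>R] by blast
    qed
    have ex: "exp (K * x) \<le> exp (K * L)" using x K by simp
    have "norm (f x - f\<^sub>0 x) \<le> 2 * m * exp (K * x)" using dbound[OF x] by (simp add: d_def)
    also have "\<dots> \<le> 2 * m * exp (K * L)" using m0 ex by (intro mult_left_mono) auto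
    also have "\<dots> \<le> (2 * C2 * exp (K * L) + C1) * \<bar>\<nu> - \<mu>\<bar>"
      using C1 by (simp add: m_def algebra_simps)
    finally have 1: "norm (f x - f\<^sub>0 x) \<le> (2 * C2 * exp (K * L) + C1) * \<bar>\<nu> - \<mu>\<bar>" .
    have "g x - g\<^sub>0 x = volterra1 \<nu> d x + complex_of_real (\<mu> - \<nu>) * J1 x"
    proof -
      have "volterra1 \<nu> d x = volterra1 \<nu> f x - volterra1 \<nu> f\<^sub>0 x"
        unfolding d_def using volterra1_lin[OF c(1) c0(1), of x \<nu> "-1"] x by simp
      moreover have "g x = g 0 + volterra1 \<nu> f x" "g\<^sub>0 x = g\<^sub>0 0 + volterra1 \<mu> f\<^sub>0 x"
        using s s0 x unfolding solves_def by blast+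
      ultimately show ?thesis using volterra1_change_parameter[OF c0(1), of x \<nu> \<mu>] x ic
        by (simp add: J1_def)
    qed
    also have "norm \<dots> \<le> 2 * m / 2 * exp (K * x) + \<bar>\<nu> - \<mu>\<bar> * C1"
    proof (rule norm_triangle_mono)
      show "norm (volterra1 \<nu> d x) \<le> 2 * m / 2 * exp (K * x)" using con[OF \<nu>R cd dbound x] by blast
      have "norm (complex_of_real (\<mu> - \<nu>) * J1 x) = \<bar>\<nu> - \<mu>\<bar> * norm (J1 x)"
        unfolding norm_mult norm_of_real by (simp add: abs_minus_commute)
      also have "\<dots> \<le> \<bar>\<nu> - \<mu>\<bar> * C1" using C1(2)[OF x] by (simp add: mult_left_mono)
      finally show "norm (complex_of_real (\<mu> - \<nu>) * J1 x) \<le> \<bar>\<nu> - \<mu>\<bar> * C1" .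
    qed
    also have "\<dots> \<le> 2 * m * exp (K * L) + \<bar>\<nu> - \<mu>\<bar> * C1"
    proof -
      have "m * exp (K * x) \<le> m * exp (K * L)" using m0 ex by (intro mult_left_mono) auto
      moreover have "0 \<le> m * exp (K * L)" using m0 by simp
      ultimately show ?thesis by simp
    qed
    also have "\<dots> = (2 * C2 * exp (K * L) + C1) * \<bar>\<nu> - \<mu>\<bar>"
      by (simp add: m_def algebra_simps)
    finally show "norm (f x - f\<^sub>0 x) \<le> (2 * C2 * exp (K * L) + C1) * \<bar>\<nu> - \<mu>\<bar> \<and>
        norm (g x - g\<^sub>0 x) \<le> (2 * C2 * exp (K * L) + C1) * \<bar>\<nu> - \<mu>\<bar>" using 1 by blast
  qed
qed

lemma solves_unique:
  assumes "solves \<nu> f g" "solves \<nu> p q" "f 0 = p 0" "g 0 = q 0" "x \<in> {0..L}"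
  shows "f x = p x" "g x = q x"
proof -
  obtain B where "\<And>\<nu>' f g x. \<bar>\<nu>' - \<nu>\<bar> \<le> 1 \<Longrightarrow> solves \<nu>' f g \<Longrightarrow> f 0 = p 0 \<Longrightarrow> g 0 = q 0 \<Longrightarrow> x \<in> {0..L} \<Longrightarrow>
      norm (f x - p x) \<le> B * \<bar>\<nu>' - \<nu>\<bar> \<and> norm (g x - q x) \<le> B * \<bar>\<nu>' - \<nu>\<bar>"
    by (rule solves_lipschitz[OF assms(2)]) (rule that)
  from this[of \<nu> f g x] assms show "f x = p x" "g x = q x" by auto
qed

text \<open>Lagrange's identity. The derivatives \<open>g\<close> and \<open>q\<close> are only
  absolutely continuous, so there are two integrations by parts, each with one of them as the rough
  factor. The potential is real and cancels. The minus sign at \<open>L\<close> matches derivatives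
  taken into the edge.\<close>

lemma solves_green:
  assumes f: "solves \<nu> f g" and p: "solves \<mu> p q"
  shows "complex_of_real (\<nu> - \<mu>) * integral {0..L} (\<lambda>x. f x * cnj (p x)) =
    (g 0 * cnj (p 0) - f 0 * cnj (q 0)) - (g L * cnj (p L) - f L * cnj (q L))"
proof -
  note cf = solves_continuous[OF f] and cp = solves_continuous[OF p]
  have ccp: "continuous_on {0..L} (\<lambda>x. cnj (p x))" "continuous_on {0..L} (\<lambda>x. cnj (q x))"
    by (intro continuous_intros cp)+
  have L: "L \<in> {0..L}" using L_pos by auto
  define hf where "hf t = complex_of_real (V t - \<nu>) * f t" for t
  define hp where "hp t = complex_of_real (V t - \<mu>) * cnj (p t)" for t
  have hf: "hf absolutely_integrable_on {0..L}" unfolding hf_def[abs_def] by (rule potential_mult_integrable[OF cf(1)])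
  have hp: "hp absolutely_integrable_on {0..L}" unfolding hp_def[abs_def] by (rule potential_mult_integrable[OF ccp(1)])
  have dp: "((\<lambda>x. cnj (p x)) has_vector_derivative cnj (q x)) (at x within {0..L})" if "x \<in> {0..L}" for x
    using p that unfolding solves_def by (intro has_vector_derivative_cnj) blast
  have df: "(f has_vector_derivative g x) (at x within {0..L})" if "x \<in> {0..L}" for x
    using f that unfolding solves_def by blast
  have 1: "g L * cnj (p L) - g 0 * cnj (p 0) = integral {0..L} (\<lambda>t. hf t * cnj (p t) + g t * cnj (q t))"
  proof (rule integration_by_parts_absolutely_continuous[OF hf _ dp ccp(2) L])
    show "g x = g 0 + integral {0..x} hf" if "x \<in> {0..L}" for x
      using f that unfolding solves_def volterra1_def hf_def[abs_def] by blast
  qed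
  have 2: "cnj (q L) * f L - cnj (q 0) * f 0 = integral {0..L} (\<lambda>t. hp t * f t + cnj (q t) * g t)"
  proof (rule integration_by_parts_absolutely_continuous[OF hp _ df cf(2) L])
    fix x assume x: "x \<in> {0..L}"
    have "cnj (integral {0..x} (\<lambda>t. complex_of_real (V t - \<mu>) * p t)) = integral {0..x} hp"
      unfolding hp_def[abs_def] integral_cnj by simp
    then show "cnj (q x) = cnj (q 0) + integral {0..x} hp"
      using p x unfolding solves_def volterra1_def by (metis complex_cnj_add)
  qed
  have int1: "(\<lambda>t. hf t * cnj (p t) + g t * cnj (q t)) integrable_on {0..L}"
    by (intro integrable_add set_lebesgue_integral_eq_integral(1) absolutely_integrable_mult_continuous hf ccp
        integrable_continuous_real continuous_intros cf)
  have int2: "(\<lambda>t. hp t * f t + cnj (q t) * g t) integrable_on {0..L}"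
    by (intro integrable_add set_lebesgue_integral_eq_integral(1) absolutely_integrable_mult_continuous hp ccp
        integrable_continuous_real continuous_intros cf cp)
  have "(g L * cnj (p L) - g 0 * cnj (p 0)) - (cnj (q L) * f L - cnj (q 0) * f 0) =
      integral {0..L} (\<lambda>t. (hf t * cnj (p t) + g t * cnj (q t)) - (hp t * f t + cnj (q t) * g t))"
    unfolding 1 2 by (rule Henstock_Kurzweil_Integration.integral_diff[OF int1 int2, symmetric])
  also have "\<dots> = integral {0..L} (\<lambda>t. complex_of_real (\<mu> - \<nu>) * (f t * cnj (p t)))"
    by (rule integral_cong) (simp add: hf_def hp_def algebra_simps)
  also have "\<dots> = complex_of_real (\<mu> - \<nu>) * integral {0..L} (\<lambda>t. f t * cnj (p t))"
    by (rule integral_mult_right)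
  finally have eq: "(g L * cnj (p L) - g 0 * cnj (p 0)) - (cnj (q L) * f L - cnj (q 0) * f 0) =
      complex_of_real (\<mu> - \<nu>) * integral {0..L} (\<lambda>t. f t * cnj (p t))" .
  have "complex_of_real (\<nu> - \<mu>) = - complex_of_real (\<mu> - \<nu>)" by simp
  then have "complex_of_real (\<nu> - \<mu>) * integral {0..L} (\<lambda>t. f t * cnj (p t)) =
      - ((g L * cnj (p L) - g 0 * cnj (p 0)) - (cnj (q L) * f L - cnj (q 0) * f 0))"
    unfolding eq by (simp only: mult_minus_left)
  then show ?thesis by (rule trans) (simp add: algebra_simps)
qed

text \<open>A choice, since \<open>solves\<close> says nothing outside the segment; on the segment
  \<open>solves_unique\<close> determines the function.\<close>

definition fund :: "real \<Rightarrow> complex \<Rightarrow> complex \<Rightarrow> real \<Rightarrow> complex" where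
  "fund \<nu> c d = (SOME f. \<exists>g. solves \<nu> f g \<and> f 0 = c \<and> g 0 = d)"

definition fund' :: "real \<Rightarrow> complex \<Rightarrow> complex \<Rightarrow> real \<Rightarrow> complex" where
  "fund' \<nu> c d = (SOME g. solves \<nu> (fund \<nu> c d) g \<and> fund \<nu> c d 0 = c \<and> g 0 = d)"

lemma fund_solves: "solves \<nu> (fund \<nu> c d) (fund' \<nu> c d)"
  and fund_0: "fund \<nu> c d 0 = c" and fund'_0: "fund' \<nu> c d 0 = d"
proof -
  obtain f g where "solves \<nu> f g" "f 0 = c" "g 0 = d" by (rule solves_exists)
  then have "\<exists>f g. solves \<nu> f g \<and> f 0 = c \<and> g 0 = d" by blast
  then have "\<exists>g. solves \<nu> (fund \<nu> c d) g \<and> fund \<nu> c d 0 = c \<and> g 0 = d"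
    unfolding fund_def by (rule someI_ex)
  then have "solves \<nu> (fund \<nu> c d) (fund' \<nu> c d) \<and> fund \<nu> c d 0 = c \<and> fund' \<nu> c d 0 = d"
    unfolding fund'_def by (rule someI_ex)
  then show "solves \<nu> (fund \<nu> c d) (fund' \<nu> c d)" "fund \<nu> c d 0 = c" "fund' \<nu> c d 0 = d" by auto
qed

lemma solves_eq_fund:
  assumes "solves \<nu> f g" "x \<in> {0..L}"
  shows "f x = fund \<nu> (f 0) (g 0) x" "g x = fund' \<nu> (f 0) (g 0) x"
  using solves_unique[OF assms(1) fund_solves _ _ assms(2)] by (simp_all add: fund_0 fund'_0)

lemma fund_lin:
  assumes "x \<in> {0..L}"
  shows "fund \<nu> (c + k * c') (d + k * d') x = fund \<nu> c d x + k * fund \<nu> c' d' x"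
    and "fund' \<nu> (c + k * c') (d + k * d') x = fund' \<nu> c d x + k * fund' \<nu> c' d' x"
  using solves_eq_fund[OF solves_lin[OF fund_solves[of \<nu> c d] fund_solves[of \<nu> c' d'], of k] assms]
  by (simp_all add: fund_0 fund'_0)

text \<open>Separates the Cauchy data, which enter linearly, from the energy, so that limits with
  both varying reduce to the two solutions with data \<open>(1, 0)\<close> and
  \<open>(0, 1)\<close>.\<close>

lemma fund_basis:
  assumes "x \<in> {0..L}"
  shows "fund \<nu> c d x = c * fund \<nu> 1 0 x + d * fund \<nu> 0 1 x"
    and "fund' \<nu> c d x = c * fund' \<nu> 1 0 x + d * fund' \<nu> 0 1 x"
proof -
  have z: "fund \<nu> 0 0 x = 0" "fund' \<nu> 0 0 x = 0"
    using fund_lin[OF assms, of \<nu> 0 "-1" 0 0 0] by simp_all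
  show "fund \<nu> c d x = c * fund \<nu> 1 0 x + d * fund \<nu> 0 1 x"
    "fund' \<nu> c d x = c * fund' \<nu> 1 0 x + d * fund' \<nu> 0 1 x"
    using fund_lin[OF assms, of \<nu> 0 c 1 0 0] fund_lin[OF assms, of \<nu> c d 0 0 1] by (simp_all add: z)
qed

lemma fund_continuous: "continuous_on {0..L} (fund \<nu> c d)"
  by (rule solves_continuous(1)[OF fund_solves])

lemma fund_lim_fixed_data:
  assumes "Z \<longlonglongrightarrow> \<nu>" "x \<in> {0..L}"
  shows "(\<lambda>n. fund (Z n) c d x) \<longlonglongrightarrow> fund \<nu> c d x" "(\<lambda>n. fund' (Z n) c d x) \<longlonglongrightarrow> fund' \<nu> c d x"
    and "uniform_limit {0..L} (\<lambda>n. fund (Z n) c d) (fund \<nu> c d) sequentially"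
proof -
  obtain B where B: "\<And>\<nu>' f g x. \<bar>\<nu>' - \<nu>\<bar> \<le> 1 \<Longrightarrow> solves \<nu>' f g \<Longrightarrow> f 0 = fund \<nu> c d 0 \<Longrightarrow> g 0 = fund' \<nu> c d 0 \<Longrightarrow>
      x \<in> {0..L} \<Longrightarrow> norm (f x - fund \<nu> c d x) \<le> B * \<bar>\<nu>' - \<nu>\<bar> \<and> norm (g x - fund' \<nu> c d x) \<le> B * \<bar>\<nu>' - \<nu>\<bar>"
    by (rule solves_lipschitz[OF fund_solves[of \<nu> c d]]) (rule that)
  have bnd: "norm (fund \<nu>' c d x - fund \<nu> c d x) \<le> B * \<bar>\<nu>' - \<nu>\<bar>"
      "norm (fund' \<nu>' c d x - fund' \<nu> c d x) \<le> B * \<bar>\<nu>' - \<nu>\<bar>"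
    if "\<bar>\<nu>' - \<nu>\<bar> \<le> 1" "x \<in> {0..L}" for \<nu>' x
    using B[OF that(1) fund_solves _ _ that(2), of c d] by (simp_all add: fund_0 fund'_0)
  have near: "\<forall>\<^sub>F n in sequentially. \<bar>Z n - \<nu>\<bar> \<le> 1"
    using tendstoD[OF assms(1), of 1] by (auto elim: eventually_mono simp: dist_real_def)
  have "(\<lambda>n. B * \<bar>Z n - \<nu>\<bar>) \<longlonglongrightarrow> B * \<bar>\<nu> - \<nu>\<bar>" by (intro tendsto_intros assms(1))
  then have z: "(\<lambda>n. B * \<bar>Z n - \<nu>\<bar>) \<longlonglongrightarrow> 0" by simp
  have "(\<lambda>n. fund (Z n) c d x - fund \<nu> c d x) \<longlonglongrightarrow> 0"
    by (rule Lim_null_comparison[OF eventually_mono[OF near] z]) (rule bnd(1)[OF _ assms(2)])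
  then show "(\<lambda>n. fund (Z n) c d x) \<longlonglongrightarrow> fund \<nu> c d x" by (simp add: LIM_zero_iff)
  have "(\<lambda>n. fund' (Z n) c d x - fund' \<nu> c d x) \<longlonglongrightarrow> 0"
    by (rule Lim_null_comparison[OF eventually_mono[OF near] z]) (rule bnd(2)[OF _ assms(2)])
  then show "(\<lambda>n. fund' (Z n) c d x) \<longlonglongrightarrow> fund' \<nu> c d x" by (simp add: LIM_zero_iff)
  show "uniform_limit {0..L} (\<lambda>n. fund (Z n) c d) (fund \<nu> c d) sequentially"
  proof (rule uniform_limitI)
    fix e :: real assume "e > 0"
    have "\<forall>\<^sub>F n in sequentially. \<bar>B * \<bar>Z n - \<nu>\<bar>\<bar> < e"
      using tendstoD[OF z \<open>e > 0\<close>] by (simp add: dist_real_def)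
    with near show "\<forall>\<^sub>F n in sequentially. \<forall>x\<in>{0..L}. dist (fund (Z n) c d x) (fund \<nu> c d x) < e"
    proof eventually_elim
      case (elim n)
      show ?case
      proof
        fix x assume "x \<in> {0..L}"
        from bnd(1)[OF elim(1) this] elim(2) show "dist (fund (Z n) c d x) (fund \<nu> c d x) < e"
          unfolding dist_norm by linarith
      qed
    qed
  qed
qed

lemma fund_lim:
  assumes "Z \<longlonglongrightarrow> \<nu>" "C \<longlonglongrightarrow> c" "D \<longlonglongrightarrow> d" "x \<in> {0..L}"
  shows "(\<lambda>n. fund (Z n) (C n) (D n) x) \<longlonglongrightarrow> fund \<nu> c d x"
    and "(\<lambda>n. fund' (Z n) (C n) (D n) x) \<longlonglongrightarrow> fund' \<nu> c d x"
  unfolding fund_basis[OF assms(4), where c = "C _" and d = "D _"]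
    fund_basis[OF assms(4), where c = c and d = d]
  by (intro tendsto_intros assms fund_lim_fixed_data)+

lemma fund_integral_lim:
  assumes "Z \<longlonglongrightarrow> \<nu>" "C \<longlonglongrightarrow> c" "D \<longlonglongrightarrow> d" and p: "continuous_on {0..L} p"
  shows "(\<lambda>n. integral {0..L} (\<lambda>x. fund (Z n) (C n) (D n) x * p x)) \<longlonglongrightarrow> integral {0..L} (\<lambda>x. fund \<nu> c d x * p x)"
proof -
  \<comment> \<open>\<open>fund_lim_fixed_data\<close> asks for a point of the segment even for its
    uniform part; 0 serves.\<close>
  have 0: "(0::real) \<in> {0..L}" using L_pos by simp
  have lim: "(\<lambda>n. integral {0..L} (\<lambda>x. fund (Z n) c d x * p x)) \<longlonglongrightarrow> integral {0..L} (\<lambda>x. fund \<nu> c d x * p x)" for c d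
  proof -
    have bp: "bounded (p ` {0..L})" "bounded (fund \<nu> c d ` {0..L})"
      using compact_imp_bounded compact_continuous_image[OF p compact_Icc]
        compact_continuous_image[OF fund_continuous compact_Icc] by blast+
    have ul: "uniform_limit {0..L} (\<lambda>n x. fund (Z n) c d x * p x) (\<lambda>x. fund \<nu> c d x * p x) sequentially"
      by (intro uniform_lim_mult fund_lim_fixed_data(3)[OF assms(1) 0] uniform_limit_const bp)
    have int: "\<And>n. continuous_on {0..L} (\<lambda>x. fund (Z n) c d x * p x)"
      by (intro continuous_intros fund_continuous p)
    obtain I J where IJ: "\<And>n. ((\<lambda>x. fund (Z n) c d x * p x) has_integral I n) {0..L}"
      "((\<lambda>x. fund \<nu> c d x * p x) has_integral J) {0..L}" "(I \<longlongrightarrow> J) sequentially"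
      by (rule uniform_limit_integral[OF ul int]) auto
    then show ?thesis using integral_unique[OF IJ(1)] integral_unique[OF IJ(2)] by simp
  qed
  have split: "integral {0..L} (\<lambda>x. fund \<nu> c d x * p x) =
      c * integral {0..L} (\<lambda>x. fund \<nu> 1 0 x * p x) + d * integral {0..L} (\<lambda>x. fund \<nu> 0 1 x * p x)" for \<nu> c d
  proof -
    have "integral {0..L} (\<lambda>x. fund \<nu> c d x * p x) =
        integral {0..L} (\<lambda>x. c * (fund \<nu> 1 0 x * p x) + d * (fund \<nu> 0 1 x * p x))"
      by (rule integral_cong) (subst fund_basis(1), auto simp: algebra_simps)
    also have "\<dots> = integral {0..L} (\<lambda>x. c * (fund \<nu> 1 0 x * p x)) + integral {0..L} (\<lambda>x. d * (fund \<nu> 0 1 x * p x))"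
      by (rule Henstock_Kurzweil_Integration.integral_add)
        (intro integrable_continuous_real continuous_intros fund_continuous p)+
    finally show ?thesis by simp
  qed
  show ?thesis unfolding split[where c = "C _" and d = "D _"] split[where c = c and d = d]
    by (intro tendsto_intros lim assms)
qed

end

section \<open>Functions with vanishing indefinite integral\<close>

lemma sigma_finite_lebesgue: "sigma_finite_measure (lebesgue :: real measure)"
proof
  obtain A :: "real set set" where A: "countable A" "A \<subseteq> sets lborel" "\<Union>A = space lborel"
      "\<forall>a\<in>A. emeasure lborel a \<noteq> \<infinity>"
    using lborel.sigma_finite_countable by blast
  then show "\<exists>A::real set set. countable A \<and> A \<subseteq> sets lebesgue \<and> \<Union>A = space lebesgue \<and>
      (\<forall>a\<in>A. emeasure lebesgue a \<noteq> \<infinity>)"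
    by (intro exI[of _ A]) (auto simp: sets_completionI_sets subset_iff)
qed

text \<open>The integral of the zero extension \<open>e\<close> vanishes on every half-line.
  Half-lines are stable under intersection and generate the Borel sets, Lebesgue sets differ from
  Borel sets by null sets, and a function whose integral over every measurable set is 0 vanishes
  almost everywhere.\<close>

lemma AE_zero_if_indefinite_integral_zero:
  fixes d :: "real \<Rightarrow> complex"
  assumes d: "d absolutely_integrable_on {0..L}" and z: "\<And>x. x \<in> {0..L} \<Longrightarrow> integral {0..x} d = 0"
  shows "AE x in lebesgue. x \<in> {0..L} \<longrightarrow> d x = 0"
proof -
  define e where "e x = indicat_real {0..L} x *\<^sub>R d x" for x
  have e: "integrable lebesgue e" using d unfolding set_integrable_def e_def .
  have atMost: "(LINT x:{..a}|lebesgue. e x) = 0" for a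
  proof -
    have "(LINT x:{..a}|lebesgue. e x) = (LINT x:{0..min a L}|lebesgue. d x)"
      unfolding set_lebesgue_integral_def e_def
      by (rule Bochner_Integration.integral_cong) (auto simp: indicator_def)
    also have "\<dots> = integral {0..min a L} d"
      by (rule set_lebesgue_integral_eq_integral(2)[OF absolutely_integrable_on_Icc_subset[OF d]]) auto
    also have "\<dots> = 0" using z[of "min a L"] by (cases "0 \<le> min a L") auto
    finally show ?thesis .
  qed
  have si: "set_integrable lebesgue A e" if "A \<in> sets lebesgue" for A
    unfolding set_integrable_def using integrable_mult_indicator[OF that e] by simp
  \<comment> \<open>The whole line is not one of the half-lines, but \<open>e\<close> vanishes
    beyond \<open>L\<close>. The complement step of the induction rests on this.\<close>
  have total: "(LINT x:UNIV|lebesgue. e x) = 0"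
  proof -
    have "(LINT x:UNIV|lebesgue. e x) = (LINT x:{..L}|lebesgue. e x)"
      unfolding set_lebesgue_integral_def e_def
      by (rule Bochner_Integration.integral_cong) (auto simp: indicator_def)
    then show ?thesis using atMost by simp
  qed
  have meas: "A \<in> sets lebesgue" if "A \<in> sigma_sets UNIV (range atMost)" for A :: "real set"
  proof -
    have "A \<in> sets borel" unfolding borel_eq_atMost using that by simp
    then show ?thesis by (simp add: sets_completionI_sets)
  qed
  have borel: "(LINT x:A|lebesgue. e x) = 0" if "A \<in> sets (borel :: real measure)" for A
  proof -
    have stable: "Int_stable (range (atMost :: real \<Rightarrow> _))"
      unfolding Int_stable_def
    proof safe
      fix a b :: real
      have "{..a} \<inter> {..b} = {..min a b}" by auto
      then show "{..a} \<inter> {..b} \<in> range atMost" by (metis rangeI)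
    qed
    have closed: "range (atMost :: real \<Rightarrow> _) \<subseteq> Pow UNIV" by simp
    have A: "A \<in> sigma_sets UNIV (range atMost)"
      using that unfolding borel_eq_atMost by simp
    show ?thesis
      using stable closed A
    proof (induction rule: sigma_sets_induct_disjoint)
      case (basic A)
      then show ?case using atMost by auto
    next
      case empty
      then show ?case by (simp add: set_lebesgue_integral_def)
    next
      case (compl A)
      then have A: "A \<in> sets lebesgue" by (intro meas)
      have cA: "UNIV - A \<in> sets lebesgue" using sets.compl_sets[OF A] by simp
      have "(LINT x:A \<union> (UNIV - A)|lebesgue. e x) = (LINT x:A|lebesgue. e x) + (LINT x:UNIV - A|lebesgue. e x)"
        by (rule set_integral_Un[OF _ si[OF A] si[OF cA]]) auto
      then show ?case using total compl by simp
    next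
      case (union A)
      then have A: "A i \<in> sets lebesgue" for i by (intro meas) auto
      have "(LINT x:(\<Union>i. A i)|lebesgue. e x) = (\<Sum>i. (LINT x:A i|lebesgue. e x))"
        by (rule lebesgue_integral_countable_add) (use A union in \<open>auto simp: disjoint_family_on_def intro: si\<close>)
      then show ?case using union by simp
    qed
  qed
  have "AE x in lebesgue. e x = 0"
  proof (rule sigma_finite_measure.density_zero[OF sigma_finite_lebesgue e])
    fix A :: "real set" assume "A \<in> sets lebesgue"
    then obtain S N N' where A: "A = S \<union> N" "N \<subseteq> N'" "N' \<in> null_sets lborel" "S \<in> sets lborel"
      by (rule sets_completionE)
    then have "AE x in lebesgue. x \<notin> N'" by (intro AE_not_in null_sets_completionI)
    then have "AE x in lebesgue. x \<in> A \<longleftrightarrow> x \<in> S" by eventually_elim (use A in auto)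
    then have "(LINT x:A|lebesgue. e x) = (LINT x:S|lebesgue. e x)"
      using si[of A] si[of S] A \<open>A \<in> sets lebesgue\<close>
      by (intro set_integral_cong_set) (auto simp: set_borel_measurable_def set_integrable_def)
    then show "(LINT x:A|lebesgue. e x) = 0" using borel A by simp
  qed
  then show ?thesis by eventually_elim (auto simp: e_def)
qed

section \<open>Self-adjoint vertex conditions\<close>

text \<open>Gaussian elimination by induction on the equations: a nonzero row eliminates one
  unknown, a zero row is dropped.\<close>

lemma nontrivial_solution:
  fixes M :: "'j \<Rightarrow> 'i \<Rightarrow> complex"
  assumes "finite J" "finite I" "card J < card I"
  shows "\<exists>x. (\<exists>i\<in>I. x i \<noteq> 0) \<and> (\<forall>i. i \<notin> I \<longrightarrow> x i = 0) \<and> (\<forall>j\<in>J. (\<Sum>i\<in>I. M j i * x i) = 0)"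
  using assms
proof (induction J arbitrary: I M rule: finite_induct)
  case empty
  then obtain i where "i \<in> I" by fastforce
  then show ?case by (intro exI[of _ "\<lambda>k. if k = i then 1 else 0"]) auto
next
  case (insert j J)
  show ?case
  proof (cases "\<forall>i\<in>I. M j i = 0")
    case True
    have "card J < card I" using insert by simp
    from insert.IH[OF insert.prems(1) this, of M] obtain x where
      x: "\<exists>i\<in>I. x i \<noteq> 0" "\<forall>i. i \<notin> I \<longrightarrow> x i = 0" "\<forall>l\<in>J. (\<Sum>i\<in>I. M l i * x i) = 0" by blast
    have "(\<Sum>i\<in>I. M j i * x i) = 0" using True by (intro sum.neutral) simp
    then show ?thesis using x by blast
  next
    case False
    then obtain k where k: "k \<in> I" "M j k \<noteq> 0" by blast
    define I' where "I' = I - {k}"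
    \<comment> \<open>Row \<open>j\<close> is solved for the pivot unknown \<open>k\<close> and
      substituted in the other rows; \<open>y\<close> below restores that unknown.\<close>
    define M' where "M' l i = M l i - M l k / M j k * M j i" for l i
    have I': "finite I'" "card J < card I'" "k \<notin> I'" and I: "I = insert k I'"
      using insert k by (auto simp: I'_def)
    from insert.IH[OF I'(1,2), of M'] obtain x where x: "\<exists>i\<in>I'. x i \<noteq> 0" "\<And>i. i \<notin> I' \<Longrightarrow> x i = 0"
      "\<And>l. l \<in> J \<Longrightarrow> (\<Sum>i\<in>I'. M' l i * x i) = 0" by blast
    define s where "s = (\<Sum>i\<in>I'. M j i * x i)"
    define y where "y = x(k := - s / M j k)"
    have y: "(\<Sum>i\<in>I. M l i * y i) = M l k * (- s / M j k) + (\<Sum>i\<in>I'. M l i * x i)" for l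
    proof -
      have "(\<Sum>i\<in>I'. M l i * y i) = (\<Sum>i\<in>I'. M l i * x i)"
        using I'(3) by (intro sum.cong) (auto simp: y_def)
      then show ?thesis using I' by (simp add: I y_def)
    qed
    have "(\<Sum>i\<in>I. M l i * y i) = 0" if "l \<in> insert j J" for l
    proof (cases "l = j")
      case True
      then show ?thesis using k y[of j] by (simp add: s_def)
    next
      case False
      then have "(\<Sum>i\<in>I'. M' l i * x i) = 0" using x(3) that by blast
      moreover have "(\<Sum>i\<in>I'. M' l i * x i) = (\<Sum>i\<in>I'. M l i * x i) - M l k / M j k * s"
        by (simp only: M'_def left_diff_distrib sum_subtractf s_def sum_distrib_left mult.assoc)
      ultimately show ?thesis by (simp add: y)
    qed
    moreover have "\<exists>i\<in>I. y i \<noteq> 0" using x(1) I I'(3) by (auto simp: y_def)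
    moreover have "\<forall>i. i \<notin> I \<longrightarrow> y i = 0" using x(2) I by (auto simp: y_def)
    ultimately show ?thesis by blast
  qed
qed

text \<open>
  The condition \<open>A F + B F' = 0\<close> with entries indexed by the ends themselves; \<open>\<alpha>\<close> and \<open>\<beta>\<close> are the
  entries of \<open>A\<close> and \<open>B\<close>.
\<close>

definition lagrangian_coeffs :: "'p set \<Rightarrow> ('p \<Rightarrow> 'p \<Rightarrow> complex) \<Rightarrow> ('p \<Rightarrow> 'p \<Rightarrow> complex) \<Rightarrow> bool" where
  "lagrangian_coeffs P \<alpha> \<beta> \<longleftrightarrow> finite P \<and>
     (\<forall>p\<in>P. \<forall>r\<in>P. (\<Sum>q\<in>P. \<alpha> p q * cnj (\<beta> r q)) = (\<Sum>q\<in>P. \<beta> p q * cnj (\<alpha> r q))) \<and>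
     (\<forall>u. (\<forall>q\<in>P. (\<Sum>p\<in>P. u p * \<alpha> p q) = 0 \<and> (\<Sum>p\<in>P. u p * \<beta> p q) = 0) \<longrightarrow> (\<forall>p\<in>P. u p = 0))"

text \<open>A maximal independent set of columns has \<open>d\<close> elements and forms an
  invertible matrix, and the transpose of this matrix annihilates \<open>u\<close>.\<close>

lemma full_row_rank_trivial_left_kernel:
  fixes M :: "complex mat"
  assumes M: "M \<in> carrier_mat d n" and rank: "vec_space.rank d M = d"
    and u: "u \<in> carrier_vec d" and orth: "\<And>c. c \<in> set (cols M) \<Longrightarrow> c \<bullet> u = 0"
  shows "u = 0\<^sub>v d"
proof -
  interpret vec_space "TYPE(complex)" d .
  have colsM: "set (cols M) \<subseteq> carrier_vec d" using M cols_dim[of M] by auto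
  have "\<exists>A. finite A \<and> maximal A (\<lambda>T. T \<subseteq> set (cols M) \<and> lin_indpt T) \<and> {} \<subseteq> A"
    by (rule maximal_exists_superset[of "set (cols M)"]) (auto simp: lin_dep_def)
  then obtain S where S: "finite S" "maximal S (\<lambda>T. T \<subseteq> set (cols M) \<and> lin_indpt T)" by blast
  then have cardS: "card S = d" using rank_card_indpt[OF M S(2)] rank by simp
  have Ssub: "S \<subseteq> set (cols M)" and Sind: "lin_indpt S" using S(2) by (auto simp: maximal_def)
  obtain ss where ss: "set ss = S" "distinct ss" using finite_distinct_list[OF S(1)] by blast
  have len: "length ss = d" using ss cardS distinct_card by fastforce
  define N where "N = mat_of_cols d ss"
  have N: "N \<in> carrier_mat d d" unfolding N_def by (simp add: len[symmetric])
  have colsN: "cols N = ss" unfolding N_def using ss Ssub colsM by (intro cols_mat_of_cols) auto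
  have "rank N = d" by (rule lin_indpt_full_rank[OF N]) (simp_all add: colsN ss Sind)
  then have "det N \<noteq> 0" using det_rank_iff[OF N] by blast
  then have det: "det N\<^sup>T \<noteq> 0" using det_transpose[OF N] by simp
  have "N\<^sup>T *\<^sub>v u = 0\<^sub>v d"
  proof (rule eq_vecI)
    fix i assume "i < dim_vec (0\<^sub>v d)"
    then have i: "i < d" by simp
    then have "col N i \<in> set (cols M)" using colsN ss Ssub N by (metis carrier_matD(2) cols_length cols_nth nth_mem subsetD)
    then show "(N\<^sup>T *\<^sub>v u) $ i = 0\<^sub>v d $ i" using orth i N by simp
  qed (use N in auto)
  then show ?thesis
    using det_0_iff_vec_prod_zero_field[of "N\<^sup>T" d] det N u by auto
qed

lemma mat_adjoint_index:
  "i < dim_col A \<Longrightarrow> j < dim_row A \<Longrightarrow> mat_adjoint A $$ (i, j) = cnj (A $$ (j, i))"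
  by (simp add: mat_adjoint_def mat_of_rows_index)

lemma mat_mult_adjoint_index:
  fixes A B :: "complex mat"
  assumes "A \<in> carrier_mat d d" "B \<in> carrier_mat d d" "i < d" "j < d"
  shows "(A * mat_adjoint B) $$ (i, j) = (\<Sum>k<d. A $$ (i, k) * cnj (B $$ (j, k)))"
proof -
  have dim: "dim_row (mat_adjoint B) = d" "dim_col (mat_adjoint B) = d" using assms by (auto simp: mat_adjoint_def)
  have "(A * mat_adjoint B) $$ (i, j) = (\<Sum>k<d. A $$ (i, k) * mat_adjoint B $$ (k, j))"
    using assms dim by (simp add: times_mat_def scalar_prod_def lessThan_atLeast0)
  also have "\<dots> = (\<Sum>k<d. A $$ (i, k) * cnj (B $$ (j, k)))"
    using assms by (intro sum.cong refl) (simp add: mat_adjoint_index)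
  finally show ?thesis .
qed

text \<open>Confines the enumeration \<open>ps\<close> and the matrices to one place:
  \<open>pos\<close> inverts the enumeration, and the full rank of the juxtaposed matrix becomes the
  independence of its rows.\<close>

lemma self_adjoint_condition_coeffs:
  assumes "self_adjoint_condition P C"
  obtains \<alpha> \<beta> where "lagrangian_coeffs P \<alpha> \<beta>"
    "\<And>F F'. C F F' \<longleftrightarrow> (\<forall>p\<in>P. (\<Sum>q\<in>P. \<alpha> p q * F q + \<beta> p q * F' q) = 0)"
proof -
  obtain ps d A B where ps: "distinct ps" "set ps = P" "d = length ps"
    and A: "A \<in> carrier_mat d d" and B: "B \<in> carrier_mat d d"
    and rank: "vec_space.rank d (mat_of_cols d (cols A @ cols B)) = d"
    and adj: "mat_adjoint (A * mat_adjoint B) = A * mat_adjoint B"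
    and C: "\<And>F F'. C F F' \<longleftrightarrow> A *\<^sub>v vec_of_list (map F ps) + B *\<^sub>v vec_of_list (map F' ps) = 0\<^sub>v d"
    using assms unfolding self_adjoint_condition_def by auto
  define pos where "pos = inv_into {..<d} ((!) ps)"
  have bij: "bij_betw ((!) ps) {..<d} P" using ps by (intro bij_betw_nth) auto
  have pos: "pos (ps ! i) = i" if "i < d" for i
    unfolding pos_def using bij that by (intro inv_into_f_f) (auto simp: bij_betw_def)
  have reindex: "(\<Sum>q\<in>P. g q) = (\<Sum>i<d. g (ps ! i))" for g :: "_ \<Rightarrow> complex"
    using sum.reindex_bij_betw[OF bij, of g] by simp
  have allP: "(\<forall>p\<in>P. Q p) \<longleftrightarrow> (\<forall>i<d. Q (ps ! i))" for Q
    unfolding ps(2)[symmetric] ps(3) by (metis in_set_conv_nth)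
  define \<alpha> where "\<alpha> p q = A $$ (pos p, pos q)" for p q
  define \<beta> where "\<beta> p q = B $$ (pos p, pos q)" for p q
  have \<alpha>: "\<alpha> (ps ! i) (ps ! j) = A $$ (i, j)" and \<beta>: "\<beta> (ps ! i) (ps ! j) = B $$ (i, j)" if "i < d" "j < d" for i j
    using pos that by (auto simp: \<alpha>_def \<beta>_def)
  have "C F F' \<longleftrightarrow> (\<forall>p\<in>P. (\<Sum>q\<in>P. \<alpha> p q * F q + \<beta> p q * F' q) = 0)" for F F'
  proof -
    have idx: "(A *\<^sub>v vec_of_list (map F ps) + B *\<^sub>v vec_of_list (map F' ps)) $ i =
        (\<Sum>q\<in>P. \<alpha> (ps ! i) q * F q + \<beta> (ps ! i) q * F' q)" if "i < d" for i
    proof -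
      have mv: "(D *\<^sub>v vec_of_list (map h ps)) $ i = (\<Sum>j<d. D $$ (i, j) * h (ps ! j))"
        if "D \<in> carrier_mat d d" for D :: "complex mat" and h
        using that \<open>i < d\<close> ps by (auto simp: mult_mat_vec_def scalar_prod_def lessThan_atLeast0 vec_of_list_index intro!: sum.cong)
      have "(A *\<^sub>v vec_of_list (map F ps) + B *\<^sub>v vec_of_list (map F' ps)) $ i =
          (A *\<^sub>v vec_of_list (map F ps)) $ i + (B *\<^sub>v vec_of_list (map F' ps)) $ i"
        using that B by (intro index_add_vec(1)) simp
      also have "\<dots> = (\<Sum>j<d. A $$ (i, j) * F (ps ! j)) + (\<Sum>j<d. B $$ (i, j) * F' (ps ! j))"
        unfolding mv[OF A] mv[OF B] ..
      also have "\<dots> = (\<Sum>q\<in>P. \<alpha> (ps ! i) q * F q + \<beta> (ps ! i) q * F' q)"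
        unfolding reindex using that by (simp add: \<alpha> \<beta> sum.distrib)
      finally show ?thesis .
    qed
    have "C F F' \<longleftrightarrow> (\<forall>i<d. (A *\<^sub>v vec_of_list (map F ps) + B *\<^sub>v vec_of_list (map F' ps)) $ i = 0)"
      unfolding C using A B by (auto simp: vec_eq_iff)
    then show ?thesis unfolding allP using idx by simp
  qed
  moreover have "lagrangian_coeffs P \<alpha> \<beta>"
    unfolding lagrangian_coeffs_def
  proof (intro conjI allI impI)
    show "finite P" using ps by auto
    have AB: "(A * mat_adjoint B) $$ (i, j) = cnj ((A * mat_adjoint B) $$ (j, i))" if "i < d" "j < d" for i j
    proof -
      have "mat_adjoint (A * mat_adjoint B) $$ (i, j) = cnj ((A * mat_adjoint B) $$ (j, i))"
        using that A B by (intro mat_adjoint_index) (auto simp: mat_adjoint_def)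
      then show ?thesis by (simp add: adj)
    qed
    show "\<forall>p\<in>P. \<forall>r\<in>P. (\<Sum>q\<in>P. \<alpha> p q * cnj (\<beta> r q)) = (\<Sum>q\<in>P. \<beta> p q * cnj (\<alpha> r q))"
      unfolding allP
    proof (intro allI impI)
      fix i j assume ij: "i < d" "j < d"
      have "(\<Sum>k<d. A $$ (i, k) * cnj (B $$ (j, k))) = cnj (\<Sum>k<d. A $$ (j, k) * cnj (B $$ (i, k)))"
        using AB[OF ij] mat_mult_adjoint_index[OF A B] ij by simp
      then show "(\<Sum>q\<in>P. \<alpha> (ps ! i) q * cnj (\<beta> (ps ! j) q)) = (\<Sum>q\<in>P. \<beta> (ps ! i) q * cnj (\<alpha> (ps ! j) q))"
        unfolding reindex using ij by (simp add: \<alpha> \<beta> mult.commute)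
    qed
  next
    fix u assume u: "\<forall>q\<in>P. (\<Sum>p\<in>P. u p * \<alpha> p q) = 0 \<and> (\<Sum>p\<in>P. u p * \<beta> p q) = 0"
    define w where "w = vec d (\<lambda>i. u (ps ! i))"
    have uA: "(\<Sum>i<d. u (ps ! i) * A $$ (i, j)) = 0" and uB: "(\<Sum>i<d. u (ps ! i) * B $$ (i, j)) = 0" if "j < d" for j
      using u that unfolding allP reindex by (auto simp: \<alpha> \<beta>)
    have dot: "c \<bullet> w = 0" if "c \<in> set (cols (mat_of_cols d (cols A @ cols B)))" for c
    proof -
      have "cols (mat_of_cols d (cols A @ cols B)) = cols A @ cols B"
        using A B cols_dim[of A] cols_dim[of B] by (intro cols_mat_of_cols) auto
      then have "c \<in> set (cols A) \<or> c \<in> set (cols B)" using that by simp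
      moreover have "c \<bullet> w = 0" if D: "D \<in> carrier_mat d d" "c \<in> set (cols D)"
          and z: "\<And>j. j < d \<Longrightarrow> (\<Sum>i<d. u (ps ! i) * D $$ (i, j)) = 0" for D :: "complex mat"
      proof -
        obtain j where j: "j < d" "c = col D j" using D by (auto simp: cols_def)
        have "c \<bullet> w = (\<Sum>i<d. u (ps ! i) * D $$ (i, j))"
          unfolding j(2) using j(1) D by (auto simp: scalar_prod_def w_def lessThan_atLeast0 mult.commute intro!: sum.cong)
        then show ?thesis using z j(1) by simp
      qed
      ultimately show ?thesis using A B uA uB by blast
    qed
    have "w = 0\<^sub>v d"
      by (rule full_row_rank_trivial_left_kernel[OF _ rank _ dot]) (auto simp: w_def mat_of_cols_carrier)
    then have "u (ps ! i) = 0" if "i < d" for i using that by (auto simp: w_def vec_eq_iff)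
    then show "\<forall>p\<in>P. u p = 0" unfolding allP by blast
  qed
  ultimately show ?thesis using that by blast
qed

text \<open>
  The rows \<open>(\<alpha>, \<beta>)\<close> are \<open>card P\<close> independent vectors of an isotropic subspace, so its annihilator is
  spanned by the vectors \<open>(cnj \<beta>, - cnj \<alpha>)\<close>: otherwise these, the vectors \<open>(cnj \<alpha>, cnj \<beta>)\<close> and \<open>(F, F')\<close>
  would be \<open>2 * card P + 1\<close> independent vectors in dimension \<open>2 * card P\<close>.
\<close>

lemma lagrangian_kernel_representation:
  assumes "lagrangian_coeffs P \<alpha> \<beta>" and ker: "\<And>p. p \<in> P \<Longrightarrow> (\<Sum>q\<in>P. \<alpha> p q * F q + \<beta> p q * F' q) = 0"
  obtains y where "\<And>q. q \<in> P \<Longrightarrow> F q = (\<Sum>k\<in>P. y k * cnj (\<beta> k q))"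
    "\<And>q. q \<in> P \<Longrightarrow> F' q = - (\<Sum>k\<in>P. y k * cnj (\<alpha> k q))"
proof -
  have fin: "finite P"
    and sa: "\<And>p r. p \<in> P \<Longrightarrow> r \<in> P \<Longrightarrow> (\<Sum>q\<in>P. \<alpha> p q * cnj (\<beta> r q)) = (\<Sum>q\<in>P. \<beta> p q * cnj (\<alpha> r q))"
    and ind: "\<And>u p. (\<And>q. q \<in> P \<Longrightarrow> (\<Sum>p\<in>P. u p * \<alpha> p q) = 0) \<Longrightarrow> (\<And>q. q \<in> P \<Longrightarrow> (\<Sum>p\<in>P. u p * \<beta> p q) = 0) \<Longrightarrow> p \<in> P \<Longrightarrow> u p = 0"
    using assms(1) unfolding lagrangian_coeffs_def by blast+
  have ind': "u p = 0" if "\<And>q. q \<in> P \<Longrightarrow> (\<Sum>k\<in>P. u k * cnj (\<alpha> k q)) = 0"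
      "\<And>q. q \<in> P \<Longrightarrow> (\<Sum>k\<in>P. u k * cnj (\<beta> k q)) = 0" "p \<in> P" for u p
  proof -
    have "(\<Sum>k\<in>P. cnj (u k) * \<alpha> k q) = 0" "(\<Sum>k\<in>P. cnj (u k) * \<beta> k q) = 0" if "q \<in> P" for q
      using arg_cong[OF \<open>\<And>q. q \<in> P \<Longrightarrow> (\<Sum>k\<in>P. u k * cnj (\<alpha> k q)) = 0\<close>[OF that], of cnj]
        arg_cong[OF \<open>\<And>q. q \<in> P \<Longrightarrow> (\<Sum>k\<in>P. u k * cnj (\<beta> k q)) = 0\<close>[OF that], of cnj] by simp_all
    from ind[of "\<lambda>k. cnj (u k)", OF this \<open>p \<in> P\<close>] show ?thesis by simp
  qed
  \<comment> \<open>Column \<open>None\<close> is \<open>(F, F')\<close>, columns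
    \<open>Inl k\<close> are \<open>(cnj \<beta>, - cnj \<alpha>)\<close> and columns
    \<open>Inr k\<close> are \<open>(cnj \<alpha>, cnj \<beta>)\<close>. There is one column more
    than rows, so they are dependent.\<close>
  define M where "M j i = (case j of
      Inl q \<Rightarrow> (case i of None \<Rightarrow> F q | Some (Inl k) \<Rightarrow> cnj (\<beta> k q) | Some (Inr k) \<Rightarrow> cnj (\<alpha> k q))
    | Inr q \<Rightarrow> (case i of None \<Rightarrow> F' q | Some (Inl k) \<Rightarrow> - cnj (\<alpha> k q) | Some (Inr k) \<Rightarrow> cnj (\<beta> k q)))"
    for j :: "'a + 'a" and i :: "('a + 'a) option"
  have "card (P <+> P) < card (insert None (Some ` (P <+> P)))"
    using fin by (subst card_insert_disjoint) (auto simp: card_image)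
  then obtain z where znz: "\<exists>i\<in>insert None (Some ` (P <+> P)). z i \<noteq> 0"
    and z: "\<And>j. j \<in> P <+> P \<Longrightarrow> (\<Sum>i\<in>insert None (Some ` (P <+> P)). M j i * z i) = 0"
    using nontrivial_solution[of "P <+> P" "insert None (Some ` (P <+> P))" M] fin by auto
  define s where "s = z None"
  define u where "u k = z (Some (Inl k))" for k
  define w where "w k = z (Some (Inr k))" for k
  have sum_split: "(\<Sum>i\<in>insert None (Some ` (P <+> P)). g i) = g None + ((\<Sum>k\<in>P. g (Some (Inl k))) + (\<Sum>k\<in>P. g (Some (Inr k))))"
    for g :: "_ \<Rightarrow> complex"
    using fin by (simp add: sum.reindex sum.Plus)
  define a where "a q = (\<Sum>k\<in>P. w k * cnj (\<alpha> k q))" for q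
  define b where "b q = (\<Sum>k\<in>P. w k * cnj (\<beta> k q))" for q
  have e1: "s * F q + (\<Sum>k\<in>P. u k * cnj (\<beta> k q)) + a q = 0" if "q \<in> P" for q
    using z[OF InlI[OF that]] unfolding sum_split by (simp add: M_def s_def u_def w_def a_def mult.commute add.assoc)
  have e2: "s * F' q - (\<Sum>k\<in>P. u k * cnj (\<alpha> k q)) + b q = 0" if "q \<in> P" for q
    using z[OF InrI[OF that]] unfolding sum_split
    by (simp add: M_def s_def u_def w_def b_def mult.commute sum_negf algebra_simps)
  \<comment> \<open>\<open>(a, b)\<close> is a combination of the other two kinds of columns, and
    both satisfy the condition: \<open>(F, F')\<close> by assumption and
    \<open>(cnj \<beta>, - cnj \<alpha>)\<close> by self-adjointness.\<close>
  have ab: "(\<Sum>q\<in>P. \<alpha> p q * a q + \<beta> p q * b q) = 0" if p: "p \<in> P" for p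
  proof -
    have "(\<Sum>q\<in>P. \<alpha> p q * a q + \<beta> p q * b q) = (\<Sum>q\<in>P. - s * (\<alpha> p q * F q + \<beta> p q * F' q)
        - \<alpha> p q * (\<Sum>k\<in>P. u k * cnj (\<beta> k q)) + \<beta> p q * (\<Sum>k\<in>P. u k * cnj (\<alpha> k q)))"
    proof (rule sum.cong)
      fix q assume "q \<in> P"
      have "a q = - s * F q - (\<Sum>k\<in>P. u k * cnj (\<beta> k q))" "b q = - s * F' q + (\<Sum>k\<in>P. u k * cnj (\<alpha> k q))"
        using e1[OF \<open>q \<in> P\<close>] e2[OF \<open>q \<in> P\<close>] by (simp_all add: algebra_simps eq_neg_iff_add_eq_0)
      then show "\<alpha> p q * a q + \<beta> p q * b q = - s * (\<alpha> p q * F q + \<beta> p q * F' q)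
        - \<alpha> p q * (\<Sum>k\<in>P. u k * cnj (\<beta> k q)) + \<beta> p q * (\<Sum>k\<in>P. u k * cnj (\<alpha> k q))"
        by (simp only:) (simp only: algebra_simps)
    qed simp
    also have "\<dots> = - s * (\<Sum>q\<in>P. \<alpha> p q * F q + \<beta> p q * F' q)
        - (\<Sum>q\<in>P. \<Sum>k\<in>P. u k * (\<alpha> p q * cnj (\<beta> k q))) + (\<Sum>q\<in>P. \<Sum>k\<in>P. u k * (\<beta> p q * cnj (\<alpha> k q)))"
    proof -
      have lin: "(\<Sum>q\<in>P. - s * K q - X q + Y q) = - s * (\<Sum>q\<in>P. K q) - (\<Sum>q\<in>P. X q) + (\<Sum>q\<in>P. Y q)"
        for K X Y :: "'a \<Rightarrow> complex"
        by (simp add: sum.distrib sum_subtractf sum_distrib_left sum_negf)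
      show ?thesis unfolding lin by (simp add: sum_distrib_left mult.left_commute)
    qed
    also have "(\<Sum>q\<in>P. \<Sum>k\<in>P. u k * (\<alpha> p q * cnj (\<beta> k q))) = (\<Sum>k\<in>P. u k * (\<Sum>q\<in>P. \<alpha> p q * cnj (\<beta> k q)))"
      by (subst sum.swap) (simp add: sum_distrib_left)
    also have "\<dots> = (\<Sum>k\<in>P. u k * (\<Sum>q\<in>P. \<beta> p q * cnj (\<alpha> k q)))"
      using sa[OF p] by (intro sum.cong) auto
    also have "\<dots> = (\<Sum>q\<in>P. \<Sum>k\<in>P. u k * (\<beta> p q * cnj (\<alpha> k q)))"
      by (subst sum.swap) (simp add: sum_distrib_left)
    finally show ?thesis using ker[OF p] by simp
  qed
  \<comment> \<open>\<open>(a, b)\<close> also lies in the span of the conjugated rows, so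
    satisfying the condition makes it orthogonal to itself.\<close>
  have "(\<Sum>q\<in>P. complex_of_real ((cmod (a q))\<^sup>2 + (cmod (b q))\<^sup>2)) = (\<Sum>q\<in>P. cnj (a q) * a q + cnj (b q) * b q)"
    by (intro sum.cong refl) (simp add: complex_norm_square mult.commute del: of_real_power)
  also have "\<dots> = (\<Sum>q\<in>P. \<Sum>p\<in>P. cnj (w p) * (\<alpha> p q * a q + \<beta> p q * b q))"
  proof (intro sum.cong refl)
    fix q
    have "cnj (a q) = (\<Sum>p\<in>P. cnj (w p) * \<alpha> p q)" "cnj (b q) = (\<Sum>p\<in>P. cnj (w p) * \<beta> p q)"
      by (simp_all add: a_def b_def)
    then show "cnj (a q) * a q + cnj (b q) * b q = (\<Sum>p\<in>P. cnj (w p) * (\<alpha> p q * a q + \<beta> p q * b q))"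
      by (simp add: sum_distrib_right sum.distrib distrib_left mult.assoc)
  qed
  also have "\<dots> = (\<Sum>p\<in>P. cnj (w p) * (\<Sum>q\<in>P. \<alpha> p q * a q + \<beta> p q * b q))"
    by (subst sum.swap) (simp only: sum_distrib_left)
  also have "\<dots> = 0" using ab by simp
  finally have "(\<Sum>q\<in>P. (cmod (a q))\<^sup>2 + (cmod (b q))\<^sup>2) = 0"
    by (metis of_real_eq_0_iff of_real_sum)
  then have "\<forall>q\<in>P. (cmod (a q))\<^sup>2 + (cmod (b q))\<^sup>2 = 0" using fin by (subst (asm) sum_nonneg_eq_0_iff) auto
  then have ab0: "a q = 0" "b q = 0" if "q \<in> P" for q using that by (auto simp: sum_power2_eq_zero_iff)
  have w0: "w p = 0" if "p \<in> P" for p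
    by (rule ind'[OF _ _ that]) (use ab0 in \<open>auto simp: a_def b_def\<close>)
  \<comment> \<open>With \<open>s = 0\<close> and \<open>w = 0\<close> only the vectors
    \<open>(cnj \<beta>, - cnj \<alpha>)\<close> would remain in the relation, and these are
    independent.\<close>
  have s0: "s \<noteq> 0"
  proof
    assume "s = 0"
    have "u p = 0" if "p \<in> P" for p
      by (rule ind'[OF _ _ that]) (use e1 e2 ab0 \<open>s = 0\<close> in auto)
    then show False using znz w0 \<open>s = 0\<close> by (auto simp: s_def u_def w_def)
  qed
  show ?thesis
  proof (rule that[of "\<lambda>k. - u k / s"])
    fix q assume q: "q \<in> P"
    have "s * F q = - (\<Sum>k\<in>P. u k * cnj (\<beta> k q))" "s * F' q = (\<Sum>k\<in>P. u k * cnj (\<alpha> k q))"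
      using e1[OF q] e2[OF q] ab0[OF q] by (simp_all add: eq_neg_iff_add_eq_0)
    then have "F q = - (\<Sum>k\<in>P. u k * cnj (\<beta> k q)) / s" "F' q = (\<Sum>k\<in>P. u k * cnj (\<alpha> k q)) / s"
      using s0 by (metis nonzero_mult_div_cancel_left)+
    then show "F q = (\<Sum>k\<in>P. - u k / s * cnj (\<beta> k q))" "F' q = - (\<Sum>k\<in>P. - u k / s * cnj (\<alpha> k q))"
      by (simp_all add: sum_divide_distrib sum_negf)
  qed
qed

text \<open>In the representation of \<open>(F, F')\<close> the form becomes a combination of the
  conjugated conditions on \<open>(G, G')\<close>, all of which vanish.\<close>

lemma lagrangian_form_zero:
  assumes "lagrangian_coeffs P \<alpha> \<beta>"
    and F: "\<And>p. p \<in> P \<Longrightarrow> (\<Sum>q\<in>P. \<alpha> p q * F q + \<beta> p q * F' q) = 0"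
    and G: "\<And>p. p \<in> P \<Longrightarrow> (\<Sum>q\<in>P. \<alpha> p q * G q + \<beta> p q * G' q) = 0"
  shows "(\<Sum>q\<in>P. F' q * cnj (G q) - F q * cnj (G' q)) = 0"
proof -
  obtain y where y: "\<And>q. q \<in> P \<Longrightarrow> F q = (\<Sum>k\<in>P. y k * cnj (\<beta> k q))"
    "\<And>q. q \<in> P \<Longrightarrow> F' q = - (\<Sum>k\<in>P. y k * cnj (\<alpha> k q))"
    by (rule lagrangian_kernel_representation[OF assms(1), of F F'], erule F, rule that)
  have "(\<Sum>q\<in>P. F' q * cnj (G q) - F q * cnj (G' q)) =
      (\<Sum>q\<in>P. \<Sum>k\<in>P. - y k * cnj (\<alpha> k q * G q + \<beta> k q * G' q))"
    by (intro sum.cong refl)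
      (simp add: y sum_distrib_right sum_distrib_left sum_negf sum_subtractf sum.distrib distrib_left mult.assoc)
  also have "\<dots> = (\<Sum>k\<in>P. - y k * cnj (\<Sum>q\<in>P. \<alpha> k q * G q + \<beta> k q * G' q))"
    by (subst sum.swap) (simp only: sum_distrib_left cnj_sum)
  also have "\<dots> = 0" using G by simp
  finally show ?thesis .
qed

section \<open>Weak second derivatives\<close>

text \<open>The segment is bounded, so the majorant \<open>1 + (norm (h x))\<^sup>2\<close> is
  integrable.\<close>

lemma square_integrable_imp_absolutely_integrable:
  fixes h :: "real \<Rightarrow> 'a::euclidean_space"
  assumes "square_integrable L h"
  shows "h absolutely_integrable_on {0..L}"
proof (rule measurable_bounded_by_integrable_imp_absolutely_integrable)
  show "h \<in> borel_measurable (lebesgue_on {0..L})"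
    using assms by (simp add: square_integrable_def set_borel_measurable_def borel_measurable_restrict_space_iff)
  have "(\<lambda>x. (norm (h x))\<^sup>2) integrable_on {0..L}"
    using assms set_lebesgue_integral_eq_integral(1) by (auto simp: square_integrable_def)
  then show "(\<lambda>x. 1 + (norm (h x))\<^sup>2) integrable_on {0..L}"
    by (intro integrable_add) auto
  show "norm (h x) \<le> 1 + (norm (h x))\<^sup>2" for x
  proof -
    have "0 \<le> (norm (h x) - 1)\<^sup>2" by simp
    then have "2 * norm (h x) \<le> 1 + (norm (h x))\<^sup>2" by (simp add: power2_eq_square algebra_simps)
    then show ?thesis using norm_ge_zero[of "h x"] by linarith
  qed
qed simp

text \<open>\<open>f\<close> determines its derivative, hence the indefinite integrals of
  \<open>h\<close> and \<open>k\<close> coincide. This makes the choice in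
  \<open>second_deriv\<close> harmless.\<close>

lemma second_weak_derivative_AE_unique:
  assumes L: "0 < L" and h: "second_weak_derivative L f h" and k: "second_weak_derivative L f k"
  shows "AE x in lebesgue. x \<in> {0..L} \<longrightarrow> h x = k x"
proof -
  have ai: "h absolutely_integrable_on {0..L}" "k absolutely_integrable_on {0..L}"
    using h k by (auto simp: second_weak_derivative_def intro: square_integrable_imp_absolutely_integrable)
  obtain g g' where g: "\<And>x. x \<in> {0..L} \<Longrightarrow> (f has_vector_derivative g x) (at x within {0..L})"
      "\<And>x. x \<in> {0..L} \<Longrightarrow> g x = g 0 + (LINT t:{0..x}|lebesgue. h t)"
    and g': "\<And>x. x \<in> {0..L} \<Longrightarrow> (f has_vector_derivative g' x) (at x within {0..L})"
      "\<And>x. x \<in> {0..L} \<Longrightarrow> g' x = g' 0 + (LINT t:{0..x}|lebesgue. k t)"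
    using h k unfolding second_weak_derivative_def by blast
  have eq: "g x = g' x" if "x \<in> {0..L}" for x
    using vector_derivative_unique_within_closed_interval[of 0 L x f "g x" "g' x"] g(1)[OF that] g'(1)[OF that] L that
    by simp
  have "AE x in lebesgue. x \<in> {0..L} \<longrightarrow> h x - k x = 0"
  proof (rule AE_zero_if_indefinite_integral_zero)
    show "(\<lambda>x. h x - k x) absolutely_integrable_on {0..L}" by (intro set_integral_diff(1) ai)
    fix x assume x: "x \<in> {0..L}"
    have aix: "h absolutely_integrable_on {0..x}" "k absolutely_integrable_on {0..x}"
      using absolutely_integrable_on_Icc_subset[OF ai(1)] absolutely_integrable_on_Icc_subset[OF ai(2)] x by auto
    have "(LINT t:{0..x}|lebesgue. h t) = (LINT t:{0..x}|lebesgue. k t)"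
      using g(2)[OF x] g'(2)[OF x] eq[OF x] eq[of 0] L by simp
    then have "integral {0..x} h = integral {0..x} k"
      using set_lebesgue_integral_eq_integral(2)[OF aix(1)] set_lebesgue_integral_eq_integral(2)[OF aix(2)] by simp
    moreover have "integral {0..x} (\<lambda>t. h t - k t) = integral {0..x} h - integral {0..x} k"
      using set_lebesgue_integral_eq_integral(1)[OF aix(1)] set_lebesgue_integral_eq_integral(1)[OF aix(2)]
      by (rule Henstock_Kurzweil_Integration.integral_diff)
    ultimately show "integral {0..x} (\<lambda>t. h t - k t) = 0" by simp
  qed
  then show ?thesis by eventually_elim auto
qed

section \<open>The weak eigenvalue equation in integrated form\<close>

context schroedinger_segment
begin

lemma solves_vector_derivative:
  assumes "solves \<nu> f g" "x \<in> {0..L}"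
  shows "vector_derivative f (at x within {0..L}) = g x"
proof -
  have "(f has_vector_derivative g x) (at x within {0..L})" using assms unfolding solves_def by blast
  then show ?thesis by (rule vector_derivative_within_closed_interval[OF L_pos assms(2)])
qed

text \<open>Recovers the derivative in the Cauchy data from the values of the function alone, for
  the injectivity of the encoding by Cauchy data.\<close>

lemma solves_vanishing:
  assumes "solves \<nu> f g" "\<And>x. x \<in> {0..L} \<Longrightarrow> f x = 0"
  shows "g 0 = 0"
proof -
  have 0: "(0::real) \<in> {0..L}" using L_pos by simp
  have "((\<lambda>x. 0) has_vector_derivative 0) (at 0 within {0..L})" by simp
  then have "(f has_vector_derivative 0) (at 0 within {0..L})"
    by (rule has_vector_derivative_transform[OF 0, rotated]) (use assms(2) in auto)
  moreover have "(f has_vector_derivative g 0) (at 0 within {0..L})"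
    using assms(1) 0 unfolding solves_def by blast
  ultimately show ?thesis
    using vector_derivative_unique_within_closed_interval[of 0 L 0 f 0 "g 0"] L_pos by simp
qed

lemma solves_imp_second_weak_derivative:
  assumes "solves \<nu> f g"
  shows "second_weak_derivative L f (\<lambda>t. complex_of_real (V t - \<nu>) * f t)"
proof -
  note cf = solves_continuous(1)[OF assms]
  have ai: "(\<lambda>t. complex_of_real (V t - \<nu>) * f t) absolutely_integrable_on {0..L}"
    by (rule potential_mult_integrable[OF cf])
  have "(\<lambda>t. (V t)\<^sup>2 - 2 * \<nu> * V t + \<nu>\<^sup>2) absolutely_integrable_on {0..L}"
    by (intro set_integral_diff(1) set_integral_add(1) V_sq_int set_integrable_mult_right V_int absolutely_integrable_on_const) auto
  then have "(\<lambda>t. (V t - \<nu>)\<^sup>2) absolutely_integrable_on {0..L}"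
    by (simp add: power2_eq_square algebra_simps)
  then have "(complex_of_real \<circ> (\<lambda>t. (V t - \<nu>)\<^sup>2)) absolutely_integrable_on {0..L}"
    by (rule absolutely_integrable_linear) (rule bounded_linear_of_real)
  \<comment> \<open>\<open>f t * f t\<close> is a continuous factor whose norm is
    \<open>(norm (f t))\<^sup>2\<close>, so the product lemma yields square integrability.\<close>
  then have "(\<lambda>t. complex_of_real ((V t - \<nu>)\<^sup>2) * (f t * f t)) absolutely_integrable_on {0..L}"
    by (intro absolutely_integrable_mult_continuous continuous_intros cf) (simp add: o_def)
  then have "(\<lambda>t. norm (complex_of_real ((V t - \<nu>)\<^sup>2) * (f t * f t))) absolutely_integrable_on {0..L}"
    by (rule set_integrable_norm)
  moreover have "norm (complex_of_real ((V t - \<nu>)\<^sup>2) * (f t * f t)) = (norm (complex_of_real (V t - \<nu>) * f t))\<^sup>2" for t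
    by (simp only: norm_mult norm_of_real power2_eq_square abs_mult mult.assoc mult.left_commute)
  ultimately have sq: "(\<lambda>t. (norm (complex_of_real (V t - \<nu>) * f t))\<^sup>2) absolutely_integrable_on {0..L}"
    by simp
  have "set_borel_measurable lebesgue {0..L} (\<lambda>t. complex_of_real (V t - \<nu>) * f t)"
    using ai unfolding set_integrable_def set_borel_measurable_def by (rule borel_measurable_integrable)
  with sq have "square_integrable L (\<lambda>t. complex_of_real (V t - \<nu>) * f t)"
    unfolding square_integrable_def by (intro conjI)
  moreover have "g x = g 0 + (LINT t:{0..x}|lebesgue. complex_of_real (V t - \<nu>) * f t)" if "x \<in> {0..L}" for x
  proof -
    have "(LINT t:{0..x}|lebesgue. complex_of_real (V t - \<nu>) * f t) = volterra1 \<nu> f x"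
      unfolding volterra1_def
      by (rule set_lebesgue_integral_eq_integral(2)[OF absolutely_integrable_on_Icc_subset[OF ai]]) (use that in auto)
    then show ?thesis using assms that unfolding solves_def by metis
  qed
  ultimately show ?thesis
    using assms unfolding second_weak_derivative_def solves_def by blast
qed

text \<open>The chosen \<open>second_deriv\<close> agrees with \<open>(V - \<nu>) f\<close> almost
  everywhere, and the integrals in \<open>solves\<close> ignore null sets. The choice and the
  exceptional set disappear from the argument through this equivalence.\<close>

lemma solves_iff_eigenvalue_equation:
  "(\<exists>g. solves \<nu> f g) \<longleftrightarrow> f \<in> sobolev_H2 L \<and>
     (AE x in lebesgue. x \<in> {0..L} \<longrightarrow> - second_deriv L f x + complex_of_real (V x) * f x = complex_of_real \<nu> * f x)"
proof
  assume "\<exists>g. solves \<nu> f g"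
  then obtain g where g: "solves \<nu> f g" by blast
  note w = solves_imp_second_weak_derivative[OF g]
  have "second_weak_derivative L f (second_deriv L f)"
    unfolding second_deriv_def by (rule someI[where P = "second_weak_derivative L f"]) (rule w)
  from second_weak_derivative_AE_unique[OF L_pos this w]
  have "AE x in lebesgue. x \<in> {0..L} \<longrightarrow> - second_deriv L f x + complex_of_real (V x) * f x = complex_of_real \<nu> * f x"
    by eventually_elim (simp add: algebra_simps)
  then show "f \<in> sobolev_H2 L \<and>
     (AE x in lebesgue. x \<in> {0..L} \<longrightarrow> - second_deriv L f x + complex_of_real (V x) * f x = complex_of_real \<nu> * f x)"
    using w unfolding sobolev_H2_def by blast
next
  assume "f \<in> sobolev_H2 L \<and>
     (AE x in lebesgue. x \<in> {0..L} \<longrightarrow> - second_deriv L f x + complex_of_real (V x) * f x = complex_of_real \<nu> * f x)"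
  then have H2: "\<exists>h. second_weak_derivative L f h"
    and ae: "AE x in lebesgue. x \<in> {0..L} \<longrightarrow> - second_deriv L f x + complex_of_real (V x) * f x = complex_of_real \<nu> * f x"
    by (auto simp: sobolev_H2_def)
  from H2 have w: "second_weak_derivative L f (second_deriv L f)"
    unfolding second_deriv_def by (rule someI_ex[where P = "second_weak_derivative L f"])
  then obtain g where g: "\<And>x. x \<in> {0..L} \<Longrightarrow> (f has_vector_derivative g x) (at x within {0..L})"
      "\<And>x. x \<in> {0..L} \<Longrightarrow> g x = g 0 + (LINT t:{0..x}|lebesgue. second_deriv L f t)"
    and sq: "square_integrable L (second_deriv L f)"
    unfolding second_weak_derivative_def by blast
  note ai = square_integrable_imp_absolutely_integrable[OF sq]
  obtain N where N: "negligible N" "\<And>x. x \<notin> N \<Longrightarrow> x \<in> {0..L} \<Longrightarrow>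
      - second_deriv L f x + complex_of_real (V x) * f x = complex_of_real \<nu> * f x"
    using ae unfolding eventually_ae_filter_negligible by blast
  have "g x = g 0 + volterra1 \<nu> f x" if x: "x \<in> {0..L}" for x
  proof -
    have "(LINT t:{0..x}|lebesgue. second_deriv L f t) = integral {0..x} (second_deriv L f)"
      by (rule set_lebesgue_integral_eq_integral(2)[OF absolutely_integrable_on_Icc_subset[OF ai]]) (use x in auto)
    also have "\<dots> = volterra1 \<nu> f x"
      unfolding volterra1_def
    proof (rule integral_spike[OF N(1)])
      fix t assume "t \<in> {0..x} - N"
      then have "- second_deriv L f t + complex_of_real (V t) * f t = complex_of_real \<nu> * f t"
        using N(2) x by auto
      then show "complex_of_real (V t - \<nu>) * f t = second_deriv L f t" by (simp add: algebra_simps)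
    qed
    finally show ?thesis using g(2)[OF x] by simp
  qed
  then have "solves \<nu> f g" unfolding solves_def using g(1) by blast
  then show "\<exists>g. solves \<nu> f g" by blast
qed

end

lemma compact_quantum_graph_segment:
  assumes "compact_quantum_graph \<Gamma>" "e \<in> edges \<Gamma>"
  shows "schroedinger_segment (len \<Gamma> e) (potential \<Gamma> e)"
proof
  have e: "0 < len \<Gamma> e" "square_integrable (len \<Gamma> e) (potential \<Gamma> e)"
    using assms by (auto simp: compact_quantum_graph_def)
  then show "0 < len \<Gamma> e" "potential \<Gamma> e absolutely_integrable_on {0..len \<Gamma> e}"
    by (auto intro: square_integrable_imp_absolutely_integrable)
  show "(\<lambda>t. (potential \<Gamma> e t)\<^sup>2) absolutely_integrable_on {0..len \<Gamma> e}"
    using e(2) by (simp add: square_integrable_def)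
qed

section \<open>Solutions on the graph\<close>

text \<open>Turns a linear condition into a row of coefficients, the form in which
  \<open>nontrivial_solution\<close> counts equations.\<close>

lemma linear_functional_coordinates:
  fixes l :: "('i \<Rightarrow> complex) \<Rightarrow> complex"
  assumes fin: "finite I" and lin: "\<And>x y c. l (\<lambda>i. x i + c * y i) = l x + c * l y"
    and supp: "\<And>i. i \<notin> I \<Longrightarrow> x i = 0"
  shows "l x = (\<Sum>i\<in>I. l (\<lambda>j. if j = i then 1 else 0) * x i)"
proof -
  have z: "l (\<lambda>i. 0) = 0" using lin[of "\<lambda>i. 0" "-1" "\<lambda>i. 0"] by simp
  have coords: "l (\<lambda>j. if j \<in> J then x j else 0) = (\<Sum>i\<in>J. l (\<lambda>j. if j = i then 1 else 0) * x i)" if "finite J" for J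
    using that
  proof induction
    case empty
    then show ?case by (simp add: z)
  next
    case (insert k J)
    have "(\<lambda>j. if j \<in> insert k J then x j else 0) =
        (\<lambda>j. (if j \<in> J then x j else 0) + x k * (if j = k then 1 else 0))"
      using insert.hyps(2) by (auto simp: fun_eq_iff)
    then show ?case using insert lin[of "\<lambda>j. if j \<in> J then x j else 0" "x k" "\<lambda>j. if j = k then 1 else 0"]
      by (simp add: mult.commute)
  qed
  have "(\<lambda>j. if j \<in> I then x j else 0) = x" using supp by auto
  with coords[OF fin] show ?thesis by (simp only:)
qed

lemma UNIV_side: "(UNIV :: side set) = {Source, Target}"
  using side.exhaust by auto

lemma delta_cong:
  assumes "\<And>p. p \<in> P \<Longrightarrow> F p = H p" "\<And>p. p \<in> P \<Longrightarrow> F' p = H' p"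
  shows "delta_condition P t F F' \<longleftrightarrow> delta_condition P t H H'"
    "inverse_delta_condition P t F F' \<longleftrightarrow> inverse_delta_condition P t H H'"
  using assms unfolding delta_condition_def inverse_delta_condition_def by (simp_all cong: sum.cong)

locale graph_with_vertex =
  fixes \<Gamma> :: "('v, 'e) quantum_graph" and v :: 'v
  assumes compact: "compact_quantum_graph \<Gamma>" and v: "v \<in> verts \<Gamma>" and ends_v: "incident_ends \<Gamma> v \<noteq> {}"
begin

abbreviation ends_at :: "'v \<Rightarrow> ('e \<times> side) set" where
  "ends_at \<equiv> incident_ends \<Gamma>"

definition ends :: "('e \<times> side) set" where "ends = edges \<Gamma> \<times> UNIV"

fun end_vertex :: "'e \<times> side \<Rightarrow> 'v" where
  "end_vertex (e, Source) = source \<Gamma> e"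
| "end_vertex (e, Target) = target \<Gamma> e"

text \<open>The value at \<open>v\<close> is read at one fixed end. This makes \<open>val\<close>
  linear on all coordinate vectors, also on those not continuous at \<open>v\<close>, as the pencil
  demands.\<close>

definition base_end :: "'e \<times> side" where "base_end = (SOME p. p \<in> ends_at v)"

abbreviation solves_on :: "'e \<Rightarrow> real \<Rightarrow> (real \<Rightarrow> complex) \<Rightarrow> (real \<Rightarrow> complex) \<Rightarrow> bool" where
  "solves_on e \<equiv> schroedinger_segment.solves (len \<Gamma> e) (potential \<Gamma> e)"

text \<open>
  A solution on all edges is encoded by its Cauchy data at the sources: \<open>x (e, Source)\<close> is the value and
  \<open>x (e, Target)\<close> the derivative at the source of \<open>e\<close>.
\<close>

definition sol :: "real \<Rightarrow> ('e \<times> side \<Rightarrow> complex) \<Rightarrow> 'e \<Rightarrow> real \<Rightarrow> complex" where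
  "sol \<nu> x e = schroedinger_segment.fund (len \<Gamma> e) (potential \<Gamma> e) \<nu> (x (e, Source)) (x (e, Target))"

definition sol' :: "real \<Rightarrow> ('e \<times> side \<Rightarrow> complex) \<Rightarrow> 'e \<Rightarrow> real \<Rightarrow> complex" where
  "sol' \<nu> x e = schroedinger_segment.fund' (len \<Gamma> e) (potential \<Gamma> e) \<nu> (x (e, Source)) (x (e, Target))"

text \<open>The inverse of the encoding on solutions. The value 0 outside \<open>ends\<close> makes
  the coordinates unique.\<close>

definition data :: "('e \<Rightarrow> real \<Rightarrow> complex) \<Rightarrow> 'e \<times> side \<Rightarrow> complex" where
  "data f p = (if p \<in> ends then (case p of (e, Source) \<Rightarrow> f e 0
     | (e, Target) \<Rightarrow> vector_derivative (f e) (at 0 within {0..len \<Gamma> e})) else 0)"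

abbreviation EV :: "real \<Rightarrow> ('e \<times> side \<Rightarrow> complex) \<Rightarrow> 'e \<times> side \<Rightarrow> complex" where
  "EV \<nu> x \<equiv> end_value \<Gamma> (sol \<nu> x)"

abbreviation ED :: "real \<Rightarrow> ('e \<times> side \<Rightarrow> complex) \<Rightarrow> 'e \<times> side \<Rightarrow> complex" where
  "ED \<nu> x \<equiv> end_deriv \<Gamma> (sol \<nu> x)"

definition S :: "real \<Rightarrow> ('e \<times> side \<Rightarrow> complex) set" where
  "S \<nu> = {x. (\<forall>i. i \<notin> ends \<longrightarrow> x i = 0) \<and>
     (\<forall>w\<in>verts \<Gamma> - {v}. vertex_cond \<Gamma> w (EV \<nu> x) (ED \<nu> x)) \<and>
     (\<forall>p\<in>ends_at v. \<forall>q\<in>ends_at v. EV \<nu> x p = EV \<nu> x q)}"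

definition val :: "real \<Rightarrow> ('e \<times> side \<Rightarrow> complex) \<Rightarrow> complex" where
  "val \<nu> x = EV \<nu> x base_end"

definition dsum :: "real \<Rightarrow> ('e \<times> side \<Rightarrow> complex) \<Rightarrow> complex" where
  "dsum \<nu> x = (\<Sum>p\<in>ends_at v. ED \<nu> x p)"

definition G :: "real \<Rightarrow> real \<Rightarrow> ('e \<times> side \<Rightarrow> complex) \<Rightarrow> ('e \<times> side \<Rightarrow> complex) \<Rightarrow> complex" where
  "G \<nu> \<mu> x y = (\<Sum>e\<in>edges \<Gamma>. integral {0..len \<Gamma> e} (\<lambda>s. sol \<nu> x e s * cnj (sol \<mu> y e s)))"

lemma finite_verts: "finite (verts \<Gamma>)" and finite_edges: "finite (edges \<Gamma>)"
  and self_adjoint: "w \<in> verts \<Gamma> \<Longrightarrow> self_adjoint_condition (ends_at w) (vertex_cond \<Gamma> w)"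
  using compact by (auto simp: compact_quantum_graph_def)

lemma end_vertex_in_verts: "p \<in> ends \<Longrightarrow> end_vertex p \<in> verts \<Gamma>"
  using compact by (cases p rule: end_vertex.cases) (auto simp: compact_quantum_graph_def ends_def)

lemma segment: "e \<in> edges \<Gamma> \<Longrightarrow> schroedinger_segment (len \<Gamma> e) (potential \<Gamma> e)"
  by (rule compact_quantum_graph_segment[OF compact])

lemma len_pos: "e \<in> edges \<Gamma> \<Longrightarrow> 0 < len \<Gamma> e"
  using compact by (auto simp: compact_quantum_graph_def)

lemma finite_ends: "finite ends"
  unfolding ends_def UNIV_side using finite_edges by simp

lemma incident_ends_iff: "p \<in> ends_at w \<longleftrightarrow> p \<in> ends \<and> end_vertex p = w"
  by (cases p rule: end_vertex.cases) (auto simp: incident_ends_def ends_def)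

lemma incident_ends_subset: "ends_at w \<subseteq> ends"
  using incident_ends_iff by blast

lemma finite_incident_ends: "finite (ends_at w)"
  using finite_subset[OF incident_ends_subset finite_ends] .

lemma base_end: "base_end \<in> ends_at v"
  unfolding base_end_def using ends_v by (simp add: some_in_eq)

lemma sum_ends: "(\<Sum>p\<in>ends. h p) = (\<Sum>e\<in>edges \<Gamma>. h (e, Source) + h (e, Target))"
  for h :: "'e \<times> side \<Rightarrow> complex"
proof -
  have "(\<Sum>p\<in>ends. h p) = (\<Sum>e\<in>edges \<Gamma>. \<Sum>s\<in>{Source, Target}. h (e, s))"
    unfolding ends_def UNIV_side by (subst sum.cartesian_product) simp
  then show ?thesis by simp
qed

text \<open>Each end lies at exactly one vertex, so boundary terms collected along edges can be
  regrouped by vertices; a loop contributes two ends to its vertex.\<close>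

lemma sum_ends_by_vertex: "(\<Sum>p\<in>ends. h p) = (\<Sum>w\<in>verts \<Gamma>. \<Sum>p\<in>ends_at w. h p)"
  for h :: "'e \<times> side \<Rightarrow> complex"
proof -
  have "ends = (\<Union>w\<in>verts \<Gamma>. ends_at w)"
    using incident_ends_iff end_vertex_in_verts by auto
  then have "(\<Sum>p\<in>ends. h p) = (\<Sum>p\<in>(\<Union>w\<in>verts \<Gamma>. ends_at w). h p)" by simp
  also have "\<dots> = (\<Sum>w\<in>verts \<Gamma>. \<Sum>p\<in>ends_at w. h p)"
    by (rule sum.UNION_disjoint) (auto simp: finite_verts finite_incident_ends incident_ends_iff)
  finally show ?thesis .
qed

lemma sol_solves: "e \<in> edges \<Gamma> \<Longrightarrow> solves_on e \<nu> (sol \<nu> x e) (sol' \<nu> x e)"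
  unfolding sol_def sol'_def by (rule schroedinger_segment.fund_solves[OF segment])

lemma sol_0: "e \<in> edges \<Gamma> \<Longrightarrow> sol \<nu> x e 0 = x (e, Source)"
  and sol'_0: "e \<in> edges \<Gamma> \<Longrightarrow> sol' \<nu> x e 0 = x (e, Target)"
  unfolding sol_def sol'_def by (simp_all add: schroedinger_segment.fund_0 schroedinger_segment.fund'_0 segment)

lemma sol_lin:
  assumes "e \<in> edges \<Gamma>" "s \<in> {0..len \<Gamma> e}"
  shows "sol \<nu> (\<lambda>i. x i + c * y i) e s = sol \<nu> x e s + c * sol \<nu> y e s"
    "sol' \<nu> (\<lambda>i. x i + c * y i) e s = sol' \<nu> x e s + c * sol' \<nu> y e s"
  unfolding sol_def sol'_def
  by (simp_all add: schroedinger_segment.fund_lin[OF segment[OF assms(1)] assms(2)])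

lemma sol_zero:
  assumes "e \<in> edges \<Gamma>" "s \<in> {0..len \<Gamma> e}"
  shows "sol \<nu> (\<lambda>i. 0) e s = 0"
  using sol_lin(1)[OF assms, of \<nu> "\<lambda>i. 0" "-1" "\<lambda>i. 0"] by simp

lemma sol_scale:
  assumes "e \<in> edges \<Gamma>" "s \<in> {0..len \<Gamma> e}"
  shows "sol \<nu> (\<lambda>i. c * y i) e s = c * sol \<nu> y e s"
  using sol_lin(1)[OF assms, of \<nu> "\<lambda>i. 0" c y] sol_zero[OF assms] by simp

lemma sol_lim:
  assumes "e \<in> edges \<Gamma>" "s \<in> {0..len \<Gamma> e}" "Z \<longlonglongrightarrow> \<nu>" "\<And>i. (\<lambda>n. X n i) \<longlonglongrightarrow> x i"
  shows "(\<lambda>n. sol (Z n) (X n) e s) \<longlonglongrightarrow> sol \<nu> x e s" "(\<lambda>n. sol' (Z n) (X n) e s) \<longlonglongrightarrow> sol' \<nu> x e s"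
  unfolding sol_def sol'_def
  by (rule schroedinger_segment.fund_lim[OF segment[OF assms(1)] assms(3) assms(4) assms(4) assms(2)])+

lemma sol_continuous: "e \<in> edges \<Gamma> \<Longrightarrow> continuous_on {0..len \<Gamma> e} (sol \<nu> x e)"
  unfolding sol_def by (rule schroedinger_segment.fund_continuous[OF segment])

lemma end_deriv_solution:
  assumes "e \<in> edges \<Gamma>" "solves_on e \<nu> (f e) g"
  shows "end_deriv \<Gamma> f (e, Source) = g 0" "end_deriv \<Gamma> f (e, Target) = - g (len \<Gamma> e)"
  using schroedinger_segment.solves_vector_derivative[OF segment[OF assms(1)] assms(2), of 0]
    schroedinger_segment.solves_vector_derivative[OF segment[OF assms(1)] assms(2), of "len \<Gamma> e"]
    len_pos[OF assms(1)] by simp_all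

lemma ED_simps:
  assumes "e \<in> edges \<Gamma>"
  shows "ED \<nu> x (e, Source) = sol' \<nu> x e 0" "ED \<nu> x (e, Target) = - sol' \<nu> x e (len \<Gamma> e)"
  by (rule end_deriv_solution[where f = "sol \<nu> x", OF assms sol_solves[OF assms]])+

lemma ends_cases:
  assumes "p \<in> ends"
  obtains e where "e \<in> edges \<Gamma>" "p = (e, Source)" | e where "e \<in> edges \<Gamma>" "p = (e, Target)"
  using assms by (cases p rule: end_vertex.cases) (auto simp: ends_def)

lemma EV_lin: "p \<in> ends \<Longrightarrow> EV \<nu> (\<lambda>i. x i + c * y i) p = EV \<nu> x p + c * EV \<nu> y p"
  and ED_lin: "p \<in> ends \<Longrightarrow> ED \<nu> (\<lambda>i. x i + c * y i) p = ED \<nu> x p + c * ED \<nu> y p"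
  by (auto elim!: ends_cases simp: ED_simps sol_lin len_pos less_imp_le simp del: end_deriv.simps)

lemma EV_lim: "p \<in> ends \<Longrightarrow> Z \<longlonglongrightarrow> \<nu> \<Longrightarrow> (\<And>i. (\<lambda>n. X n i) \<longlonglongrightarrow> x i) \<Longrightarrow> (\<lambda>n. EV (Z n) (X n) p) \<longlonglongrightarrow> EV \<nu> x p"
  and ED_lim: "p \<in> ends \<Longrightarrow> Z \<longlonglongrightarrow> \<nu> \<Longrightarrow> (\<And>i. (\<lambda>n. X n i) \<longlonglongrightarrow> x i) \<Longrightarrow> (\<lambda>n. ED (Z n) (X n) p) \<longlonglongrightarrow> ED \<nu> x p"
  by (auto elim!: ends_cases simp: ED_simps len_pos less_imp_le simp del: end_deriv.simps intro!: sol_lim tendsto_minus)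

lemma val_lin: "val \<nu> (\<lambda>i. x i + c * y i) = val \<nu> x + c * val \<nu> y"
  unfolding val_def by (rule EV_lin) (use base_end incident_ends_subset in blast)

lemma dsum_lin: "dsum \<nu> (\<lambda>i. x i + c * y i) = dsum \<nu> x + c * dsum \<nu> y"
proof -
  have "dsum \<nu> (\<lambda>i. x i + c * y i) = (\<Sum>p\<in>ends_at v. ED \<nu> x p + c * ED \<nu> y p)"
    unfolding dsum_def by (intro sum.cong refl ED_lin) (use incident_ends_subset in blast)
  then show ?thesis by (simp add: dsum_def sum.distrib sum_distrib_left)
qed

lemma val_lim: "Z \<longlonglongrightarrow> \<nu> \<Longrightarrow> (\<And>i. (\<lambda>n. X n i) \<longlonglongrightarrow> x i) \<Longrightarrow> (\<lambda>n. val (Z n) (X n)) \<longlonglongrightarrow> val \<nu> x"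
  unfolding val_def using EV_lim base_end incident_ends_subset by blast

lemma dsum_lim: "Z \<longlonglongrightarrow> \<nu> \<Longrightarrow> (\<And>i. (\<lambda>n. X n i) \<longlonglongrightarrow> x i) \<Longrightarrow> (\<lambda>n. dsum (Z n) (X n)) \<longlonglongrightarrow> dsum \<nu> x"
  unfolding dsum_def using incident_ends_subset by (intro tendsto_sum ED_lim) auto

lemma G_lim:
  assumes "Z \<longlonglongrightarrow> \<nu>" "\<And>i. (\<lambda>n. X n i) \<longlonglongrightarrow> x i"
  shows "(\<lambda>n. G (Z n) \<mu> (X n) y) \<longlonglongrightarrow> G \<nu> \<mu> x y"
  unfolding G_def
proof (intro tendsto_sum)
  fix e assume e: "e \<in> edges \<Gamma>"
  show "(\<lambda>n. integral {0..len \<Gamma> e} (\<lambda>s. sol (Z n) (X n) e s * cnj (sol \<mu> y e s)))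
      \<longlonglongrightarrow> integral {0..len \<Gamma> e} (\<lambda>s. sol \<nu> x e s * cnj (sol \<mu> y e s))"
    unfolding sol_def[of _ "X _"] sol_def[of \<nu> x]
    by (rule schroedinger_segment.fund_integral_lim[OF segment[OF e] assms(1) assms(2) assms(2)])
      (intro continuous_intros sol_continuous e)
qed

lemma G_scale: "G \<nu> \<mu> (\<lambda>i. c * x i) y = c * G \<nu> \<mu> x y"
proof -
  have "integral {0..len \<Gamma> e} (\<lambda>s. sol \<nu> (\<lambda>i. c * x i) e s * cnj (sol \<mu> y e s)) =
      c * integral {0..len \<Gamma> e} (\<lambda>s. sol \<nu> x e s * cnj (sol \<mu> y e s))" if "e \<in> edges \<Gamma>" for e
  proof -
    have "integral {0..len \<Gamma> e} (\<lambda>s. sol \<nu> (\<lambda>i. c * x i) e s * cnj (sol \<mu> y e s)) =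
        integral {0..len \<Gamma> e} (\<lambda>s. c * (sol \<nu> x e s * cnj (sol \<mu> y e s)))"
      by (rule integral_cong) (simp add: sol_scale[OF that] mult.assoc)
    then show ?thesis by simp
  qed
  then show ?thesis unfolding G_def by (simp add: sum_distrib_left)
qed

text \<open>A solution on the edges determines its Cauchy data, the derivative at a source included.
  This carries multiples of functions over to multiples of coordinate vectors.\<close>

lemma sol_inj:
  assumes x: "\<And>i. i \<notin> ends \<Longrightarrow> x i = 0" and y: "\<And>i. i \<notin> ends \<Longrightarrow> y i = 0"
    and eq: "\<And>e s. e \<in> edges \<Gamma> \<Longrightarrow> s \<in> {0..len \<Gamma> e} \<Longrightarrow> sol \<nu> x e s = sol \<nu> y e s"
  shows "x = y"
proof
  fix p
  show "x p = y p"
  proof (cases "p \<in> ends")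
    case True
    then obtain e where e: "e \<in> edges \<Gamma>" and p: "p = (e, Source) \<or> p = (e, Target)"
      by (auto elim: ends_cases)
    define z where "z i = x i + (-1) * y i" for i
    have z: "sol \<nu> z e s = 0" if "s \<in> {0..len \<Gamma> e}" for s
      unfolding z_def[abs_def] using sol_lin(1)[OF e that, of \<nu> x "-1" y] eq[OF e that] by simp
    have "z (e, Source) = 0" using z[of 0] sol_0[OF e, of \<nu> z] len_pos[OF e] by simp
    moreover have "z (e, Target) = 0"
      using schroedinger_segment.solves_vanishing[OF segment[OF e] sol_solves[OF e] z] sol'_0[OF e, of \<nu> z] by simp
    ultimately show ?thesis using p by (auto simp: z_def)
  qed (simp add: x y)
qed

lemma G_self: "G \<nu> \<nu> x x = complex_of_real (\<Sum>e\<in>edges \<Gamma>. integral {0..len \<Gamma> e} (\<lambda>s. (cmod (sol \<nu> x e s))\<^sup>2))"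
proof -
  have "integral {0..len \<Gamma> e} (\<lambda>s. sol \<nu> x e s * cnj (sol \<nu> x e s)) =
      complex_of_real (integral {0..len \<Gamma> e} (\<lambda>s. (cmod (sol \<nu> x e s))\<^sup>2))" if e: "e \<in> edges \<Gamma>" for e
  proof -
    have "(\<lambda>s. (cmod (sol \<nu> x e s))\<^sup>2) integrable_on {0..len \<Gamma> e}"
      by (intro integrable_continuous_real continuous_intros sol_continuous e)
    from has_integral_of_real[OF integrable_integral[OF this], where ?'b = complex]
    show ?thesis by (intro integral_unique) (simp only: complex_norm_square)
  qed
  then show ?thesis unfolding G_def by simp
qed

text \<open>A continuous nonnegative function with integral 0 vanishes, so norm 0 would make the
  solution zero on all edges and, by \<open>sol_inj\<close>, its coordinates as well.\<close>

lemma G_pos: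
  assumes x: "x \<in> S \<nu>" "x \<noteq> (\<lambda>i. 0)"
  shows "\<exists>r>0. G \<nu> \<nu> x x = complex_of_real r"
proof -
  have nn: "0 \<le> integral {0..len \<Gamma> e} (\<lambda>s. (cmod (sol \<nu> x e s))\<^sup>2)" if "e \<in> edges \<Gamma>" for e
    by (intro integral_nonneg integrable_continuous_real continuous_intros sol_continuous that) simp
  have "(\<Sum>e\<in>edges \<Gamma>. integral {0..len \<Gamma> e} (\<lambda>s. (cmod (sol \<nu> x e s))\<^sup>2)) \<noteq> 0"
  proof
    assume "(\<Sum>e\<in>edges \<Gamma>. integral {0..len \<Gamma> e} (\<lambda>s. (cmod (sol \<nu> x e s))\<^sup>2)) = 0"
    then have z: "integral {0..len \<Gamma> e} (\<lambda>s. (cmod (sol \<nu> x e s))\<^sup>2) = 0" if "e \<in> edges \<Gamma>" for e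
      using sum_nonneg_0[where f = "\<lambda>e. integral {0..len \<Gamma> e} (\<lambda>s. (cmod (sol \<nu> x e s))\<^sup>2)", OF finite_edges _ _ that] nn
      by blast
    have "x = (\<lambda>i. 0)"
    proof (rule sol_inj)
      fix e s assume e: "e \<in> edges \<Gamma>" and s: "s \<in> {0..len \<Gamma> e}"
      have cont: "continuous_on {0..len \<Gamma> e} (\<lambda>s. (cmod (sol \<nu> x e s))\<^sup>2)"
        by (intro continuous_intros sol_continuous e)
      have "(cmod (sol \<nu> x e s))\<^sup>2 = 0"
        using integral_eq_0_iff[OF cont len_pos[OF e]] z[OF e] s by simp
      then show "sol \<nu> x e s = sol \<nu> (\<lambda>i. 0) e s" using sol_zero[OF e s] by simp
    qed (use x(1) in \<open>auto simp: S_def\<close>)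
    then show False using x(2) by blast
  qed
  moreover have "(\<Sum>e\<in>edges \<Gamma>. integral {0..len \<Gamma> e} (\<lambda>s. (cmod (sol \<nu> x e s))\<^sup>2)) \<ge> 0"
    by (intro sum_nonneg nn)
  ultimately have "(\<Sum>e\<in>edges \<Gamma>. integral {0..len \<Gamma> e} (\<lambda>s. (cmod (sol \<nu> x e s))\<^sup>2)) > 0" by linarith
  then show ?thesis using G_self by blast
qed

lemma vertex_coeffs:
  obtains \<alpha> \<beta> where "\<And>w. w \<in> verts \<Gamma> \<Longrightarrow> lagrangian_coeffs (ends_at w) (\<alpha> w) (\<beta> w)"
    "\<And>w F F'. w \<in> verts \<Gamma> \<Longrightarrow> vertex_cond \<Gamma> w F F' \<longleftrightarrow>
       (\<forall>p\<in>ends_at w. (\<Sum>q\<in>ends_at w. \<alpha> w p q * F q + \<beta> w p q * F' q) = 0)"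
proof -
  define Q where "Q w ab \<longleftrightarrow> lagrangian_coeffs (ends_at w) (fst ab) (snd ab) \<and> (\<forall>F F'. vertex_cond \<Gamma> w F F' \<longleftrightarrow>
       (\<forall>p\<in>ends_at w. (\<Sum>q\<in>ends_at w. fst ab p q * F q + snd ab p q * F' q) = 0))" for w ab
  have "\<forall>w\<in>verts \<Gamma>. \<exists>ab. Q w ab"
  proof
    fix w assume w: "w \<in> verts \<Gamma>"
    obtain \<alpha> \<beta> where "lagrangian_coeffs (ends_at w) \<alpha> \<beta>"
      "\<And>F F'. vertex_cond \<Gamma> w F F' \<longleftrightarrow>
       (\<forall>p\<in>ends_at w. (\<Sum>q\<in>ends_at w. \<alpha> p q * F q + \<beta> p q * F' q) = 0)"
      by (rule self_adjoint_condition_coeffs[OF self_adjoint[OF w]]) (rule that)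
    then have "Q w (\<alpha>, \<beta>)" by (simp add: Q_def)
    then show "\<exists>ab. Q w ab" by blast
  qed
  then obtain ab where ab: "\<forall>w\<in>verts \<Gamma>. Q w (ab w)" using bchoice[of "verts \<Gamma>" Q] by blast
  show ?thesis by (rule that[of "\<lambda>w. fst (ab w)" "\<lambda>w. snd (ab w)"]) (use ab in \<open>simp_all add: Q_def\<close>)
qed

text \<open>The edge terms of \<open>solves_green\<close> are regrouped by vertices.
  \<open>lagrangian_form_zero\<close> removes every vertex except \<open>v\<close>, and continuity
  at \<open>v\<close> lets the common value be factored out there.\<close>

lemma green:
  assumes x: "x \<in> S \<nu>" and y: "y \<in> S \<mu>"
  shows "complex_of_real (\<nu> - \<mu>) * G \<nu> \<mu> x y = dsum \<nu> x * cnj (val \<mu> y) - val \<nu> x * cnj (dsum \<mu> y)"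
proof -
  define b where "b p = ED \<nu> x p * cnj (EV \<mu> y p) - EV \<nu> x p * cnj (ED \<mu> y p)" for p
  obtain \<alpha> \<beta> where lag: "\<And>w. w \<in> verts \<Gamma> \<Longrightarrow> lagrangian_coeffs (ends_at w) (\<alpha> w) (\<beta> w)"
    and vc: "\<And>w F F'. w \<in> verts \<Gamma> \<Longrightarrow> vertex_cond \<Gamma> w F F' \<longleftrightarrow>
       (\<forall>p\<in>ends_at w. (\<Sum>q\<in>ends_at w. \<alpha> w p q * F q + \<beta> w p q * F' q) = 0)"
    by (rule vertex_coeffs) (rule that)
  have "complex_of_real (\<nu> - \<mu>) * G \<nu> \<mu> x y = (\<Sum>e\<in>edges \<Gamma>. b (e, Source) + b (e, Target))"
    unfolding G_def sum_distrib_left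
  proof (intro sum.cong refl)
    fix e assume e: "e \<in> edges \<Gamma>"
    show "complex_of_real (\<nu> - \<mu>) * integral {0..len \<Gamma> e} (\<lambda>s. sol \<nu> x e s * cnj (sol \<mu> y e s)) =
        b (e, Source) + b (e, Target)"
      using schroedinger_segment.solves_green[OF segment[OF e] sol_solves[OF e, of \<nu> x] sol_solves[OF e, of \<mu> y]]
      by (simp add: b_def ED_simps[OF e] del: end_deriv.simps)
  qed
  also have "\<dots> = (\<Sum>w\<in>verts \<Gamma>. \<Sum>p\<in>ends_at w. b p)"
    unfolding sum_ends[symmetric] sum_ends_by_vertex ..
  also have "\<dots> = (\<Sum>p\<in>ends_at v. b p) + (\<Sum>w\<in>verts \<Gamma> - {v}. \<Sum>p\<in>ends_at w. b p)"
    by (rule sum.remove[OF finite_verts v])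
  also have "(\<Sum>w\<in>verts \<Gamma> - {v}. \<Sum>p\<in>ends_at w. b p) = 0"
  proof (rule sum.neutral, rule ballI)
    fix w assume w: "w \<in> verts \<Gamma> - {v}"
    have "vertex_cond \<Gamma> w (EV \<nu> x) (ED \<nu> x)" "vertex_cond \<Gamma> w (EV \<mu> y) (ED \<mu> y)"
      using x y w by (auto simp: S_def)
    then show "(\<Sum>p\<in>ends_at w. b p) = 0"
      unfolding b_def using w vc by (intro lagrangian_form_zero[OF lag[of w]]) auto
  qed
  also have "(\<Sum>p\<in>ends_at v. b p) = (\<Sum>p\<in>ends_at v. ED \<nu> x p * cnj (val \<mu> y) - val \<nu> x * cnj (ED \<mu> y p))"
  proof (intro sum.cong refl)
    fix p assume p: "p \<in> ends_at v"
    have "EV \<nu> x p = val \<nu> x" "EV \<mu> y p = val \<mu> y"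
      unfolding val_def using x y p base_end unfolding S_def by blast+
    then show "b p = ED \<nu> x p * cnj (val \<mu> y) - val \<nu> x * cnj (ED \<mu> y p)" by (simp add: b_def)
  qed
  finally show ?thesis by (simp add: dsum_def sum_subtractf sum_distrib_left sum_distrib_right)
qed

text \<open>The continuity conditions at \<open>v\<close> are one fewer than the ends at \<open>v\<close>.\<close>

lemma S_description:
  obtains R where
    "\<And>\<nu> x. x \<in> S \<nu> \<longleftrightarrow> (\<forall>i. i \<notin> ends \<longrightarrow> x i = 0) \<and> (\<forall>j\<in>ends - {base_end}. R j \<nu> x = 0)"
    "\<And>j \<nu> x c y. j \<in> ends \<Longrightarrow> R j \<nu> (\<lambda>i. x i + c * y i) = R j \<nu> x + c * R j \<nu> y"
    "\<And>j Z \<nu> X x. j \<in> ends \<Longrightarrow> Z \<longlonglongrightarrow> \<nu> \<Longrightarrow> \<forall>i. (\<lambda>n. X n i) \<longlonglongrightarrow> x i \<Longrightarrow> (\<lambda>n. R j (Z n) (X n)) \<longlonglongrightarrow> R j \<nu> x"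
proof -
  obtain \<alpha> \<beta> where vc: "\<And>w F F'. w \<in> verts \<Gamma> \<Longrightarrow> vertex_cond \<Gamma> w F F' \<longleftrightarrow>
       (\<forall>p\<in>ends_at w. (\<Sum>q\<in>ends_at w. \<alpha> w p q * F q + \<beta> w p q * F' q) = 0)"
    by (rule vertex_coeffs) (rule that)
  \<comment> \<open>One equation per end: a row of the vertex condition away from \<open>v\<close>,
    equality with the reference end at \<open>v\<close>. The equation of \<open>base_end\<close> is
    trivial and is left out of the count.\<close>
  define R where "R p \<nu> x = (if end_vertex p = v then EV \<nu> x p - EV \<nu> x base_end
     else (\<Sum>q\<in>ends_at (end_vertex p).
       \<alpha> (end_vertex p) p q * EV \<nu> x q + \<beta> (end_vertex p) p q * ED \<nu> x q))" for p \<nu> x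
  have base: "base_end \<in> ends" "end_vertex base_end = v" using base_end incident_ends_iff by auto
  show ?thesis
  proof (rule that[of R])
    fix \<nu> x
    have 1: "(\<forall>w\<in>verts \<Gamma> - {v}. vertex_cond \<Gamma> w (EV \<nu> x) (ED \<nu> x)) \<longleftrightarrow>
        (\<forall>j\<in>ends. end_vertex j \<noteq> v \<longrightarrow> R j \<nu> x = 0)"
    proof
      assume "\<forall>w\<in>verts \<Gamma> - {v}. vertex_cond \<Gamma> w (EV \<nu> x) (ED \<nu> x)"
      then show "\<forall>j\<in>ends. end_vertex j \<noteq> v \<longrightarrow> R j \<nu> x = 0"
        using vc end_vertex_in_verts by (auto simp: R_def incident_ends_iff)
    next
      assume R: "\<forall>j\<in>ends. end_vertex j \<noteq> v \<longrightarrow> R j \<nu> x = 0"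
      show "\<forall>w\<in>verts \<Gamma> - {v}. vertex_cond \<Gamma> w (EV \<nu> x) (ED \<nu> x)"
      proof
        fix w assume w: "w \<in> verts \<Gamma> - {v}"
        have "(\<Sum>q\<in>ends_at w. \<alpha> w p q * EV \<nu> x q + \<beta> w p q * ED \<nu> x q) = 0"
          if "p \<in> ends_at w" for p
          using R that w unfolding incident_ends_iff[of p] by (auto simp: R_def)
        then show "vertex_cond \<Gamma> w (EV \<nu> x) (ED \<nu> x)" using vc w by blast
      qed
    qed
    have 2: "(\<forall>p\<in>ends_at v. \<forall>q\<in>ends_at v. EV \<nu> x p = EV \<nu> x q) \<longleftrightarrow>
        (\<forall>j\<in>ends. end_vertex j = v \<longrightarrow> R j \<nu> x = 0)"
    proof
      assume c: "\<forall>p\<in>ends_at v. \<forall>q\<in>ends_at v. EV \<nu> x p = EV \<nu> x q"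
      show "\<forall>j\<in>ends. end_vertex j = v \<longrightarrow> R j \<nu> x = 0"
      proof (intro ballI impI)
        fix j assume j: "j \<in> ends" "end_vertex j = v"
        then have "EV \<nu> x j = EV \<nu> x base_end" using c base_end incident_ends_iff by blast
        then show "R j \<nu> x = 0" using j(2) by (simp add: R_def)
      qed
    next
      assume R: "\<forall>j\<in>ends. end_vertex j = v \<longrightarrow> R j \<nu> x = 0"
      have eq: "EV \<nu> x p = EV \<nu> x base_end" if "p \<in> ends_at v" for p
      proof -
        have "end_vertex p = v" "R p \<nu> x = 0" using R that by (auto simp: incident_ends_iff)
        then show ?thesis by (simp add: R_def)
      qed
      show "\<forall>p\<in>ends_at v. \<forall>q\<in>ends_at v. EV \<nu> x p = EV \<nu> x q"
      proof (intro ballI)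
        fix p q assume "p \<in> ends_at v" "q \<in> ends_at v"
        from eq[OF this(1)] eq[OF this(2)] show "EV \<nu> x p = EV \<nu> x q" by (rule trans[OF _ sym])
      qed
    qed
    have rb: "R base_end \<nu> x = 0" by (simp add: R_def base)
    have 3: "((\<forall>j\<in>ends. end_vertex j \<noteq> v \<longrightarrow> R j \<nu> x = 0) \<and> (\<forall>j\<in>ends. end_vertex j = v \<longrightarrow> R j \<nu> x = 0)) \<longleftrightarrow>
        (\<forall>j\<in>ends - {base_end}. R j \<nu> x = 0)"
    proof (intro iffI conjI ballI impI)
      fix j assume "\<forall>j\<in>ends - {base_end}. R j \<nu> x = 0" "j \<in> ends"
      then show "R j \<nu> x = 0" "R j \<nu> x = 0" using rb by (cases "j = base_end"; simp)+
    qed (elim conjE, metis DiffD1)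
    show "x \<in> S \<nu> \<longleftrightarrow> (\<forall>i. i \<notin> ends \<longrightarrow> x i = 0) \<and> (\<forall>j\<in>ends - {base_end}. R j \<nu> x = 0)"
      unfolding S_def mem_Collect_eq 1 2 3 ..
  next
    fix j \<nu> x c y assume j: "j \<in> ends"
    have s: "(\<Sum>q\<in>ends_at w. A q * EV \<nu> (\<lambda>i. x i + c * y i) q + B q * ED \<nu> (\<lambda>i. x i + c * y i) q) =
        (\<Sum>q\<in>ends_at w. A q * EV \<nu> x q + B q * ED \<nu> x q) + c * (\<Sum>q\<in>ends_at w. A q * EV \<nu> y q + B q * ED \<nu> y q)"
      for w A B
    proof -
      have "(\<Sum>q\<in>ends_at w. A q * EV \<nu> (\<lambda>i. x i + c * y i) q + B q * ED \<nu> (\<lambda>i. x i + c * y i) q) =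
        (\<Sum>q\<in>ends_at w. (A q * EV \<nu> x q + B q * ED \<nu> x q) + c * (A q * EV \<nu> y q + B q * ED \<nu> y q))"
      proof (rule sum.cong[OF refl])
        fix q assume "q \<in> ends_at w"
        then have q: "q \<in> ends" by (simp add: incident_ends_iff)
        show "A q * EV \<nu> (\<lambda>i. x i + c * y i) q + B q * ED \<nu> (\<lambda>i. x i + c * y i) q =
            (A q * EV \<nu> x q + B q * ED \<nu> x q) + c * (A q * EV \<nu> y q + B q * ED \<nu> y q)"
          unfolding EV_lin[OF q] ED_lin[OF q] by (simp add: algebra_simps)
      qed
      then show ?thesis by (simp only: sum.distrib[of "\<lambda>q. A q * EV \<nu> x q + B q * ED \<nu> x q"] sum_distrib_left)
    qed
    show "R j \<nu> (\<lambda>i. x i + c * y i) = R j \<nu> x + c * R j \<nu> y"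
      unfolding R_def s EV_lin[OF j] EV_lin[OF base(1)] by (simp add: algebra_simps)
  next
    fix j \<nu> x and Z :: "nat \<Rightarrow> real" and X :: "nat \<Rightarrow> 'e \<times> side \<Rightarrow> complex"
    assume j: "j \<in> ends" and "Z \<longlonglongrightarrow> \<nu>" "\<forall>i. (\<lambda>n. X n i) \<longlonglongrightarrow> x i"
    then have lim: "Z \<longlonglongrightarrow> \<nu>" "\<And>i. (\<lambda>n. X n i) \<longlonglongrightarrow> x i" by blast+
    show "(\<lambda>n. R j (Z n) (X n)) \<longlonglongrightarrow> R j \<nu> x"
    proof (cases "end_vertex j = v")
      case True
      have "(\<lambda>n. EV (Z n) (X n) j - EV (Z n) (X n) base_end) \<longlonglongrightarrow> EV \<nu> x j - EV \<nu> x base_end"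
        by (intro tendsto_diff EV_lim[OF j lim] EV_lim[OF base(1) lim])
      then show ?thesis using True by (simp add: R_def)
    next
      case False
      have "(\<lambda>n. \<Sum>q\<in>ends_at (end_vertex j). \<alpha> (end_vertex j) j q * EV (Z n) (X n) q + \<beta> (end_vertex j) j q * ED (Z n) (X n) q)
          \<longlonglongrightarrow> (\<Sum>q\<in>ends_at (end_vertex j). \<alpha> (end_vertex j) j q * EV \<nu> x q + \<beta> (end_vertex j) j q * ED \<nu> x q)"
        using incident_ends_subset
        by (intro tendsto_sum tendsto_add tendsto_mult tendsto_const EV_lim ED_lim lim) blast+
      then show ?thesis using False by (simp add: R_def)
    qed
  qed
qed

lemma S_supp: "x \<in> S \<nu> \<Longrightarrow> i \<notin> ends \<Longrightarrow> x i = 0"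
  unfolding S_def by blast

lemma S_lin: "x \<in> S \<nu> \<Longrightarrow> y \<in> S \<nu> \<Longrightarrow> (\<lambda>i. x i + c * y i) \<in> S \<nu>"
  and S_closed: "Z \<longlonglongrightarrow> \<nu> \<Longrightarrow> (\<And>n. X n \<in> S (Z n)) \<Longrightarrow> (\<And>i. (\<lambda>n. X n i) \<longlonglongrightarrow> x i) \<Longrightarrow> x \<in> S \<nu>"
  and S_nontrivial: "\<exists>x\<in>S \<nu>. x \<noteq> (\<lambda>i. 0)"
proof -
  obtain R where S_iff: "\<And>\<nu> x. x \<in> S \<nu> \<longleftrightarrow> (\<forall>i. i \<notin> ends \<longrightarrow> x i = 0) \<and> (\<forall>j\<in>ends - {base_end}. R j \<nu> x = 0)"
    and lin: "\<And>j \<nu> x c y. j \<in> ends \<Longrightarrow> R j \<nu> (\<lambda>i. x i + c * y i) = R j \<nu> x + c * R j \<nu> y"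
    and lim: "\<And>j Z \<nu> X x. j \<in> ends \<Longrightarrow> Z \<longlonglongrightarrow> \<nu> \<Longrightarrow> \<forall>i. (\<lambda>n. X n i) \<longlonglongrightarrow> x i \<Longrightarrow> (\<lambda>n. R j (Z n) (X n)) \<longlonglongrightarrow> R j \<nu> x"
    by (rule S_description) (rule that)
  show "(\<lambda>i. x i + c * y i) \<in> S \<nu>" if "x \<in> S \<nu>" "y \<in> S \<nu>" using that by (simp add: S_iff lin)
  show "x \<in> S \<nu>" if h: "Z \<longlonglongrightarrow> \<nu>" "\<And>n. X n \<in> S (Z n)" "\<And>i. (\<lambda>n. X n i) \<longlonglongrightarrow> x i"
  proof -
    have "x i = 0" if "i \<notin> ends" for i
      using h(3)[of i] S_supp[OF h(2) that] by (simp add: LIMSEQ_const_iff)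
    moreover have "R j \<nu> x = 0" if "j \<in> ends - {base_end}" for j
    proof -
      have "(\<lambda>n. R j (Z n) (X n)) \<longlonglongrightarrow> R j \<nu> x" by (rule lim) (use that h in auto)
      moreover have "R j (Z n) (X n) = 0" for n using S_iff h(2) that by blast
      ultimately show ?thesis by (simp add: LIMSEQ_const_iff)
    qed
    ultimately show ?thesis by (simp add: S_iff)
  qed
  have base: "base_end \<in> ends" using base_end incident_ends_subset by blast
  define M where "M j i = R j \<nu> (\<lambda>k. if k = i then 1 else 0)" for j i
  \<comment> \<open>The unknowns are indexed by \<open>ends\<close> too, since each edge has two
    Cauchy data.\<close>
  have "card (ends - {base_end}) < card ends" by (rule card_Diff1_less[OF finite_ends base])
  then obtain x where x: "\<exists>i\<in>ends. x i \<noteq> 0" "\<forall>i. i \<notin> ends \<longrightarrow> x i = 0"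
      "\<forall>j\<in>ends - {base_end}. (\<Sum>i\<in>ends. M j i * x i) = 0"
    using nontrivial_solution[of "ends - {base_end}" ends M] finite_ends by blast
  have "R j \<nu> x = 0" if j: "j \<in> ends - {base_end}" for j
  proof -
    have "R j \<nu> x = (\<Sum>i\<in>ends. M j i * x i)"
      unfolding M_def by (rule linear_functional_coordinates[OF finite_ends]) (use lin j x(2) in auto)
    then show ?thesis using x(3) j by simp
  qed
  then have "x \<in> S \<nu>" using x(2) by (simp add: S_iff)
  moreover have "x \<noteq> (\<lambda>i. 0)" using x(1) by auto
  ultimately show "\<exists>x\<in>S \<nu>. x \<noteq> (\<lambda>i. 0)" by blast
qed

sublocale delta: boundary_pencil ends S val dsum G
  by unfold_locales
    (fact finite_ends S_supp S_lin S_nontrivial S_closed val_lin dsum_lin val_lim dsum_lim G_lim G_scale G_pos green)+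

text \<open>The quarter turn from \<open>(val, dsum)\<close> to \<open>(dsum, - val)\<close>
  preserves the right-hand side of \<open>green\<close>; without the minus sign it would be a
  reflection and reverse it.\<close>

sublocale inverse: boundary_pencil ends S dsum "\<lambda>\<nu> x. - val \<nu> x" G
proof
  fix \<nu> x c y
  show "- val \<nu> (\<lambda>i. x i + c * y i) = - val \<nu> x + c * - val \<nu> y" by (simp add: val_lin)
next
  fix Z :: "nat \<Rightarrow> real" and \<nu> and X :: "nat \<Rightarrow> 'e \<times> side \<Rightarrow> complex" and x
  assume "Z \<longlonglongrightarrow> \<nu>" "\<And>i. (\<lambda>n. X n i) \<longlonglongrightarrow> x i"
  then show "(\<lambda>n. - val (Z n) (X n)) \<longlonglongrightarrow> - val \<nu> x" by (intro tendsto_minus val_lim)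
next
  fix x \<nu> y \<mu> assume "x \<in> S \<nu>" "y \<in> S \<mu>"
  from green[OF this] show "complex_of_real (\<nu> - \<mu>) * G \<nu> \<mu> x y = - val \<nu> x * cnj (dsum \<mu> y) - dsum \<nu> x * cnj (- val \<mu> y)"
    by simp
qed (fact finite_ends S_supp S_lin S_nontrivial S_closed dsum_lin dsum_lim G_lim G_scale G_pos)+

section \<open>Eigenfunctions of the graph as vectors of the pencil\<close>

definition with_cond :: "'e vertex_condition \<Rightarrow> ('v, 'e) quantum_graph" where
  "with_cond K = \<Gamma>\<lparr>vertex_cond := (vertex_cond \<Gamma>)(v := K)\<rparr>"

lemma with_cond_simps [simp]:
  "verts (with_cond K) = verts \<Gamma>" "edges (with_cond K) = edges \<Gamma>" "len (with_cond K) = len \<Gamma>"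
  "potential (with_cond K) = potential \<Gamma>" "vertex_cond (with_cond K) v = K"
  "w \<noteq> v \<Longrightarrow> vertex_cond (with_cond K) w = vertex_cond \<Gamma> w"
  by (simp_all add: with_cond_def)

lemma end_value_with_cond [simp]: "end_value (with_cond K) f = end_value \<Gamma> f"
  and end_deriv_with_cond [simp]: "end_deriv (with_cond K) f = end_deriv \<Gamma> f"
proof -
  have "end_value (with_cond K) f p = end_value \<Gamma> f p" "end_deriv (with_cond K) f p = end_deriv \<Gamma> f p" for p
    by (cases p rule: end_vertex.cases; simp)+
  then show "end_value (with_cond K) f = end_value \<Gamma> f" "end_deriv (with_cond K) f = end_deriv \<Gamma> f" by auto
qed

lemma eigenfunction_iff:
  "eigenfunction (with_cond K) (complex_of_real \<nu>) f \<longleftrightarrow>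
     (\<forall>e\<in>edges \<Gamma>. \<exists>g. solves_on e \<nu> (f e) g) \<and>
     (\<forall>w\<in>verts \<Gamma> - {v}. vertex_cond \<Gamma> w (end_value \<Gamma> f) (end_deriv \<Gamma> f)) \<and>
     K (end_value \<Gamma> f) (end_deriv \<Gamma> f) \<and> (\<exists>e\<in>edges \<Gamma>. \<exists>s\<in>{0..len \<Gamma> e}. f e s \<noteq> 0)"
proof -
  have 1: "(\<exists>g. solves_on e \<nu> (f e) g) \<longleftrightarrow> f e \<in> sobolev_H2 (len \<Gamma> e) \<and>
      (AE x in lebesgue. x \<in> {0..len \<Gamma> e} \<longrightarrow> hamiltonian (with_cond K) f e x = complex_of_real \<nu> * f e x)"
    if "e \<in> edges \<Gamma>" for e
    unfolding schroedinger_segment.solves_iff_eigenvalue_equation[OF segment[OF that]] hamiltonian_def by simp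
  have "(\<forall>w\<in>verts \<Gamma> - {v}. vertex_cond (with_cond K) w (end_value \<Gamma> f) (end_deriv \<Gamma> f)) \<longleftrightarrow>
      (\<forall>w\<in>verts \<Gamma> - {v}. vertex_cond \<Gamma> w (end_value \<Gamma> f) (end_deriv \<Gamma> f))"
    by (intro ball_cong) auto
  moreover have "vertex_cond (with_cond K) v (end_value \<Gamma> f) (end_deriv \<Gamma> f) \<longleftrightarrow> K (end_value \<Gamma> f) (end_deriv \<Gamma> f)"
    by simp
  ultimately have 2: "(\<forall>w\<in>verts \<Gamma>. vertex_cond (with_cond K) w (end_value \<Gamma> f) (end_deriv \<Gamma> f)) \<longleftrightarrow>
      K (end_value \<Gamma> f) (end_deriv \<Gamma> f) \<and> (\<forall>w\<in>verts \<Gamma> - {v}. vertex_cond \<Gamma> w (end_value \<Gamma> f) (end_deriv \<Gamma> f))"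
    using v by blast
  show ?thesis
    unfolding eigenfunction_def hamiltonian_domain_def mem_Collect_eq end_value_with_cond end_deriv_with_cond
      with_cond_simps(1-3) 2
    using 1 by blast
qed

lemma data_solution:
  assumes e: "e \<in> edges \<Gamma>" and g: "solves_on e \<nu> (f e) g"
  shows "data f (e, Source) = f e 0" "data f (e, Target) = g 0"
    "s \<in> {0..len \<Gamma> e} \<Longrightarrow> f e s = sol \<nu> (data f) e s"
    "s \<in> {0..len \<Gamma> e} \<Longrightarrow> g s = sol' \<nu> (data f) e s"
proof -
  have 0: "(0::real) \<in> {0..len \<Gamma> e}" using len_pos[OF e] by simp
  show d: "data f (e, Source) = f e 0" "data f (e, Target) = g 0"
    using e schroedinger_segment.solves_vector_derivative[OF segment[OF e] g 0]
    by (simp_all add: data_def ends_def)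
  show "s \<in> {0..len \<Gamma> e} \<Longrightarrow> f e s = sol \<nu> (data f) e s"
    "s \<in> {0..len \<Gamma> e} \<Longrightarrow> g s = sol' \<nu> (data f) e s"
    unfolding sol_def sol'_def d by (rule schroedinger_segment.solves_eq_fund[OF segment[OF e] g]; assumption)+
qed

lemma data_supp: "i \<notin> ends \<Longrightarrow> data f i = 0"
  by (simp add: data_def)

lemma end_value_data:
  assumes f: "\<forall>e\<in>edges \<Gamma>. \<exists>g. solves_on e \<nu> (f e) g" and p: "p \<in> ends"
  shows "end_value \<Gamma> f p = EV \<nu> (data f) p" "end_deriv \<Gamma> f p = ED \<nu> (data f) p"
proof -
  obtain e where e: "e \<in> edges \<Gamma>" and pe: "p = (e, Source) \<or> p = (e, Target)"
    using p by (auto elim: ends_cases)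
  obtain g where g: "solves_on e \<nu> (f e) g" using f e by blast
  have L: "0 \<in> {0..len \<Gamma> e}" "len \<Gamma> e \<in> {0..len \<Gamma> e}" using len_pos[OF e] by auto
  note d = data_solution(3,4)[where f = f, OF e g]
  show "end_value \<Gamma> f p = EV \<nu> (data f) p" using pe d(1)[OF L(1)] d(1)[OF L(2)] by auto
  show "end_deriv \<Gamma> f p = ED \<nu> (data f) p"
    using pe d(2)[OF L(1)] d(2)[OF L(2)] end_deriv_solution[where f = f, OF e g] ED_simps[OF e, of \<nu> "data f"]
    by (auto simp del: end_deriv.simps)
qed

text \<open>An eigenfunction and its encoded copy agree only on the segments, so the conditions must
  be insensitive to everything but the incident ends. The coefficient form shows that they
  are.\<close>

lemma vertex_cond_cong:
  assumes w: "w \<in> verts \<Gamma>" and "\<And>p. p \<in> ends_at w \<Longrightarrow> F p = H p" "\<And>p. p \<in> ends_at w \<Longrightarrow> F' p = H' p"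
  shows "vertex_cond \<Gamma> w F F' \<longleftrightarrow> vertex_cond \<Gamma> w H H'"
proof -
  obtain \<alpha> \<beta> where vc: "\<And>w F F'. w \<in> verts \<Gamma> \<Longrightarrow> vertex_cond \<Gamma> w F F' \<longleftrightarrow>
       (\<forall>p\<in>ends_at w. (\<Sum>q\<in>ends_at w. \<alpha> w p q * F q + \<beta> w p q * F' q) = 0)"
    by (rule vertex_coeffs) (rule that)
  show ?thesis unfolding vc[OF w] using assms(2,3) by (simp cong: sum.cong)
qed

text \<open>Covers both families at once. \<open>K_cong\<close> plays the part of
  \<open>vertex_cond_cong\<close> at \<open>v\<close>, and \<open>K_pencil\<close> reads the
  condition on encoded solutions as continuity plus the equation of the pencil.\<close>

context
  fixes a b :: "real \<Rightarrow> ('e \<times> side \<Rightarrow> complex) \<Rightarrow> complex" and K :: "real \<Rightarrow> 'e vertex_condition"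
  assumes pencil: "boundary_pencil ends S a b G"
    and K_cong: "\<And>t F F' H H'. (\<And>p. p \<in> ends_at v \<Longrightarrow> F p = H p) \<Longrightarrow>
        (\<And>p. p \<in> ends_at v \<Longrightarrow> F' p = H' p) \<Longrightarrow> K t F F' \<longleftrightarrow> K t H H'"
    and K_pencil: "\<And>t \<nu> x. K t (EV \<nu> x) (ED \<nu> x) \<longleftrightarrow>
        (\<forall>p\<in>ends_at v. \<forall>q\<in>ends_at v. EV \<nu> x p = EV \<nu> x q) \<and> b \<nu> x = complex_of_real t * a \<nu> x"
begin

interpretation P: boundary_pencil ends S a b G by (rule pencil)

lemma eigenfunction_imp_eigenspace:
  assumes "eigenfunction (with_cond (K t)) (complex_of_real \<nu>) f"
  shows "data f \<in> P.eigenspace t \<nu>" "data f \<noteq> (\<lambda>i. 0)"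
    "\<And>e s. e \<in> edges \<Gamma> \<Longrightarrow> s \<in> {0..len \<Gamma> e} \<Longrightarrow> f e s = sol \<nu> (data f) e s"
proof -
  have sol: "\<forall>e\<in>edges \<Gamma>. \<exists>g. solves_on e \<nu> (f e) g"
    and vc: "\<forall>w\<in>verts \<Gamma> - {v}. vertex_cond \<Gamma> w (end_value \<Gamma> f) (end_deriv \<Gamma> f)"
    and Kf: "K t (end_value \<Gamma> f) (end_deriv \<Gamma> f)" and nz: "\<exists>e\<in>edges \<Gamma>. \<exists>s\<in>{0..len \<Gamma> e}. f e s \<noteq> 0"
    using assms unfolding eigenfunction_iff by blast+
  show eq: "f e s = sol \<nu> (data f) e s" if "e \<in> edges \<Gamma>" "s \<in> {0..len \<Gamma> e}" for e s
    using sol that data_solution(3)[where f = f] by blast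
  have ends_eq: "end_value \<Gamma> f p = EV \<nu> (data f) p" "end_deriv \<Gamma> f p = ED \<nu> (data f) p"
    if "p \<in> ends_at w" for p w
    using end_value_data[OF sol] that incident_ends_subset by blast+
  have "vertex_cond \<Gamma> w (EV \<nu> (data f)) (ED \<nu> (data f))" if w: "w \<in> verts \<Gamma> - {v}" for w
    using vc w vertex_cond_cong[of w "end_value \<Gamma> f" "EV \<nu> (data f)" "end_deriv \<Gamma> f" "ED \<nu> (data f)"] ends_eq
    by blast
  moreover have "K t (EV \<nu> (data f)) (ED \<nu> (data f))"
    using Kf K_cong[of "end_value \<Gamma> f" "EV \<nu> (data f)" "end_deriv \<Gamma> f" "ED \<nu> (data f)" t] ends_eq by blast
  ultimately show "data f \<in> P.eigenspace t \<nu>"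
    unfolding P.eigenspace_def S_def K_pencil using data_supp by blast
  show "data f \<noteq> (\<lambda>i. 0)"
  proof
    assume z: "data f = (\<lambda>i. 0)"
    obtain e s where es: "e \<in> edges \<Gamma>" "s \<in> {0..len \<Gamma> e}" "f e s \<noteq> 0" using nz by blast
    then show False using eq[OF es(1,2)] sol_zero[OF es(1,2)] by (simp add: z)
  qed
qed

lemma eigenspace_imp_eigenfunction:
  assumes x: "x \<in> P.eigenspace t \<nu>" "x \<noteq> (\<lambda>i. 0)"
  shows "eigenfunction (with_cond (K t)) (complex_of_real \<nu>) (sol \<nu> x)"
proof -
  have xS: "x \<in> S \<nu>" and bx: "b \<nu> x = complex_of_real t * a \<nu> x"
    using x(1) by (auto simp: P.eigenspace_def)
  have "\<exists>e\<in>edges \<Gamma>. \<exists>s\<in>{0..len \<Gamma> e}. sol \<nu> x e s \<noteq> 0"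
  proof (rule ccontr)
    assume "\<not> ?thesis"
    then have "sol \<nu> x e s = sol \<nu> (\<lambda>i. 0) e s" if "e \<in> edges \<Gamma>" "s \<in> {0..len \<Gamma> e}" for e s
      using sol_zero[OF that] that by simp
    then have "x = (\<lambda>i. 0)" by (rule sol_inj[rotated 2]) (use S_supp[OF xS] in auto)
    then show False using x(2) by blast
  qed
  moreover have "K t (EV \<nu> x) (ED \<nu> x)" using xS bx unfolding K_pencil S_def by blast
  moreover have "\<forall>w\<in>verts \<Gamma> - {v}. vertex_cond \<Gamma> w (EV \<nu> x) (ED \<nu> x)" using xS unfolding S_def by blast
  moreover have "\<forall>e\<in>edges \<Gamma>. \<exists>g. solves_on e \<nu> (sol \<nu> x e) g" using sol_solves by blast
  ultimately show ?thesis unfolding eigenfunction_iff by blast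
qed

lemma simple_eigenvalue_iff:
  "simple_eigenvalue (with_cond (K t)) (complex_of_real \<nu>) \<longleftrightarrow> P.simple t \<nu>"
proof
  assume "simple_eigenvalue (with_cond (K t)) (complex_of_real \<nu>)"
  then obtain f where f: "eigenfunction (with_cond (K t)) (complex_of_real \<nu>) f"
    and uniq: "\<And>g. eigenfunction (with_cond (K t)) (complex_of_real \<nu>) g \<Longrightarrow>
       \<exists>c. \<forall>e\<in>edges \<Gamma>. \<forall>s\<in>{0..len \<Gamma> e}. g e s = c * f e s"
    unfolding simple_eigenvalue_def by auto
  note f' = eigenfunction_imp_eigenspace[OF f]
  have "\<exists>c. y = (\<lambda>i. c * data f i)" if y: "y \<in> P.eigenspace t \<nu>" for y
  \<comment> \<open>The zero vector lies in the eigenspace but is no eigenfunction, so it gets its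
    multiple \<open>c = 0\<close> separately.\<close>
  proof (cases "y = (\<lambda>i. 0)")
    case True
    then show ?thesis by (intro exI[of _ 0]) simp
  next
    case False
    from uniq[OF eigenspace_imp_eigenfunction[OF y False]] obtain c
      where c: "\<And>e s. e \<in> edges \<Gamma> \<Longrightarrow> s \<in> {0..len \<Gamma> e} \<Longrightarrow> sol \<nu> y e s = c * f e s" by blast
    have "y = (\<lambda>i. c * data f i)"
    proof (rule sol_inj)
      show "y i = 0" if "i \<notin> ends" for i using y that S_supp unfolding P.eigenspace_def by blast
      show "c * data f i = 0" if "i \<notin> ends" for i using data_supp[OF that] by simp
      show "sol \<nu> y e s = sol \<nu> (\<lambda>i. c * data f i) e s" if "e \<in> edges \<Gamma>" "s \<in> {0..len \<Gamma> e}" for e s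
        using c[OF that] f'(3)[OF that] sol_scale[OF that] by simp
    qed
    then show ?thesis by blast
  qed
  then show "P.simple t \<nu>" unfolding P.simple_def using f' by blast
next
  assume "P.simple t \<nu>"
  then obtain x where x: "x \<in> P.eigenspace t \<nu>" "x \<noteq> (\<lambda>i. 0)"
    and uniq: "\<And>y. y \<in> P.eigenspace t \<nu> \<Longrightarrow> \<exists>c. y = (\<lambda>i. c * x i)"
    unfolding P.simple_def by blast
  have "\<exists>c. \<forall>e\<in>edges \<Gamma>. \<forall>s\<in>{0..len \<Gamma> e}. g e s = c * sol \<nu> x e s"
    if g: "eigenfunction (with_cond (K t)) (complex_of_real \<nu>) g" for g
  proof -
    note g' = eigenfunction_imp_eigenspace[OF g]
    obtain c where "data g = (\<lambda>i. c * x i)" using uniq[OF g'(1)] by blast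
    then show ?thesis using g'(3) sol_scale by (intro exI[of _ c] ballI) simp
  qed
  then show "simple_eigenvalue (with_cond (K t)) (complex_of_real \<nu>)"
    unfolding simple_eigenvalue_def using eigenspace_imp_eigenfunction[OF x] by auto
qed

lemma simple_eigenvalue_branch_iff:
  "simple_eigenvalue_branch (\<lambda>t. with_cond (K t)) t \<mu> lam \<longleftrightarrow> P.branch t \<mu> lam"
  unfolding simple_eigenvalue_branch_def P.branch_def simple_eigenvalue_iff ..

lemma simple_eigenvalue_branch_exists:
  assumes "simple_eigenvalue (with_cond (K t)) (complex_of_real \<mu>)"
  shows "\<exists>lam. simple_eigenvalue_branch (\<lambda>t. with_cond (K t)) t \<mu> lam"
  using P.branch_exists assms unfolding simple_eigenvalue_iff simple_eigenvalue_branch_iff by blast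

lemma simple_eigenvalue_branch_deriv:
  assumes br: "simple_eigenvalue_branch (\<lambda>t. with_cond (K t)) t \<mu> lam"
    and f: "normalized_eigenfunction (with_cond (K t)) (complex_of_real \<mu>) f"
  shows "(lam has_real_derivative (cmod (a \<mu> (data f)))\<^sup>2) (at t)"
proof (rule P.branch_has_derivative)
  have ef: "eigenfunction (with_cond (K t)) (complex_of_real \<mu>) f"
    and n: "(\<Sum>e\<in>edges \<Gamma>. LINT x:{0..len \<Gamma> e}|lebesgue. (cmod (f e x))\<^sup>2) = 1"
    using f unfolding normalized_eigenfunction_def by simp_all
  note f' = eigenfunction_imp_eigenspace[OF ef]
  show "P.branch t \<mu> lam" using br unfolding simple_eigenvalue_branch_iff .
  show "data f \<in> P.eigenspace t \<mu>" by (rule f'(1))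
  \<comment> \<open>\<open>f\<close> and its encoded copy agree on the edges, so the normalization
    of \<open>f\<close> is the one that \<open>G_self\<close> expresses.\<close>
  have "(LINT x:{0..len \<Gamma> e}|lebesgue. (cmod (f e x))\<^sup>2) = integral {0..len \<Gamma> e} (\<lambda>s. (cmod (sol \<mu> (data f) e s))\<^sup>2)"
    if e: "e \<in> edges \<Gamma>" for e
  proof -
    have "(LINT x:{0..len \<Gamma> e}|lebesgue. (cmod (f e x))\<^sup>2) = (LINT s:{0..len \<Gamma> e}|lebesgue. (cmod (sol \<mu> (data f) e s))\<^sup>2)"
      by (rule set_lebesgue_integral_cong) (use f'(3)[OF e] in auto)
    also have "\<dots> = integral {0..len \<Gamma> e} (\<lambda>s. (cmod (sol \<mu> (data f) e s))\<^sup>2)"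
      by (intro set_lebesgue_integral_eq_integral(2) absolutely_integrable_continuous_real continuous_intros sol_continuous e)
    finally show ?thesis .
  qed
  then show "G \<mu> \<mu> (data f) (data f) = 1" unfolding G_self using n by simp
qed

lemma eigenfunction_val:
  assumes "eigenfunction (with_cond (K t)) (complex_of_real \<mu>) f"
  shows "vertex_value \<Gamma> f v = val \<mu> (data f)" "vertex_deriv_sum \<Gamma> f v = dsum \<mu> (data f)"
proof -
  have sol: "\<forall>e\<in>edges \<Gamma>. \<exists>g. solves_on e \<mu> (f e) g" using assms unfolding eigenfunction_iff by blast
  have ends_eq: "end_value \<Gamma> f p = EV \<mu> (data f) p" "end_deriv \<Gamma> f p = ED \<mu> (data f) p"
    if "p \<in> ends_at v" for p
    using end_value_data[OF sol] that incident_ends_subset by blast+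
  have "data f \<in> S \<mu>" using eigenfunction_imp_eigenspace(1)[OF assms] unfolding P.eigenspace_def by blast
  then have "EV \<mu> (data f) p = val \<mu> (data f)" if "p \<in> ends_at v" for p
    using that base_end unfolding S_def val_def by blast
  then have c: "\<forall>p\<in>ends_at v. end_value \<Gamma> f p = val \<mu> (data f)" using ends_eq(1) by simp
  show "vertex_value \<Gamma> f v = val \<mu> (data f)"
    unfolding vertex_value_def
  proof (rule the_equality[where P = "\<lambda>c. \<forall>p\<in>ends_at v. end_value \<Gamma> f p = c", OF c])
    fix d assume "\<forall>p\<in>ends_at v. end_value \<Gamma> f p = d"
    \<comment> \<open>At least one end lies at \<open>v\<close>, so the common value is unique and
      the definite description is meaningful.\<close>
    with c base_end show "d = val \<mu> (data f)" by metis
  qed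
  show "vertex_deriv_sum \<Gamma> f v = dsum \<mu> (data f)"
    unfolding vertex_deriv_sum_def dsum_def by (intro sum.cong refl ends_eq)
qed

end

lemma with_delta_eq: "with_delta \<Gamma> v = (\<lambda>t. with_cond (delta_condition (ends_at v) t))"
  and with_inverse_delta_eq:
    "with_inverse_delta \<Gamma> v = (\<lambda>t. with_cond (inverse_delta_condition (ends_at v) t))"
  unfolding with_delta_def[abs_def] with_inverse_delta_def[abs_def] with_cond_def by simp_all

text \<open>Continuity reduces the equation demanded at every end to the one at
  \<open>base_end\<close>.\<close>

lemma delta_condition_iff:
  "delta_condition (ends_at v) t (EV \<nu> x) (ED \<nu> x) \<longleftrightarrow>
     (\<forall>p\<in>ends_at v. \<forall>q\<in>ends_at v. EV \<nu> x p = EV \<nu> x q) \<and>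
     dsum \<nu> x = complex_of_real t * val \<nu> x"
  unfolding delta_condition_def dsum_def val_def using base_end by metis

lemma inverse_delta_condition_iff:
  "inverse_delta_condition (ends_at v) t (EV \<nu> x) (ED \<nu> x) \<longleftrightarrow>
     (\<forall>p\<in>ends_at v. \<forall>q\<in>ends_at v. EV \<nu> x p = EV \<nu> x q) \<and>
     - val \<nu> x = complex_of_real t * dsum \<nu> x"
  unfolding inverse_delta_condition_def dsum_def val_def using base_end by metis

lemma delta_branch:
  assumes s: "simple_eigenvalue (with_delta \<Gamma> v \<alpha>) (complex_of_real \<mu>)"
  shows "\<exists>lam. simple_eigenvalue_branch (with_delta \<Gamma> v) \<alpha> \<mu> lam"
  unfolding with_delta_eq
  by (rule simple_eigenvalue_branch_exists[where a = val and b = dsum and K = "delta_condition (ends_at v)"])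
    (fact delta.boundary_pencil_axioms delta_cong(1) delta_condition_iff s[unfolded with_delta_eq])+

lemma inverse_delta_branch:
  assumes s: "simple_eigenvalue (with_inverse_delta \<Gamma> v \<zeta>) (complex_of_real \<mu>)"
  shows "\<exists>lam. simple_eigenvalue_branch (with_inverse_delta \<Gamma> v) \<zeta> \<mu> lam"
  unfolding with_inverse_delta_eq
  by (rule simple_eigenvalue_branch_exists[where a = dsum and b = "\<lambda>\<nu> x. - val \<nu> x"
        and K = "inverse_delta_condition (ends_at v)"])
    (fact inverse.boundary_pencil_axioms delta_cong(2) inverse_delta_condition_iff s[unfolded with_inverse_delta_eq])+

lemma delta_branch_deriv:
  assumes br: "simple_eigenvalue_branch (with_delta \<Gamma> v) \<alpha> \<mu> lam"
    and f: "normalized_eigenfunction (with_delta \<Gamma> v \<alpha>) (complex_of_real \<mu>) f"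
  shows "(lam has_real_derivative (cmod (vertex_value \<Gamma> f v))\<^sup>2) (at \<alpha>)"
proof -
  have "eigenfunction (with_delta \<Gamma> v \<alpha>) (complex_of_real \<mu>) f"
    using f unfolding normalized_eigenfunction_def by blast
  note ef = this[unfolded with_delta_eq]
  have "vertex_value \<Gamma> f v = val \<mu> (data f)"
    by (rule eigenfunction_val(1)[where a = val and b = dsum and K = "delta_condition (ends_at v)"])
      (fact delta.boundary_pencil_axioms delta_cong(1) delta_condition_iff ef)+
  moreover have "(lam has_real_derivative (cmod (val \<mu> (data f)))\<^sup>2) (at \<alpha>)"
    by (rule simple_eigenvalue_branch_deriv[where a = val and b = dsum and K = "delta_condition (ends_at v)"])
      (fact delta.boundary_pencil_axioms delta_cong(1) delta_condition_iff br[unfolded with_delta_eq] f[unfolded with_delta_eq])+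
  ultimately show ?thesis by simp
qed

lemma inverse_delta_branch_deriv:
  assumes br: "simple_eigenvalue_branch (with_inverse_delta \<Gamma> v) \<zeta> \<mu> lam"
    and f: "normalized_eigenfunction (with_inverse_delta \<Gamma> v \<zeta>) (complex_of_real \<mu>) f"
  shows "(lam has_real_derivative (cmod (vertex_deriv_sum \<Gamma> f v))\<^sup>2) (at \<zeta>)"
proof -
  have "eigenfunction (with_inverse_delta \<Gamma> v \<zeta>) (complex_of_real \<mu>) f"
    using f unfolding normalized_eigenfunction_def by blast
  note ef = this[unfolded with_inverse_delta_eq]
  have "vertex_deriv_sum \<Gamma> f v = dsum \<mu> (data f)"
    by (rule eigenfunction_val(2)[where a = dsum and b = "\<lambda>\<nu> x. - val \<nu> x"
          and K = "inverse_delta_condition (ends_at v)"])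
      (fact inverse.boundary_pencil_axioms delta_cong(2) inverse_delta_condition_iff ef)+
  moreover have "(lam has_real_derivative (cmod (dsum \<mu> (data f)))\<^sup>2) (at \<zeta>)"
    by (rule simple_eigenvalue_branch_deriv[where a = dsum and b = "\<lambda>\<nu> x. - val \<nu> x"
          and K = "inverse_delta_condition (ends_at v)"])
      (fact inverse.boundary_pencil_axioms delta_cong(2) inverse_delta_condition_iff
        br[unfolded with_inverse_delta_eq] f[unfolded with_inverse_delta_eq])+
  ultimately show ?thesis by simp
qed

end

theorem proposition4p2:
  fixes \<Gamma> :: "('v, 'e) quantum_graph" and v :: 'v
  assumes "compact_quantum_graph \<Gamma>"
    and "v \<in> verts \<Gamma>"
    and "incident_ends \<Gamma> v \<noteq> {}"
  shows
    "(\<forall>\<alpha> \<mu>. simple_eigenvalue (with_delta \<Gamma> v \<alpha>) (complex_of_real \<mu>) \<longrightarrow>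
        (\<exists>lam. simple_eigenvalue_branch (with_delta \<Gamma> v) \<alpha> \<mu> lam) \<and>
        (\<forall>lam f. simple_eigenvalue_branch (with_delta \<Gamma> v) \<alpha> \<mu> lam \<and>
            normalized_eigenfunction (with_delta \<Gamma> v \<alpha>) (complex_of_real \<mu>) f \<longrightarrow>
            (lam has_real_derivative (cmod (vertex_value \<Gamma> f v))\<^sup>2) (at \<alpha>)))
     \<and>
     (\<forall>\<zeta> \<mu>. simple_eigenvalue (with_inverse_delta \<Gamma> v \<zeta>) (complex_of_real \<mu>) \<longrightarrow>
        (\<exists>lam. simple_eigenvalue_branch (with_inverse_delta \<Gamma> v) \<zeta> \<mu> lam) \<and>
        (\<forall>lam f. simple_eigenvalue_branch (with_inverse_delta \<Gamma> v) \<zeta> \<mu> lam \<and>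
            normalized_eigenfunction (with_inverse_delta \<Gamma> v \<zeta>) (complex_of_real \<mu>) f \<longrightarrow>
            (lam has_real_derivative (cmod (vertex_deriv_sum \<Gamma> f v))\<^sup>2) (at \<zeta>)))"
proof -
  interpret graph_with_vertex \<Gamma> v by unfold_locales (fact assms)+
  show ?thesis
    using delta_branch delta_branch_deriv inverse_delta_branch inverse_delta_branch_deriv by blast
qed

end
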